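(* Let $p$ be a prime, $u$ a nonnegative integer and $\ell$ a positive integer, and let $\mathcal{K}$ be a fixed set of number fields ordered by the absolute value of their discriminants. Assume that for every integer partition $\lambda=1^{m_1}2^{m_2}\cdots\ell^{m_\ell}$, as $K$ varies over $\mathcal{K}$, the average of $|\mathrm{Cl}(K)[p]|^{m_1}\cdots|\mathrm{Cl}(K)[p^\ell]|^{m_\ell}$ is equal to $\sum_{\mu\subseteq\lambda}C_{\lambda,\mu}(p)p^{-u|\mu|}$. Then for any integers $\mu_1\geq\mu_2\geq\cdots\geq\mu_\ell\geq0$, as $K$ varies over $\mathcal{K}$, the probability that $\mathrm{rk}_{p^j}(\mathrm{Cl}(K))=\mu_j$ for all $1\leq j\leq\ell$ is equal to $$\frac{(1/p^{u+\mu_\ell+1};1/p)_\infty}{p^{\mu_1^2+\cdots+\mu_\ell^2+u(\mu_1+\cdots+\mu_\ell)}\prod_{j=1}^{\ell}(1/p;1/p)_{\mu_j-\mu_{j+1}}},$$ where $\mu_{\ell+1}:=0$.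
   Context: $\mathrm{Cl}(K)$ is the class group of $K$ and $\mathrm{disc}(K)$ its discriminant. A real function $f$ on isomorphism classes of finite abelian groups has average value $c$ over $\mathcal{K}$ if $\sum_{K\in\mathcal{K},|\mathrm{disc}(K)|<X}f(\mathrm{Cl}(K))=(c+o(1))\sum_{K\in\mathcal{K},|\mathrm{disc}(K)|<X}1$ as $X\to\infty$; for $f$ an indicator function of a property, $c$ is its probability. For a finite abelian group $G$, $G[n]$ is the $n$-torsion and $\mathrm{rk}_{p^j}(G)=\dim_{\mathbb{F}_p}p^{j-1}G/p^jG$. For $|q|<1$: $(a;q)_0=1$, $(a;q)_k=\prod_{i=0}^{k-1}(1-aq^i)$, $(a;q)_\infty=\lim_k(a;q)_k$, $\binom{n}{k}_q=\frac{(q;q)_n}{(q;q)_k(q;q)_{n-k}}$. A partition $\lambda=1^{m_1}\cdots\ell^{m_\ell}$ has $m_i$ parts equal to $i$; $|\lambda|$ is the sum of parts; the conjugate $\lambda'$ has $\lambda'_k=\sum_{j\geq k}m_j$; $\mu\subseteq\lambda$ means $\mu_i\leq\lambda_i$ for all $i$, and sums over $\mu\subseteq\lambda$ range over all such partitions. $C_{\lambda,\mu}(p)=p^{\sum_{i\geq1}\mu'_{i+1}(\lambda'_i-\mu'_i)}\prod_{i\geq1}\binom{\lambda'_i-\mu'_{i+1}}{\lambda'_i-\mu'_i}_{p}$. *)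

theory Defs
  imports
    Complex_Main
    "HOL-Library.FuncSet"
    "HOL-Library.Multiset"
    "HOL-Computational_Algebra.Polynomial"
    "HOL-Computational_Algebra.Primes"
    "HOL-Algebra.Coset"
    "HOL-Number_Theory.Residues"
    "Jordan_Normal_Form.Determinant"
    "Jordan_Normal_Form.Missing_VectorSpace"
begin

section \<open>Number fields\<close>

text \<open>
  Every number field is isomorphic to a subfield of the complex numbers, and such a subfield
  is a number field iff it is spanned over the rationals by a finite set.
\<close>

definition number_field :: "complex set \<Rightarrow> bool" where
  "number_field K \<longleftrightarrow>
     1 \<in> K \<and>
     (\<forall>x\<in>K. \<forall>y\<in>K. x - y \<in> K \<and> x * y \<in> K) \<and>
     (\<forall>x\<in>K. inverse x \<in> K) \<and>
     (\<exists>B. finite B \<and> K = {\<Sum>b\<in>B. of_rat (c b) * b | c :: complex \<Rightarrow> rat. True})"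

definition ring_of_integers :: "complex set \<Rightarrow> complex set" where
  "ring_of_integers K = {x \<in> K. algebraic_int x}"

text \<open>
  Field homomorphisms into the complex numbers, made extensional (\<open>undefined\<close> outside
  \<open>K\<close>) so that distinct elements of the set are distinct as maps on \<open>K\<close>.
\<close>

definition embeddings :: "complex set \<Rightarrow> (complex \<Rightarrow> complex) set" where
  "embeddings K =
     {\<sigma> \<in> K \<rightarrow>\<^sub>E UNIV. \<sigma> 1 = 1 \<and>
        (\<forall>x\<in>K. \<forall>y\<in>K. \<sigma> (x + y) = \<sigma> x + \<sigma> y \<and> \<sigma> (x * y) = \<sigma> x * \<sigma> y)}"

definition field_trace :: "complex set \<Rightarrow> complex \<Rightarrow> complex" where
  "field_trace K x = (\<Sum>\<sigma>\<in>embeddings K. \<sigma> x)"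

definition integral_basis :: "complex set \<Rightarrow> complex list \<Rightarrow> bool" where
  "integral_basis K bs \<longleftrightarrow>
     set bs \<subseteq> ring_of_integers K \<and>
     (\<forall>x\<in>ring_of_integers K.
        \<exists>!c :: int list. length c = length bs \<and> x = (\<Sum>i<length bs. of_int (c ! i) * bs ! i))"

definition disc :: "complex set \<Rightarrow> int" where
  "disc K = (THE d. \<exists>bs. integral_basis K bs \<and>
     of_int d = det (mat (length bs) (length bs) (\<lambda>(i, j). field_trace K (bs ! i * bs ! j))))"


section \<open>Class groups\<close>

definition fractional_ideal :: "complex set \<Rightarrow> complex set \<Rightarrow> bool" where
  "fractional_ideal K I \<longleftrightarrow>
     I \<subseteq> K \<and> 0 \<in> I \<and> I \<noteq> {0} \<and>
     (\<forall>x\<in>I. \<forall>y\<in>I. x + y \<in> I) \<and>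
     (\<forall>a\<in>ring_of_integers K. \<forall>x\<in>I. a * x \<in> I) \<and>
     (\<exists>d\<in>ring_of_integers K. d \<noteq> 0 \<and> (\<forall>x\<in>I. d * x \<in> ring_of_integers K))"

definition ideal_mult :: "complex set \<Rightarrow> complex set \<Rightarrow> complex set" where
  "ideal_mult I J =
     {\<Sum>i<n. a i * b i | (n :: nat) a b. \<forall>i<n. a i \<in> I \<and> b i \<in> J}"

definition fractional_ideals :: "complex set \<Rightarrow> complex set monoid" where
  "fractional_ideals K =
     \<lparr>carrier = {I. fractional_ideal K I}, monoid.mult = ideal_mult, one = ring_of_integers K\<rparr>"

text \<open>
  The ring of integers is a Dedekind domain, so every nonzero fractional ideal is invertible
  and \<open>units_of\<close> keeps all of them.
\<close>

definition ideal_group :: "complex set \<Rightarrow> complex set monoid" where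
  "ideal_group K = units_of (fractional_ideals K)"

definition principal_ideals :: "complex set \<Rightarrow> complex set set" where
  "principal_ideals K = {(\<lambda>a. x * a) ` ring_of_integers K | x. x \<in> K \<and> x \<noteq> 0}"

definition class_group :: "complex set \<Rightarrow> complex set set monoid" where
  "class_group K = ideal_group K Mod principal_ideals K"


section \<open>Averages and probabilities over a set of number fields\<close>

definition has_average ::
  "complex set set \<Rightarrow> (complex set set monoid \<Rightarrow> real) \<Rightarrow> real \<Rightarrow> bool" where
  "has_average \<K> f c \<longleftrightarrow>
     (\<exists>\<epsilon> :: real \<Rightarrow> real. (\<epsilon> \<longlongrightarrow> 0) at_top \<and>
        (\<forall>X. (\<Sum>K\<in>{K \<in> \<K>. real_of_int \<bar>disc K\<bar> < X}. f (class_group K)) =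
             (c + \<epsilon> X) * (\<Sum>K\<in>{K \<in> \<K>. real_of_int \<bar>disc K\<bar> < X}. 1)))"

definition has_probability ::
  "complex set set \<Rightarrow> (complex set set monoid \<Rightarrow> bool) \<Rightarrow> real \<Rightarrow> bool" where
  "has_probability \<K> P c \<longleftrightarrow> has_average \<K> (\<lambda>G. of_bool (P G)) c"


section \<open>Torsion and ranks of abelian groups\<close>

definition torsion :: "('a, 'b) monoid_scheme \<Rightarrow> nat \<Rightarrow> 'a set" where
  "torsion G n = {x \<in> carrier G. x [^]\<^bsub>G\<^esub> n = \<one>\<^bsub>G\<^esub>}"

definition multiples :: "('a, 'b) monoid_scheme \<Rightarrow> nat \<Rightarrow> 'a set" where
  "multiples G n = (\<lambda>x. x [^]\<^bsub>G\<^esub> n) ` carrier G"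

text \<open>
  An abelian group \<open>Q\<close> of exponent \<open>p\<close>, written multiplicatively, as a module over the
  integers modulo \<open>p\<close>. The ring multiplication and unit of a module record carry no
  meaning; they are filled arbitrarily.
\<close>

definition module_of_group :: "('a, 'b) monoid_scheme \<Rightarrow> (int, 'a) module" where
  "module_of_group Q =
     \<lparr>carrier = carrier Q, monoid.mult = monoid.mult Q, one = \<one>\<^bsub>Q\<^esub>,
      zero = \<one>\<^bsub>Q\<^esub>, add = monoid.mult Q, module.smult = (\<lambda>a x. x [^]\<^bsub>Q\<^esub> a)\<rparr>"

definition rk :: "nat \<Rightarrow> nat \<Rightarrow> ('a, 'b) monoid_scheme \<Rightarrow> nat" where
  "rk p j G =
     vectorspace.dim (residue_ring (int p))
       (module_of_group (G\<lparr>carrier := multiples G (p ^ (j - 1))\<rparr> Mod multiples G (p ^ j)))"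


section \<open>q-series\<close>

definition qpoch :: "real \<Rightarrow> real \<Rightarrow> nat \<Rightarrow> real" where
  "qpoch a q k = (\<Prod>i<k. 1 - a * q ^ i)"

definition qpoch_inf :: "real \<Rightarrow> real \<Rightarrow> real" where
  "qpoch_inf a q = lim (\<lambda>k. qpoch a q k)"

definition qbinom :: "real \<Rightarrow> nat \<Rightarrow> nat \<Rightarrow> real" where
  "qbinom q n k = qpoch q q n / (qpoch q q k * qpoch q q (n - k))"


section \<open>Partitions\<close>

text \<open>
  A partition is the multiset of its parts: \<open>m\<^sub>i\<close> is \<open>count lam i\<close> and the
  sum of the parts is \<open>\<Sum>\<^sub># lam\<close>.
\<close>

definition is_partition :: "nat multiset \<Rightarrow> bool" where
  "is_partition lam \<longleftrightarrow> 0 \<notin># lam"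

definition part :: "nat multiset \<Rightarrow> nat \<Rightarrow> nat" where
  "part lam i =
     (let ps = rev (sorted_list_of_multiset lam)
      in if 1 \<le> i \<and> i \<le> length ps then ps ! (i - 1) else 0)"

definition conj_part :: "nat multiset \<Rightarrow> nat \<Rightarrow> nat" where
  "conj_part lam k = (\<Sum>j\<in>{j. j \<in># lam \<and> k \<le> j}. count lam j)"

definition partition_le :: "nat multiset \<Rightarrow> nat multiset \<Rightarrow> bool" where
  "partition_le mu lam \<longleftrightarrow> (\<forall>i\<ge>1. part mu i \<le> part lam i)"

text \<open>
  For \<open>partition_le mu lam\<close> the subtractions below do not truncate. No part of
  \<open>lam\<close> exceeds the sum of its parts, so for all larger \<open>i\<close> the terms of the sum
  are 0 and the factors of the product are 1.
\<close>

definition C_coeff :: "nat \<Rightarrow> nat multiset \<Rightarrow> nat multiset \<Rightarrow> real" where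
  "C_coeff p lam mu =
     real p ^ (\<Sum>i = 1..\<Sum>\<^sub># lam. conj_part mu (i + 1) * (conj_part lam i - conj_part mu i)) *
     (\<Prod>i = 1..\<Sum>\<^sub># lam.
        qbinom (real p) (conj_part lam i - conj_part mu (i + 1)) (conj_part lam i - conj_part mu i))"

end

theory Submission
  imports Defs "Jordan_Normal_Form.Char_Poly"
begin

text \<open>
  Class groups are finite, so \<open>|Cl[p\<^sup>i]| = p\<^bsup>r\<^sub>1 + \<dots> + r\<^sub>i\<^esup>\<close> where \<open>r\<^sub>j\<close> is the \<open>p\<^sup>j\<close>-rank, and the
  hypothesis prescribes the averages of all \<open>p\<^bsup>\<Sum>n\<^sub>jr\<^sub>j\<^esup>\<close> with \<open>n\<^sub>1 \<ge> \<dots> \<ge> n\<^sub>l\<close>. The claimed law is the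
  limit for \<open>R \<longrightarrow> \<infinity>\<close> of the law of a Markov chain \<open>R \<ge> r\<^sub>1 \<ge> \<dots> \<ge> r\<^sub>l\<close>. The number
  of surjections from \<open>\<bbbF>\<^sub>p\<^sup>r\<close> onto \<open>\<bbbF>\<^sub>p\<^sup>k\<close> has conditional expectation \<open>p\<^bsup>-uk-kR\<^esup>\<close> times the number of
  surjections from \<open>\<bbbF>\<^sub>p\<^sup>R\<close>, and summing out the ranks from \<open>r\<^sub>l\<close> to \<open>r\<^sub>1\<close> produces exactly the sum over \<open>\<mu> \<subseteq> \<lambda>\<close>. Hence both laws have the same
  moments. To compare their point masses, the indicator of a rank vector is interpolated by a
  polynomial in the \<open>p\<^bsup>r\<^sub>1 + \<dots> + r\<^sub>i\<^esup>\<close>: once \<open>r\<^sub>1\<close> is pinned by Lagrange interpolation on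
  \<open>{0, \<dots>, J - 1}\<close>, the other ranks are bounded. The interpolation error lives on \<open>r\<^sub>1 \<ge> J\<close> and is at most
  \<open>p\<^bsup>J r\<^sub>1 - J\<^sup>2/2 + O(J + r\<^sub>1)\<^esup>\<close>, with average at most \<open>p\<^bsup>J\<^sup>2/4 - J\<^sup>2/2 + O(J)\<^esup>\<close>, which tends to 0.
\<close>

section \<open>Algebraic integers and number fields\<close>

text \<open>Two obstacles shape the argument. The first is the growth of the moments: the average of
  \<open>P^(n r_1)\<close> is \<open>P^(n^2/4 + O(n))\<close>, too fast for Carleman's condition, so
  the moments do not determine the law for a general reason. What helps is that
  \<open>P^(r_1)\<close> takes its values among the powers of \<open>P\<close>: Lagrange
  denominators on these sparse nodes are of order \<open>P^(J^2/2)\<close> and beat the moments. The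
  second is that the averages over fields are known on moments only, and no tail bound is given. The
  interpolation error is therefore dominated by a function that is itself a combination of moments,
  so that the hypothesis controls its average as well; from there on linearity and monotonicity of
  averages suffice. Finiteness of the class group has to come before all this: the
  \<open>card\<close> of an infinite set is 0, and the passage from torsion to ranks rests on
  counting.\<close>

interpretation ratvs: vector_space "\<lambda>(c::rat) (x::complex). of_rat c * x"
  by unfold_locales (auto simp: algebra_simps of_rat_add of_rat_mult)

interpretation zmod: Modules.module "\<lambda>(c::int) (x::complex). of_int c * x"
  by unfold_locales (auto simp: algebra_simps)

text \<open>The determinant trick: \<open>y\<close> is an eigenvalue of an integer matrix, hence a
  root of its characteristic polynomial, which is monic with integer coefficients.\<close>

lemma algebraic_int_eigenvalue:
  fixes y :: complex and v :: "nat \<Rightarrow> complex" and A :: "nat \<Rightarrow> nat \<Rightarrow> int"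
  assumes ev: "\<And>i. i < n \<Longrightarrow> y * v i = (\<Sum>j<n. of_int (A i j) * v j)"
    and nz: "i0 < n" "v i0 \<noteq> 0"
  shows "algebraic_int y"
proof -
  define M where "M = mat n n (\<lambda>(i, j). A i j)"
  have M: "M \<in> carrier_mat n n" by (simp add: M_def)
  let ?M = "map_mat (of_int :: int \<Rightarrow> complex) M"
  have "?M *\<^sub>v vec n v = y \<cdot>\<^sub>v vec n v"
    by (rule eq_vecI) (auto simp: M_def scalar_prod_def ev atLeast0LessThan)
  moreover have "vec n v \<noteq> 0\<^sub>v n"
    using nz by (metis index_vec index_zero_vec(1))
  ultimately have "eigenvalue ?M y"
    unfolding eigenvalue_def eigenvector_def by (intro exI[of _ "vec n v"]) (use M in auto)
  then have "poly (char_poly ?M) y = 0"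
    using eigenvalue_root_char_poly[of ?M n y] M by simp
  then have "poly (of_int_poly (char_poly M)) y = 0"
    by (simp add: of_int_hom.char_poly_hom[OF M])
  moreover have "monic (char_poly M)"
    using degree_monic_char_poly[OF M] by simp
  ultimately show ?thesis unfolding algebraic_int_altdef_ipoly by blast
qed

text \<open>The working criterion for integrality: closure under sums and products and the existence
  of integral multiples all reduce to exhibiting a finitely generated group stable under
  \<open>y\<close>. The nonzero \<open>v0\<close> makes the eigenvector nonzero.\<close>

lemma algebraic_int_stable_module:
  assumes "finite V" "v0 \<in> V" "v0 \<noteq> 0"
    and stab: "\<And>v. v \<in> V \<Longrightarrow> y * v \<in> zmod.span V"
  shows "algebraic_int y"
proof -
  obtain h where h: "bij_betw h {..<card V} V"
    using ex_bij_betw_nat_finite[OF assms(1)] by (auto simp: atLeast0LessThan)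
  have "\<forall>v\<in>V. \<exists>u :: complex \<Rightarrow> int. y * v = (\<Sum>w\<in>V. of_int (u w) * w)"
    using stab unfolding zmod.span_finite[OF assms(1)] by blast
  then obtain u :: "complex \<Rightarrow> complex \<Rightarrow> int" where u: "\<And>v. v \<in> V \<Longrightarrow> y * v = (\<Sum>w\<in>V. of_int (u v w) * w)"
    by metis
  have "y * h i = (\<Sum>j<card V. of_int (u (h i) (h j)) * h j)" if "i < card V" for i
    using u[of "h i"] that h sum.reindex_bij_betw[OF h, of "\<lambda>w. of_int (u (h i) w) * w"]
    by (auto simp: bij_betw_def)
  moreover obtain i0 where "i0 < card V" "h i0 = v0"
    using assms(2) h by (metis bij_betw_iff_bijections lessThan_iff)
  ultimately show ?thesis
    using assms(3) by (intro algebraic_int_eigenvalue[of "card V" y h "\<lambda>i j. u (h i) (h j)" i0]) auto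
qed

lemma span_mult_closed:
  assumes "\<And>v. v \<in> V \<Longrightarrow> y * v \<in> zmod.span W" "x \<in> zmod.span V"
  shows "y * x \<in> zmod.span W"
  using assms(2)
proof (induction rule: zmod.span_induct_alt)
  case (step c x z)
  have "y * (of_int c * x + z) = of_int c * (y * x) + y * z" by (simp add: algebra_simps)
  then show ?case using step assms(1) zmod.span_add zmod.span_scale by presburger
qed (simp add: zmod.span_zero)

lemma algebraic_int_power_reduction:
  assumes "algebraic_int (x::complex)"
  obtains m a where "m \<ge> 1" "x ^ m = (\<Sum>i<m. of_int (a i :: int) * x ^ i)"
proof -
  obtain p where p: "poly (of_int_poly p) x = 0" "monic p"
    using assms unfolding algebraic_int_altdef_ipoly by blast
  have "degree p \<noteq> 0"
  proof
    assume "degree p = 0"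
    then have "p = 1" using p(2) by (metis monic_degree_0)
    then show False using p(1) by simp
  qed
  moreover have "x ^ degree p = (\<Sum>i<degree p. of_int (- poly.coeff p i) * x ^ i)"
  proof -
    have "0 = (\<Sum>i\<le>degree p. of_int (poly.coeff p i) * x ^ i)"
      using p(1) by (simp add: poly_altdef)
    also have "\<dots> = (\<Sum>i<degree p. of_int (poly.coeff p i) * x ^ i) + x ^ degree p"
      using p(2) by (simp add: lessThan_Suc_atMost[symmetric])
    finally show ?thesis by (simp add: sum_negf eq_neg_iff_add_eq_0 add.commute)
  qed
  ultimately show ?thesis using that[of "degree p" "\<lambda>i. - poly.coeff p i"] by simp
qed

text \<open>The products \<open>x^i * y^j\<close> with exponents below the degrees of the two
  integral equations generate a group stable under both \<open>x\<close> and \<open>y\<close>, hence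
  under their sum and product.\<close>

lemma algebraic_int_common_module:
  assumes "algebraic_int (x::complex)" "algebraic_int y"
  obtains V where "finite V" "1 \<in> V" "\<And>v. v \<in> V \<Longrightarrow> x * v \<in> zmod.span V"
    "\<And>v. v \<in> V \<Longrightarrow> y * v \<in> zmod.span V"
proof -
  obtain m a where ma: "m \<ge> 1" "x ^ m = (\<Sum>i<m. of_int (a i :: int) * x ^ i)"
    using algebraic_int_power_reduction[OF assms(1)] .
  obtain k b where kb: "k \<ge> 1" "y ^ k = (\<Sum>i<k. of_int (b i :: int) * y ^ i)"
    using algebraic_int_power_reduction[OF assms(2)] .
  define V where "V = (\<lambda>(i,j). x ^ i * y ^ j) ` ({..<m} \<times> {..<k})"
  have inV: "x ^ i * y ^ j \<in> zmod.span V" if "i < m" "j < k" for i j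
    using that by (intro zmod.span_base) (auto simp: V_def)
  have 1: "x * (x ^ i * y ^ j) \<in> zmod.span V" if "i < m" "j < k" for i j
  proof (cases "Suc i < m")
    case True
    then show ?thesis using inV[of "Suc i" j] that by (simp add: mult.assoc)
  next
    case False
    then have "x * (x ^ i * y ^ j) = x ^ m * y ^ j"
      using that by (metis Suc_lessI mult.assoc power_Suc)
    also have "\<dots> = (\<Sum>i<m. of_int (a i) * (x ^ i * y ^ j))"
      by (simp add: ma(2) sum_distrib_right mult.assoc)
    also have "\<dots> \<in> zmod.span V"
      by (intro zmod.span_sum zmod.span_scale inV) (use that in auto)
    finally show ?thesis .
  qed
  have 2: "y * (x ^ i * y ^ j) \<in> zmod.span V" if "i < m" "j < k" for i j
  proof (cases "Suc j < k")
    case True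
    then show ?thesis using inV[of i "Suc j"] that by (simp add: mult.left_commute)
  next
    case False
    then have "y * (x ^ i * y ^ j) = y ^ k * x ^ i"
      using that by (metis Suc_lessI mult.assoc mult.commute power_Suc)
    also have "\<dots> = (\<Sum>j<k. of_int (b j) * (x ^ i * y ^ j))"
      by (simp add: kb(2) sum_distrib_left mult.assoc mult.left_commute mult.commute)
    also have "\<dots> \<in> zmod.span V"
      by (intro zmod.span_sum zmod.span_scale inV) (use that in auto)
    finally show ?thesis .
  qed
  show ?thesis
  proof (rule that)
    show "finite V" by (simp add: V_def)
    have "x ^ 0 * y ^ 0 \<in> V" unfolding V_def using ma(1) kb(1) by (intro image_eqI[of _ _ "(0, 0)"]) auto
    then show "1 \<in> V" by simp
  qed (use 1 2 in \<open>auto simp: V_def\<close>)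
qed

lemma algebraic_int_add [intro]:
  assumes "algebraic_int (x::complex)" "algebraic_int y"
  shows "algebraic_int (x + y)"
proof -
  obtain V where V: "finite V" "1 \<in> V" "\<And>v. v \<in> V \<Longrightarrow> x * v \<in> zmod.span V"
    "\<And>v. v \<in> V \<Longrightarrow> y * v \<in> zmod.span V"
    using algebraic_int_common_module[OF assms] by blast
  show ?thesis
    by (rule algebraic_int_stable_module[OF V(1,2)])
      (use V in \<open>auto simp: distrib_right intro: zmod.span_add\<close>)
qed

lemma algebraic_int_mult [intro]:
  assumes "algebraic_int (x::complex)" "algebraic_int y"
  shows "algebraic_int (x * y)"
proof -
  obtain V where V: "finite V" "1 \<in> V" "\<And>v. v \<in> V \<Longrightarrow> x * v \<in> zmod.span V"
    "\<And>v. v \<in> V \<Longrightarrow> y * v \<in> zmod.span V"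
    using algebraic_int_common_module[OF assms] by blast
  show ?thesis
  proof (rule algebraic_int_stable_module[OF V(1,2)])
    fix v assume "v \<in> V"
    then show "x * y * v \<in> zmod.span V"
      using span_mult_closed[of V x V "y * v"] V by (simp add: mult.assoc)
  qed simp
qed

section \<open>Denominators and integral multiples in number fields\<close>

lemma common_denominator_rat:
  assumes "finite (S :: rat set)"
  shows "\<exists>d::int. d > 0 \<and> (\<forall>r\<in>S. of_int d * r \<in> \<int>)"
  using assms
proof induction
  case (insert r S)
  then obtain d where d: "d > 0" "\<forall>r\<in>S. of_int d * r \<in> \<int>" by blast
  obtain a b where ab: "r = Rat.Fract a b" "b > 0" by (cases r) auto
  have r: "of_int b * r = of_int a" using ab by (simp add: Fract_of_int_quotient)
  show ?case
  proof (intro exI[of _ "d * b"] conjI ballI)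
    fix s assume "s \<in> insert r S"
    then show "of_int (d * b) * s \<in> \<int>"
    proof
      assume "s = r"
      then have "of_int (d * b) * s = of_int (d * a)" using r by (simp add: mult.assoc)
      then show ?thesis by (metis Ints_of_int)
    next
      assume "s \<in> S"
      then have "of_int b * (of_int d * s) \<in> \<int>" using d by (metis Ints_mult Ints_of_int)
      then show ?thesis by (simp add: mult_ac)
    qed
  qed (use ab d in simp)
qed (intro exI[of _ 1], simp)

lemma number_field_closed:
  assumes "number_field K"
  shows number_field_0: "0 \<in> K" and number_field_1: "1 \<in> K"
    and number_field_minus: "x \<in> K \<Longrightarrow> y \<in> K \<Longrightarrow> x - y \<in> K"
    and number_field_add: "x \<in> K \<Longrightarrow> y \<in> K \<Longrightarrow> x + y \<in> K"
    and number_field_uminus: "x \<in> K \<Longrightarrow> - x \<in> K"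
    and number_field_mult: "x \<in> K \<Longrightarrow> y \<in> K \<Longrightarrow> x * y \<in> K"
    and number_field_inverse: "x \<in> K \<Longrightarrow> inverse x \<in> K"
    and number_field_divide: "x \<in> K \<Longrightarrow> y \<in> K \<Longrightarrow> x / y \<in> K"
proof -
  show 1: "1 \<in> K" and m: "x \<in> K \<Longrightarrow> y \<in> K \<Longrightarrow> x - y \<in> K"
     "x \<in> K \<Longrightarrow> y \<in> K \<Longrightarrow> x * y \<in> K" "x \<in> K \<Longrightarrow> inverse x \<in> K" for x y
    using assms unfolding number_field_def by blast+
  show 0: "0 \<in> K" using m(1)[OF 1 1] by simp
  show u: "x \<in> K \<Longrightarrow> - x \<in> K" for x using m(1)[OF 0] by simp
  show "x \<in> K \<Longrightarrow> y \<in> K \<Longrightarrow> x + y \<in> K" using m(1)[OF _ u, of x y] by simp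
  show "x \<in> K \<Longrightarrow> y \<in> K \<Longrightarrow> x / y \<in> K" using m(2)[OF _ m(3), of x y] by (simp add: divide_inverse)
qed

lemma number_field_span:
  assumes "number_field K"
  obtains B where "finite B" "K = ratvs.span B"
proof -
  obtain B :: "complex set" where B: "finite B" "K = {\<Sum>b\<in>B. of_rat (c b) * b | c. True}"
    using assms unfolding number_field_def by blast
  have "K = ratvs.span B" using B(2) unfolding ratvs.span_finite[OF B(1)] by blast
  with B(1) show ?thesis using that by blast
qed

lemma number_field_rat:
  assumes "number_field K"
  shows "of_rat c \<in> K"
proof -
  obtain B where B: "finite B" "K = ratvs.span B" using number_field_span[OF assms] .
  show ?thesis using ratvs.span_scale[of 1 B c] number_field_1[OF assms] B by simp
qed

lemma number_field_int:
  assumes "number_field K"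
  shows "of_int c \<in> K"
  using number_field_rat[OF assms, of "of_int c"] by simp

lemma ring_of_integers_closed:
  assumes "number_field K"
  shows "0 \<in> ring_of_integers K" "1 \<in> ring_of_integers K"
    "x \<in> ring_of_integers K \<Longrightarrow> y \<in> ring_of_integers K \<Longrightarrow> x + y \<in> ring_of_integers K"
    "x \<in> ring_of_integers K \<Longrightarrow> y \<in> ring_of_integers K \<Longrightarrow> x - y \<in> ring_of_integers K"
    "x \<in> ring_of_integers K \<Longrightarrow> y \<in> ring_of_integers K \<Longrightarrow> x * y \<in> ring_of_integers K"
    "of_int c \<in> ring_of_integers K"
  using algebraic_int_add[of x "-y"]
  by (auto simp: ring_of_integers_def int_imp_algebraic_int number_field_closed[OF assms] number_field_int[OF assms])

lemma ring_of_integers_sum: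
  assumes "number_field K" "\<And>i. i \<in> A \<Longrightarrow> f i \<in> ring_of_integers K"
  shows "sum f A \<in> ring_of_integers K"
  using assms(2) by (induction A rule: infinite_finite_induct)
    (auto intro: ring_of_integers_closed[OF assms(1)])

text \<open>Multiplication by \<open>x\<close> has rational coefficients on a finite spanning set. A
  common denominator \<open>d\<close> makes them integral, and then \<open>d * x\<close> maps the
  integer span of that set into itself.\<close>

lemma number_field_integral_multiple:
  assumes K: "number_field K" and x: "x \<in> K"
  obtains d :: int where "d > 0" "of_int d * x \<in> ring_of_integers K"
proof -
  obtain B where B: "finite B" "K = ratvs.span B" using number_field_span[OF K] .
  have "\<forall>b\<in>B. \<exists>u :: complex \<Rightarrow> rat. x * b = (\<Sum>w\<in>B. of_rat (u w) * w)"
  proof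
    fix b assume "b \<in> B"
    then have "x * b \<in> ratvs.span B"
      using x B(2) number_field_mult[OF K] ratvs.span_base by blast
    then show "\<exists>u :: complex \<Rightarrow> rat. x * b = (\<Sum>w\<in>B. of_rat (u w) * w)"
      unfolding ratvs.span_finite[OF B(1)] by blast
  qed
  then obtain u :: "complex \<Rightarrow> complex \<Rightarrow> rat"
    where u: "\<And>b. b \<in> B \<Longrightarrow> x * b = (\<Sum>w\<in>B. of_rat (u b w) * w)" by metis
  have "finite ((\<lambda>(b,w). u b w) ` (B \<times> B))" using B(1) by simp
  from common_denominator_rat[OF this] obtain d :: int
    where d: "d > 0" "\<And>b w. b \<in> B \<Longrightarrow> w \<in> B \<Longrightarrow> of_int d * u b w \<in> \<int>" by auto
  have "\<exists>b\<in>B. b \<noteq> 0"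
  proof (rule ccontr)
    assume "\<not> ?thesis"
    then have "B \<subseteq> {0}" by auto
    then have "ratvs.span B \<subseteq> {0}" using ratvs.span_mono[of B "{0}"] ratvs.span_insert_0[of "{}"] by simp
    then show False using number_field_1[OF K] B(2) by auto
  qed
  then obtain b0 where b0: "b0 \<in> B" "b0 \<noteq> 0" by blast
  have "algebraic_int (of_int d * x)"
  proof (rule algebraic_int_stable_module[OF B(1) b0])
    fix b assume b: "b \<in> B"
    have "of_int d * x * b = (\<Sum>w\<in>B. of_int d * (of_rat (u b w) * w))"
      using u[OF b] by (simp add: mult.assoc sum_distrib_left)
    also have "\<dots> \<in> zmod.span B"
    proof (rule zmod.span_sum)
      fix w assume w: "w \<in> B"
      then obtain k where "of_int d * u b w = of_int k" using d(2)[OF b w] by (elim Ints_cases) auto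
      then have "(of_int d * of_rat (u b w) :: complex) = of_int k"
        by (metis of_rat_mult of_rat_of_int_eq)
      then have "of_int d * (of_rat (u b w) * w) = of_int k * w" by (metis mult.assoc)
      then show "of_int d * (of_rat (u b w) * w) \<in> zmod.span B"
        using zmod.span_scale[OF zmod.span_base[OF w], of k] by argo
    qed
    finally show "of_int d * x * b \<in> zmod.span B" .
  qed
  then show ?thesis
    using that[OF d(1)] x number_field_mult[OF K] number_field_int[OF K] by (simp add: ring_of_integers_def)
qed

section \<open>Finiteness of the set of ideal classes\<close>

text \<open>A rational basis consisting of algebraic integers, not an integral basis: linear algebra
  alone provides it. Integers may then have fractional coordinates, which
  \<open>bounded_denominators\<close> keeps under control.\<close>

locale integral_rat_basis =
  fixes K :: "complex set" and n :: nat and e :: "nat \<Rightarrow> complex"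
    and cf :: "complex \<Rightarrow> nat \<Rightarrow> rat"
  assumes K: "number_field K"
    and e_int: "i < n \<Longrightarrow> e i \<in> ring_of_integers K"
    and cf_expand: "x \<in> K \<Longrightarrow> x = (\<Sum>i<n. of_rat (cf x i) * e i)"
    and cf_eq: "j < n \<Longrightarrow> cf (\<Sum>i<n. of_rat (a i) * e i) j = a j"

lemma integral_rat_basis_exists:
  assumes K: "number_field K"
  obtains n e cf where "integral_rat_basis K n e cf"
proof -
  obtain B where B: "finite B" "K = ratvs.span B" using number_field_span[OF K] .
  obtain E where E: "E \<subseteq> ring_of_integers K" "ratvs.independent E" "ring_of_integers K \<subseteq> ratvs.span E"
    using ratvs.maximal_independent_subset .
  have OK: "ring_of_integers K \<subseteq> K" by (auto simp: ring_of_integers_def)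
  have fin: "finite E"
    using ratvs.independent_span_bound[OF B(1) E(2)] E(1) OK B(2) by blast
  \<comment> \<open>Every element of \<open>K\<close> has a nonzero integer multiple in the ring of
    integers, so a maximal independent set of integers already spans \<open>K\<close>.\<close>
  have KE: "K = ratvs.span E"
  proof
    show "ratvs.span E \<subseteq> K" using E(1) OK B(2) ratvs.span_minimal ratvs.subspace_span by blast
    show "K \<subseteq> ratvs.span E"
    proof
      fix x assume "x \<in> K"
      then obtain d :: int where d: "d > 0" "of_int d * x \<in> ring_of_integers K"
        using number_field_integral_multiple[OF K] by blast
      then have "of_rat (1 / of_int d) * (of_int d * x) \<in> ratvs.span E"
        using E(3) by (intro ratvs.span_scale) auto
      then show "x \<in> ratvs.span E" using d(1) by (simp add: of_rat_divide)
    qed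
  qed
  obtain h where h: "bij_betw h {..<card E} E"
    using ex_bij_betw_nat_finite[OF fin] by (auto simp: atLeast0LessThan)
  define cf where "cf = (\<lambda>x i. ratvs.representation E x (h i))"
  have "integral_rat_basis K (card E) h cf"
  proof
    show "number_field K" by fact
    show "h i \<in> ring_of_integers K" if "i < card E" for i
      using that h E(1) by (auto simp: bij_betw_def)
    show "x = (\<Sum>i<card E. of_rat (cf x i) * h i)" if "x \<in> K" for x
      using ratvs.sum_representation_eq[OF E(2), of x E] that KE fin
        sum.reindex_bij_betw[OF h, of "\<lambda>b. of_rat (ratvs.representation E x b) * b"]
      by (simp add: cf_def)
    show "cf (\<Sum>i<card E. of_rat (a i) * h i) j = a j" if j: "j < card E" for a j
    proof -
      let ?g = "inv_into {..<card E} h"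
      have gh: "?g (h i) = i" if "i < card E" for i
        using h that by (simp add: bij_betw_def)
      have hE: "h i \<in> E" if "i < card E" for i using that h by (auto simp: bij_betw_def)
      let ?x = "\<Sum>i<card E. of_rat (a i) * h i"
      have "?x = (\<Sum>b\<in>E. of_rat (a (?g b)) * b)"
        using sum.reindex_bij_betw[OF h, of "\<lambda>b. of_rat (a (?g b)) * b"] gh by simp
      also have "\<dots> = (\<Sum>b | (if b \<in> E then a (?g b) else 0) \<noteq> 0. of_rat (if b \<in> E then a (?g b) else 0) * b)"
        by (rule sum.mono_neutral_cong_right) (use fin in auto)
      finally have x: "?x = \<dots>" .
      have "ratvs.representation E ?x = (\<lambda>b. if b \<in> E then a (?g b) else 0)"
        by (rule ratvs.representation_eqI[OF E(2)])
          (use x fin in \<open>auto intro: ratvs.span_sum ratvs.span_scale ratvs.span_base hE split: if_splits\<close>)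
      then show ?thesis using gh[OF j] hE[OF j] by (simp add: cf_def)
    qed
  qed
  then show ?thesis using that by blast
qed

context integral_rat_basis
begin

abbreviation "OK \<equiv> ring_of_integers K"

lemma OK_sub: "OK \<subseteq> K" by (auto simp: ring_of_integers_def)

lemma e_K: "i < n \<Longrightarrow> e i \<in> K" using e_int OK_sub by blast

lemmas K_closed = number_field_closed[OF K] number_field_rat[OF K] number_field_int[OF K]
lemmas OK_closed = ring_of_integers_closed[OF K]

lemma cf_sum:
  assumes "\<And>k. k \<in> A \<Longrightarrow> f k \<in> K" "finite A" "j < n"
  shows "cf (\<Sum>k\<in>A. of_rat (c k) * f k) j = (\<Sum>k\<in>A. c k * cf (f k) j)"
proof -
  have "(\<Sum>k\<in>A. of_rat (c k) * f k) = (\<Sum>k\<in>A. of_rat (c k) * (\<Sum>i<n. of_rat (cf (f k) i) * e i))"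
  proof (rule sum.cong[OF refl])
    fix k assume "k \<in> A"
    from arg_cong[OF cf_expand[OF assms(1)[OF this]], of "\<lambda>z. of_rat (c k) * z"]
    show "of_rat (c k) * f k = of_rat (c k) * (\<Sum>i<n. of_rat (cf (f k) i) * e i)" .
  qed
  also have "\<dots> = (\<Sum>k\<in>A. \<Sum>i<n. of_rat (c k * cf (f k) i) * e i)"
    by (simp only: sum_distrib_left of_rat_mult mult.assoc)
  also have "\<dots> = (\<Sum>i<n. \<Sum>k\<in>A. of_rat (c k * cf (f k) i) * e i)" by (rule sum.swap)
  also have "\<dots> = (\<Sum>i<n. of_rat (\<Sum>k\<in>A. c k * cf (f k) i) * e i)"
    by (simp add: sum_distrib_right of_rat_sum)
  finally show ?thesis using cf_eq[OF assms(3)] by simp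
qed

lemma cf_scale: "x \<in> K \<Longrightarrow> j < n \<Longrightarrow> cf (of_rat c * x) j = c * cf x j"
  using cf_sum[of "{0::nat}" "\<lambda>_. x" j "\<lambda>_. c"] by simp

lemma cf_diff: "x \<in> K \<Longrightarrow> y \<in> K \<Longrightarrow> j < n \<Longrightarrow> cf (x - y) j = cf x j - cf y j"
  using cf_sum[of "{0,1::nat}" "\<lambda>k. if k = 0 then x else y" j "\<lambda>k. if k = 0 then 1 else - 1"]
  by (simp add: of_rat_minus)

lemma cf_e: "i < n \<Longrightarrow> j < n \<Longrightarrow> cf (e j) i = (if i = j then 1 else 0)"
proof -
  assume *: "i < n" "j < n"
  have "(\<Sum>k<n. of_rat (if k = j then 1 else 0) * e k) = (\<Sum>k<n. if k = j then e k else 0)"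
    by (intro sum.cong) auto
  also have "\<dots> = e j" using * by simp
  finally show ?thesis using cf_eq[OF *(1), of "\<lambda>k. if k = j then 1 else 0"] by simp
qed

lemma n_pos: "n \<ge> 1"
proof (rule ccontr)
  assume "\<not> ?thesis"
  then have "n = 0" by simp
  then have "(\<Sum>i<n. of_rat (cf 1 i) * e i) = 0" by simp
  then show False using cf_expand[OF K_closed(2)] by (metis zero_neq_one)
qed

section \<open>Multiplication matrices and the norm\<close>

definition mult_mat :: "complex \<Rightarrow> rat mat" where
  "mult_mat x = mat n n (\<lambda>(i, j). cf (x * e j) i)"

lemma mult_mat_carrier [simp]: "mult_mat x \<in> carrier_mat n n"
  by (simp add: mult_mat_def)

lemma mult_mat_mult:
  assumes "x \<in> K" "y \<in> K"
  shows "mult_mat (x * y) = mult_mat x * mult_mat y"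
proof (rule eq_matI)
  fix i j assume "i < dim_row (mult_mat x * mult_mat y)" "j < dim_col (mult_mat x * mult_mat y)"
  then have ij: "i < n" "j < n" by (auto simp: mult_mat_def)
  have "y * e j = (\<Sum>k<n. of_rat (cf (y * e j) k) * e k)"
    by (rule cf_expand[OF number_field_mult[OF K assms(2) e_K[OF ij(2)]]])
  from arg_cong[OF this, of "\<lambda>z. x * z"]
  have "x * y * e j = (\<Sum>k<n. of_rat (cf (y * e j) k) * (x * e k))"
    by (simp add: sum_distrib_left mult_ac)
  then have "cf (x * y * e j) i = (\<Sum>k<n. cf (y * e j) k * cf (x * e k) i)"
    using cf_sum[of "{..<n}" "\<lambda>k. x * e k" i] ij e_K assms K_closed by simp
  then show "mult_mat (x * y) $$ (i, j) = (mult_mat x * mult_mat y) $$ (i, j)"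
    using ij by (simp add: mult_mat_def scalar_prod_def atLeast0LessThan mult.commute)
qed (simp_all add: mult_mat_def)

text \<open>The absolute value of the field norm. In the form of a determinant it inherits
  multiplicativity from matrices.\<close>

definition N :: "complex \<Rightarrow> real" where
  "N x = \<bar>real_of_rat (det (mult_mat x))\<bar>"

lemma N_mult: "x \<in> K \<Longrightarrow> y \<in> K \<Longrightarrow> N (x * y) = N x * N y"
  by (simp add: N_def mult_mat_mult det_mult[OF mult_mat_carrier mult_mat_carrier] of_rat_mult abs_mult)

lemma N_1: "N 1 = 1"
proof -
  have "mult_mat 1 = 1\<^sub>m n" by (rule eq_matI) (auto simp: mult_mat_def cf_e)
  then show ?thesis by (simp add: N_def)
qed

lemma N_nonneg: "N x \<ge> 0" by (simp add: N_def)

lemma N_pos: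
  assumes "x \<in> K" "x \<noteq> 0"
  shows "N x > 0"
proof -
  have "N x * N (inverse x) = 1"
    using N_mult[of x "inverse x"] assms K_closed N_1 by simp
  then show ?thesis using N_nonneg[of x] by (metis less_eq_real_def mult_zero_left zero_neq_one)
qed

lemma N_power: "x \<in> K \<Longrightarrow> N (x ^ k) = N x ^ k" and K_power: "x \<in> K \<Longrightarrow> x ^ k \<in> K"
proof -
  show p: "x \<in> K \<Longrightarrow> x ^ k \<in> K" for k by (induction k) (auto intro: K_closed)
  show "x \<in> K \<Longrightarrow> N (x ^ k) = N x ^ k" by (induction k) (simp_all add: N_1 N_mult p)
qed

text \<open>By the integral equation of \<open>x\<close> every power is an integer combination of
  the first \<open>m\<close> powers, so a common denominator for finitely many matrices serves all
  powers.\<close>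

lemma bounded_denominators:
  assumes "x \<in> OK"
  obtains d :: int where "d > 0" "\<And>k i j. i < n \<Longrightarrow> j < n \<Longrightarrow> of_int d * cf (x ^ k * e j) i \<in> \<int>"
proof -
  have xK: "x \<in> K" using assms OK_sub by blast
  have "algebraic_int x" using assms by (simp add: ring_of_integers_def)
  then obtain m a where ma: "m \<ge> 1" "x ^ m = (\<Sum>i<m. of_int (a i :: int) * x ^ i)"
    by (rule algebraic_int_power_reduction)
  let ?S = "(\<lambda>(k, j, i). cf (x ^ k * e j) i) ` ({..<m} \<times> {..<n} \<times> {..<n})"
  have "finite ?S" by simp
  from common_denominator_rat[OF this] obtain d :: int
    where d: "d > 0" "\<And>k i j. k < m \<Longrightarrow> i < n \<Longrightarrow> j < n \<Longrightarrow> of_int d * cf (x ^ k * e j) i \<in> \<int>"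
    by auto
  have "of_int d * cf (x ^ k * e j) i \<in> \<int>" if ij: "i < n" "j < n" for k i j
  proof (induction k rule: less_induct)
    case (less k)
    show ?case
    proof (cases "k < m")
      case True
      then show ?thesis using d(2) ij by blast
    next
      case False
      then have "x ^ k = x ^ (k - m) * x ^ m" by (simp flip: power_add)
      also have "\<dots> = (\<Sum>l<m. of_int (a l) * x ^ (k - m + l))"
        by (simp add: ma(2) sum_distrib_left power_add mult_ac)
      finally have "x ^ k * e j = (\<Sum>l<m. of_rat (of_int (a l)) * (x ^ (k - m + l) * e j))"
        by (simp add: sum_distrib_left sum_distrib_right mult_ac)
      then have "cf (x ^ k * e j) i = (\<Sum>l<m. of_int (a l) * cf (x ^ (k - m + l) * e j) i)"
        using cf_sum[of "{..<m}" "\<lambda>l. x ^ (k - m + l) * e j" i "\<lambda>l. of_int (a l)"] ij e_K K_power[OF xK] K_closed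
        by simp
      then have "of_int d * cf (x ^ k * e j) i =
          (\<Sum>l<m. of_int (a l) * (of_int d * cf (x ^ (k - m + l) * e j) i))"
        by (simp add: sum_distrib_left mult_ac)
      also have "\<dots> \<in> \<int>"
        by (intro Ints_sum Ints_mult[OF Ints_of_int] less) (use False in auto)
      finally show ?thesis .
    qed
  qed
  then show ?thesis using that d(1) by blast
qed

lemma det_Ints:
  assumes "A \<in> carrier_mat n n" "\<And>i j. i < n \<Longrightarrow> j < n \<Longrightarrow> A $$ (i, j) \<in> \<int>"
  shows "det A \<in> (\<int> :: 'a :: comm_ring_1 set)"
  unfolding det_def'[OF assms(1)]
  by (intro Ints_sum Ints_mult Ints_prod Ints_of_int assms(2)) (auto simp: permutes_in_image)

text \<open>
  The multiplication matrices of the powers \<open>x\<^sup>k\<close> have a common denominator \<open>d\<close>, so \<open>d\<^sup>n N(x)\<^sup>k\<close>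
  is a positive integer for every \<open>k\<close>.
\<close>

lemma N_ge_1:
  assumes "x \<in> OK" "x \<noteq> 0"
  shows "N x \<ge> 1"
proof (rule ccontr)
  assume "\<not> ?thesis"
  have xK: "x \<in> K" using assms OK_sub by blast
  obtain d :: int where d: "d > 0" "\<And>k i j. i < n \<Longrightarrow> j < n \<Longrightarrow> of_int d * cf (x ^ k * e j) i \<in> \<int>"
    using bounded_denominators[OF assms(1)] by blast
  have ge: "of_int d ^ n * N x ^ k \<ge> 1" for k
  proof -
    let ?A = "of_int d \<cdot>\<^sub>m mult_mat (x ^ k)"
    have "det ?A \<in> \<int>" by (rule det_Ints) (use d(2) in \<open>auto simp: mult_mat_def\<close>)
    then obtain z where z: "det ?A = of_int z" by (elim Ints_cases)
    have "det ?A = of_int d ^ n * det (mult_mat (x ^ k))" by (simp add: mult_mat_def)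
    then have "of_int z = of_int d ^ n * det (mult_mat (x ^ k))" by (simp only: z)
    then have "real_of_rat (of_int z) = real_of_rat (of_int d ^ n * det (mult_mat (x ^ k)))"
      by (simp only:)
    then have "\<bar>real_of_rat (of_int z)\<bar> = of_int d ^ n * N (x ^ k)"
      using d(1) by (simp add: N_def of_rat_mult of_rat_power abs_mult)
    then have *: "\<bar>real_of_int z\<bar> = of_int d ^ n * N x ^ k" using xK by (simp add: N_power)
    have "of_int d ^ n * N x ^ k > 0" using d(1) N_pos[OF xK assms(2)] by simp
    then have "\<bar>z\<bar> \<ge> 1" using * by auto
    then have "\<bar>real_of_int z\<bar> \<ge> 1" by linarith
    then show ?thesis using * by simp
  qed
  obtain k where "N x ^ k < 1 / of_int d ^ n"
    using real_arch_pow_inv[of "1 / of_int d ^ n" "N x"] d(1) \<open>\<not> N x \<ge> 1\<close> by auto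
  then show False using ge[of k] d(1) by (simp add: field_simps)
qed

text \<open>The entries of \<open>mult_mat x\<close> are linear in the coordinates of
  \<open>x\<close>, and the Leibniz sum has \<open>fact n\<close> terms, so small coordinates force
  a small determinant.\<close>

lemma small_norm:
  obtains \<delta> :: rat where "\<delta> > 0"
    "\<And>x. x \<in> K \<Longrightarrow> (\<And>i. i < n \<Longrightarrow> \<bar>cf x i\<bar> < \<delta>) \<Longrightarrow> N x < 1 / 2"
proof -
  \<comment> \<open>\<open>C\<close> dominates the sums of absolute structure constants that occur
    in the matrix entries, so each entry is at most \<open>\<delta> * C\<close>. The choice of
    \<open>\<delta>\<close> gives \<open>fact n * (\<delta> * C) = 1 / 4\<close>; the summand 1
    keeps \<open>C\<close> positive.\<close>
  define C :: rat where "C = 1 + (\<Sum>i<n. \<Sum>j<n. \<Sum>k<n. \<bar>cf (e k * e j) i\<bar>)"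
  define \<delta> where "\<delta> = 1 / (4 * fact n * C)"
  have C: "C \<ge> 1" by (auto simp: C_def intro!: sum_nonneg)
  have dpos: "\<delta> > 0" using C by (simp add: \<delta>_def)
  have "N x < 1 / 2" if x: "x \<in> K" and small: "\<And>i. i < n \<Longrightarrow> \<bar>cf x i\<bar> < \<delta>" for x
  proof -
    have ent: "\<bar>mult_mat x $$ (i, j)\<bar> \<le> \<delta> * C" if ij: "i < n" "j < n" for i j
    proof -
      have "x * e j = (\<Sum>k<n. of_rat (cf x k) * (e k * e j))"
        by (subst cf_expand[OF x]) (simp add: sum_distrib_right mult.assoc)
      then have "cf (x * e j) i = (\<Sum>k<n. cf x k * cf (e k * e j) i)"
        using cf_sum[of "{..<n}" "\<lambda>k. e k * e j" i "cf x"] ij e_K K_closed by simp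
      then have "\<bar>mult_mat x $$ (i, j)\<bar> \<le> (\<Sum>k<n. \<bar>cf x k * cf (e k * e j) i\<bar>)"
        using ij sum_abs by (simp add: mult_mat_def)
      also have "\<dots> \<le> (\<Sum>k<n. \<delta> * \<bar>cf (e k * e j) i\<bar>)"
        unfolding abs_mult by (intro sum_mono mult_right_mono) (use small less_imp_le in auto)
      also have "\<dots> = \<delta> * (\<Sum>k<n. \<bar>cf (e k * e j) i\<bar>)" by (simp add: sum_distrib_left)
      also have "(\<Sum>k<n. \<bar>cf (e k * e j) i\<bar>) \<le> (\<Sum>j<n. \<Sum>k<n. \<bar>cf (e k * e j) i\<bar>)"
        using ij by (intro member_le_sum) (auto intro: sum_nonneg)
      also have "\<dots> \<le> (\<Sum>i<n. \<Sum>j<n. \<Sum>k<n. \<bar>cf (e k * e j) i\<bar>)"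
        using ij by (intro member_le_sum[of i "{..<n}" "\<lambda>i. \<Sum>j<n. \<Sum>k<n. \<bar>cf (e k * e j) i\<bar>"]) (auto intro: sum_nonneg)
      also have "\<dots> \<le> C" by (simp add: C_def)
      finally show ?thesis using dpos by simp
    qed
    have dC: "\<delta> * C = 1 / (4 * fact n)" using C by (simp add: \<delta>_def)
    have "\<bar>det (mult_mat x)\<bar> \<le> (\<Sum>p | p permutes {0..<n}. \<bar>signof p * (\<Prod>i = 0..<n. mult_mat x $$ (i, p i))\<bar>)"
      unfolding det_def'[OF mult_mat_carrier] by (rule sum_abs)
    also have "\<dots> \<le> (\<Sum>p | p permutes {0..<n}. (\<delta> * C) ^ n)"
    proof (rule sum_mono)
      fix p assume p: "p \<in> {p. p permutes {0..<n}}"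
      have "\<bar>signof p * (\<Prod>i = 0..<n. mult_mat x $$ (i, p i))\<bar> = (\<Prod>i = 0..<n. \<bar>mult_mat x $$ (i, p i)\<bar>)"
        by (simp add: abs_mult abs_prod sign_def)
      also have "\<dots> \<le> (\<Prod>i = 0..<n. \<delta> * C)"
        by (intro prod_mono conjI ent) (use p in \<open>auto simp: permutes_in_image\<close>)
      finally show "\<bar>signof p * (\<Prod>i = 0..<n. mult_mat x $$ (i, p i))\<bar> \<le> (\<delta> * C) ^ n" by simp
    qed
    also have "\<dots> = fact n * (\<delta> * C) ^ n" by (simp add: card_permutations)
    also have "(\<delta> * C) ^ n \<le> (\<delta> * C) ^ 1"
    proof (rule power_decreasing)
      show "0 \<le> \<delta> * C" using dpos C by simp
      show "\<delta> * C \<le> 1" unfolding dC using fact_ge_1[of n, where 'a = rat] by (simp add: field_simps del: fact_ge_1)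
    qed (rule n_pos)
    also have "fact n * (\<delta> * C) ^ 1 = 1 / 4" using dC by simp
    finally have "\<bar>det (mult_mat x)\<bar> \<le> 1 / 4" by simp
    then have "real_of_rat \<bar>det (mult_mat x)\<bar> \<le> real_of_rat (1 / 4)" by (simp only: of_rat_less_eq)
    then show ?thesis by (simp add: N_def of_rat_divide)
  qed
  then show ?thesis using that dpos by blast
qed

text \<open>Two integers in the same box of side \<open>\<delta>\<close> differ by an integer of norm less than 1, that is, by 0.\<close>

lemma finite_box:
  shows "finite {x \<in> OK. \<forall>i<n. 0 \<le> cf x i \<and> cf x i < of_nat m}" (is "finite ?B")
proof -
  obtain \<delta> :: rat where \<delta>: "\<delta> > 0"
    "\<And>x. x \<in> K \<Longrightarrow> (\<And>i. i < n \<Longrightarrow> \<bar>cf x i\<bar> < \<delta>) \<Longrightarrow> N x < 1 / 2"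
    using small_norm by blast
  let ?f = "\<lambda>x. restrict (\<lambda>i. \<lfloor>cf x i / \<delta>\<rfloor>) {..<n}"
  have "inj_on ?f ?B"
  proof (rule inj_onI)
    fix x y assume xy: "x \<in> ?B" "y \<in> ?B" "?f x = ?f y"
    then have xyK: "x \<in> K" "y \<in> K" using OK_sub by auto
    have "\<bar>cf (x - y) i\<bar> < \<delta>" if "i < n" for i
    proof -
      have "?f x i = ?f y i" using xy(3) by simp
      then have "\<lfloor>cf x i / \<delta>\<rfloor> = \<lfloor>cf y i / \<delta>\<rfloor>" using that by simp
      then have "\<bar>cf x i / \<delta> - cf y i / \<delta>\<bar> < 1" by linarith
      then show ?thesis using \<delta>(1) cf_diff[OF xyK that] by (simp add: field_simps abs_less_iff)
    qed
    then have "N (x - y) < 1 / 2" using \<delta>(2)[of "x - y"] xyK K_closed by blast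
    then show "x = y" using N_ge_1[of "x - y"] xy OK_closed by force
  qed
  moreover have "?f ` ?B \<subseteq> PiE {..<n} (\<lambda>_. {0..\<lfloor>of_nat m / \<delta>\<rfloor>})"
  proof (rule image_subsetI)
    fix x assume "x \<in> ?B"
    then show "?f x \<in> PiE {..<n} (\<lambda>_. {0..\<lfloor>of_nat m / \<delta>\<rfloor>})"
      using \<delta>(1) unfolding restrict_PiE_iff
      by (auto intro!: floor_mono divide_right_mono intro: less_imp_le[of "cf x _"])
  qed
  moreover have "finite (PiE {..<n} (\<lambda>_. {0..\<lfloor>of_nat m / \<delta>\<rfloor>}))" by (intro finite_PiE) auto
  ultimately show ?thesis using finite_imageD finite_subset by blast
qed

lemma int_comb_OK: "(\<Sum>i<n. of_int (a i) * e i) \<in> OK"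
  by (intro ring_of_integers_sum[OF K] OK_closed e_int) auto

section \<open>Approximation of field elements by integers\<close>

text \<open>Dirichlet's pigeonhole argument: the fractional parts of the \<open>q ^ n + 1\<close>
  multiples \<open>t * x\<close> fall into \<open>q ^ n\<close> boxes of side \<open>1 / q\<close>,
  so two of them share a box. The resulting bound \<open>q ^ n\<close> does not depend on
  \<open>x\<close>.\<close>

lemma norm_approximation:
  obtains m :: nat where "m \<ge> 1"
    "\<And>x. x \<in> K \<Longrightarrow> \<exists>t\<in>{1..m}. \<exists>w\<in>OK. N (of_nat t * x - w) < 1 / 2"
proof -
  obtain \<delta> :: rat where \<delta>: "\<delta> > 0"
    "\<And>x. x \<in> K \<Longrightarrow> (\<And>i. i < n \<Longrightarrow> \<bar>cf x i\<bar> < \<delta>) \<Longrightarrow> N x < 1 / 2"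
    using small_norm by blast
  obtain q :: nat where q: "q > 0" "1 / of_nat q < \<delta>"
    using ex_inverse_of_nat_less[OF \<delta>(1)] by (auto simp: divide_inverse)
  have "\<exists>t\<in>{1..q ^ n}. \<exists>w\<in>OK. N (of_nat t * x - w) < 1 / 2" if x: "x \<in> K" for x
  proof -
    let ?f = "\<lambda>t. restrict (\<lambda>i. \<lfloor>of_nat q * frac (of_nat t * cf x i)\<rfloor>) {..<n}"
    have "?f ` {0..q ^ n} \<subseteq> PiE {..<n} (\<lambda>_. {0..<int q})"
    proof -
      have "\<lfloor>of_nat q * frac r\<rfloor> < int q" for r :: rat
        using frac_lt_1[of r] q(1) by (simp add: floor_less_iff)
      then show ?thesis using q(1) by (intro image_subsetI) (simp add: restrict_PiE_iff)
    qed
    then have "card (?f ` {0..q ^ n}) \<le> card (PiE {..<n} (\<lambda>_. {0..<int q}))"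
      by (intro card_mono finite_PiE) auto
    also have "\<dots> < card {0..q ^ n}" by (simp add: card_PiE)
    finally have "\<not> inj_on ?f {0..q ^ n}" by (rule pigeonhole)
    then obtain s' t' where st': "s' \<in> {0..q ^ n}" "t' \<in> {0..q ^ n}" "?f s' = ?f t'" "s' \<noteq> t'"
      unfolding inj_on_def by blast
    obtain s t where st: "s < t" "t \<le> q ^ n" "?f s = ?f t"
    proof (cases "s' < t'")
      case True
      then show ?thesis using that[OF True _ st'(3)] st'(2) by simp
    next
      case False
      then show ?thesis using that[OF _ _ st'(3)[symmetric]] st' by simp
    qed
    \<comment> \<open>Subtracting the difference of the integral parts leaves the difference of the
      fractional parts, with coordinates below \<open>1 / q < \<delta>\<close>.\<close>
    let ?a = "\<lambda>i. \<lfloor>of_nat t * cf x i\<rfloor> - \<lfloor>of_nat s * cf x i\<rfloor>"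
    let ?w = "\<Sum>i<n. of_int (?a i) * e i"
    have wK: "?w \<in> K" by (rule subsetD[OF OK_sub int_comb_OK])
    have tx: "of_nat (t - s) * x \<in> K" using K_closed(6)[OF number_field_int[OF K, of "int (t - s)"] x] by simp
    have cfw: "cf ?w i = of_int (?a i)" if "i < n" for i
      using cf_eq[OF that, of "\<lambda>i. of_int (?a i)"] by (simp del: of_int_diff)
    have "\<bar>cf (of_nat (t - s) * x - ?w) i\<bar> < \<delta>" if i: "i < n" for i
    proof -
      have "cf (of_nat (t - s) * x) i = of_nat (t - s) * cf x i"
        using cf_scale[OF x i, of "of_nat (t - s)"] by simp
      then have "cf (of_nat (t - s) * x - ?w) i = of_nat (t - s) * cf x i - of_int (?a i)"
        using cf_diff[OF tx wK i] cfw[OF i] by simp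
      also have "\<dots> = frac (of_nat t * cf x i) - frac (of_nat s * cf x i)"
        using st(1) by (simp add: frac_def algebra_simps)
      finally have eq: "cf (of_nat (t - s) * x - ?w) i = frac (of_nat t * cf x i) - frac (of_nat s * cf x i)" .
      have "?f s i = ?f t i" using st(3) by simp
      then have "\<lfloor>of_nat q * frac (of_nat s * cf x i)\<rfloor> = \<lfloor>of_nat q * frac (of_nat t * cf x i)\<rfloor>"
        using i by simp
      then have "\<bar>of_nat q * frac (of_nat t * cf x i) - of_nat q * frac (of_nat s * cf x i)\<bar> < 1"
        by linarith
      then have "of_nat q * \<bar>frac (of_nat t * cf x i) - frac (of_nat s * cf x i)\<bar> < 1"
        by (simp add: abs_mult flip: right_diff_distrib)
      then have "\<bar>frac (of_nat t * cf x i) - frac (of_nat s * cf x i)\<bar> < 1 / of_nat q"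
        using q(1) by (simp add: field_simps)
      then show ?thesis using eq q(2) by simp
    qed
    then have "N (of_nat (t - s) * x - ?w) < 1 / 2"
      using \<delta>(2)[OF number_field_minus[OF K tx wK]] by blast
    moreover have "t - s \<in> {1..q ^ n}" using st by auto
    ultimately show ?thesis
      by (intro bexI[of _ "t - s"] bexI[of _ ?w] int_comb_OK)
  qed
  then show ?thesis using that[of "q ^ n"] q(1) by simp
qed

definition OK_module :: "complex set \<Rightarrow> bool" where
  "OK_module J \<longleftrightarrow> (\<forall>x\<in>J. \<forall>y\<in>J. x + y \<in> J) \<and> (\<forall>a\<in>OK. \<forall>x\<in>J. a * x \<in> J)"

lemma OK_module_diff: "OK_module J \<Longrightarrow> x \<in> J \<Longrightarrow> y \<in> J \<Longrightarrow> x - y \<in> J"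
proof -
  assume *: "OK_module J" "x \<in> J" "y \<in> J"
  have "- 1 * y \<in> J" using * OK_closed(6)[of "-1"] by (auto simp: OK_module_def)
  then have "x + (- 1 * y) \<in> J" using * unfolding OK_module_def by blast
  then show ?thesis by simp
qed

text \<open>\<open>J\<close> contains \<open>m\<close> times every integer, so its elements can be
  reduced coordinatewise modulo \<open>m\<close> without leaving \<open>J\<close>. Hence
  \<open>J\<close> is determined by its intersection with the finite set of
  \<open>finite_box\<close>.\<close>

lemma finite_modules_containing:
  assumes "m \<ge> 1"
  shows "finite {J. OK_module J \<and> J \<subseteq> OK \<and> of_nat m \<in> J}" (is "finite ?A")
proof -
  let ?B = "{x \<in> OK. \<forall>i<n. 0 \<le> cf x i \<and> cf x i < of_nat m}"
  have sub: "J1 \<subseteq> J2" if J: "J1 \<in> ?A" "J2 \<in> ?A" "J1 \<inter> ?B = J2 \<inter> ?B" for J1 J2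
  proof
    fix x assume x: "x \<in> J1"
    then have xO: "x \<in> OK" and xK: "x \<in> K" using J(1) OK_sub by auto
    let ?w = "\<Sum>i<n. of_int \<lfloor>cf x i / of_nat m\<rfloor> * e i"
    let ?z = "?w * of_nat m"
    have zJ: "?z \<in> J1" "?z \<in> J2" using J(1,2) int_comb_OK by (auto simp: OK_module_def)
    have "x - ?z \<in> J1" using OK_module_diff J(1) x zJ by blast
    moreover have "x - ?z \<in> ?B"
    proof -
      have zK: "?z \<in> K" and zO: "?z \<in> OK" using zJ(1) J(1) OK_sub by auto
      have cfz: "cf ?z i = of_int \<lfloor>cf x i / of_nat m\<rfloor> * of_nat m" if i: "i < n" for i
      proof -
        have "?z = (\<Sum>i<n. of_rat (of_int \<lfloor>cf x i / of_nat m\<rfloor> * of_nat m) * e i)"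
          by (simp add: sum_distrib_left sum_distrib_right of_rat_mult mult_ac)
        then show ?thesis using cf_eq[OF i] by simp
      qed
      have m0: "(of_nat m :: rat) > 0" using assms by simp
      have "0 \<le> cf (x - ?z) i \<and> cf (x - ?z) i < of_nat m" if i: "i < n" for i
      proof -
        have "of_int \<lfloor>cf x i / of_nat m\<rfloor> * of_nat m \<le> cf x i"
          "cf x i < (of_int \<lfloor>cf x i / of_nat m\<rfloor> + 1) * of_nat m" 
          using floor_divide_lower[OF m0] floor_divide_upper[OF m0] by blast+
        then show ?thesis using cf_diff[OF xK zK i] cfz[OF i] by (simp add: distrib_right)
      qed
      then show ?thesis using OK_closed(4)[OF xO zO] by blast
    qed
    ultimately have "x - ?z \<in> J2" using J(3) by blast
    then have "(x - ?z) + ?z \<in> J2" using J(2) zJ(2) unfolding OK_module_def by blast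
    then show "x \<in> J2" by simp
  qed
  have "inj_on (\<lambda>J. J \<inter> ?B) ?A"
  proof (rule inj_onI)
    fix J1 J2 assume J: "J1 \<in> ?A" "J2 \<in> ?A" "J1 \<inter> ?B = J2 \<inter> ?B"
    show "J1 = J2" using sub[OF J] sub[OF J(2,1) J(3)[symmetric]] by (rule subset_antisym)
  qed
  moreover have "(\<lambda>J. J \<inter> ?B) ` ?A \<subseteq> Pow ?B" by blast
  ultimately show ?thesis using finite_imageD finite_subset finite_Pow_iff finite_box by meson
qed

text \<open>
  Hurwitz's argument. An element \<open>b\<close> of \<open>I\<close> whose norm is less than twice the infimum serves in place
  of one of minimal norm.
\<close>

lemma ideal_scaling:
  obtains m :: nat where "m \<ge> 1"
    "\<And>I. fractional_ideal K I \<Longrightarrow>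
       \<exists>x\<in>K. x \<noteq> 0 \<and> (*) x ` I \<subseteq> OK \<and> of_nat m \<in> (*) x ` I"
proof -
  obtain m :: nat where m: "m \<ge> 1"
    "\<And>x. x \<in> K \<Longrightarrow> \<exists>t\<in>{1..m}. \<exists>w\<in>OK. N (of_nat t * x - w) < 1 / 2"
    using norm_approximation by blast
  have "\<exists>x\<in>K. x \<noteq> 0 \<and> (*) x ` I \<subseteq> OK \<and> of_nat (fact m) \<in> (*) x ` I"
    if I: "fractional_ideal K I" for I
  proof -
    have mod: "OK_module I" and IK: "I \<subseteq> K" using I by (auto simp: fractional_ideal_def OK_module_def)
    obtain d where d: "d \<in> OK" "d \<noteq> 0" "\<forall>x\<in>I. d * x \<in> OK" using I by (auto simp: fractional_ideal_def)
    obtain x0 where x0: "x0 \<in> I" "x0 \<noteq> 0" using I by (auto simp: fractional_ideal_def)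
    let ?S = "N ` (I - {0})"
    have Nd: "N d > 0" using N_pos d OK_sub by blast
    \<comment> \<open>For nonzero \<open>x\<close> in \<open>I\<close> the product
      \<open>d * x\<close> is a nonzero integer and has norm at least 1. The infimum is therefore
      positive, hence strictly below its double.\<close>
    have lb: "N x \<ge> 1 / N d" if "x \<in> I" "x \<noteq> 0" for x
    proof -
      have "d \<in> K" "x \<in> K" using that d OK_sub IK by auto
      moreover have "N (d * x) \<ge> 1" using N_ge_1 that d by simp
      ultimately have "N d * N x \<ge> 1" by (simp add: N_mult)
      then show ?thesis using Nd by (simp add: field_simps)
    qed
    have ne: "?S \<noteq> {}" and bb: "bdd_below ?S" using x0 lb by (auto intro!: bdd_belowI[of _ "1 / N d"])
    have "1 / N d \<le> Inf ?S" by (rule cInf_greatest[OF ne]) (use lb in auto)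
    moreover have "1 / N d > 0" using Nd by simp
    ultimately have "Inf ?S > 0" by linarith
    then have "Inf ?S < 2 * Inf ?S" by simp
    then obtain b where b: "b \<in> I" "b \<noteq> 0" "N b < 2 * Inf ?S"
      using cInf_lessD[OF ne, of "2 * Inf ?S"] by blast
    have min: "Inf ?S \<le> N x" if "x \<in> I" "x \<noteq> 0" for x
      using cInf_lower[OF _ bb] that by blast
    have bK: "b \<in> K" using b IK by blast
    \<comment> \<open>The multiplier \<open>t\<close> supplied by the approximation varies with
      \<open>a\<close>, but each \<open>t \<le> m\<close> divides \<open>fact m\<close>, so one
      scaling factor serves all of \<open>I\<close>.\<close>
    let ?x = "of_nat (fact m) / b"
    have factK: "of_nat (fact m) \<in> K" using number_field_int[OF K, of "int (fact m)"] by simp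
    have "?x * a \<in> OK" if a: "a \<in> I" for a
    proof -
      have aK: "a \<in> K" using a IK by blast
      then have "a / b \<in> K" using number_field_divide[OF K _ bK] by blast
      from m(2)[OF this] obtain t w where t: "t \<in> {1..m}" and w: "w \<in> OK" "N (of_nat t * (a / b) - w) < 1 / 2"
        by blast
      let ?y = "of_nat t * (a / b) - w"
      have tO: "of_nat t \<in> OK" using OK_closed(6)[of "int t"] by simp
      have yK: "?y \<in> K" using tO w(1) aK bK OK_sub K_closed by (meson subsetD)
      have yb: "?y * b = of_nat t * a - w * b" using b(2) by (simp add: left_diff_distrib)
      have "of_nat t * a \<in> I" "w * b \<in> I" using mod a b(1) tO w(1) by (auto simp: OK_module_def)
      then have yI: "?y * b \<in> I" unfolding yb using OK_module_diff mod by blast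
      have "N (?y * b) = N ?y * N b" using N_mult yK bK by blast
      \<comment> \<open>An error of norm below 1/2, times \<open>b\<close> of norm below twice the
        infimum, gives an element of \<open>I\<close> of norm below the infimum; it must be
        0.\<close>
      also have "\<dots> \<le> 1 / 2 * N b" using w(2) N_nonneg by (intro mult_right_mono) auto
      also have "\<dots> < Inf ?S" using b(3) by simp
      finally have "?y * b = 0" using min[OF yI] by force
      then have ty: "of_nat t * (a / b) = w" using b(2) by simp
      obtain c where "fact m = t * c" using dvd_fact[of t m] t by (auto simp: dvd_def)
      then have fm: "(of_nat (fact m) :: complex) = of_nat c * of_nat t"
        by (simp only: of_nat_mult mult.commute)
      have "?x * a = of_nat c * (of_nat t * (a / b))" unfolding fm by simp
      then have "?x * a = of_int (int c) * w" by (simp only: ty of_int_of_nat_eq)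
      then show ?thesis using OK_closed w(1) by metis
    qed
    moreover have "of_nat (fact m) \<in> (*) ?x ` I" using b by (intro image_eqI[of _ _ b]) auto
    moreover have "?x \<in> K" "?x \<noteq> 0" using factK bK K_closed b(2) by auto
    ultimately show ?thesis by blast
  qed
  then show ?thesis using that[of "fact m"] by (metis fact_ge_1)
qed

lemma finite_ideal_classes_aux:
  "\<exists>\<J>. finite \<J> \<and> (\<forall>I. fractional_ideal K I \<longrightarrow> (\<exists>x\<in>K. x \<noteq> 0 \<and> (*) x ` I \<in> \<J>))"
proof -
  obtain m :: nat where m: "m \<ge> 1" "\<And>I. fractional_ideal K I \<Longrightarrow>
       \<exists>x\<in>K. x \<noteq> 0 \<and> (*) x ` I \<subseteq> OK \<and> of_nat m \<in> (*) x ` I"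
    using ideal_scaling by blast
  let ?J = "{J. OK_module J \<and> J \<subseteq> OK \<and> of_nat m \<in> J}"
  have "\<exists>x\<in>K. x \<noteq> 0 \<and> (*) x ` I \<in> ?J" if I: "fractional_ideal K I" for I
  proof -
    obtain x where x: "x \<in> K" "x \<noteq> 0" "(*) x ` I \<subseteq> OK" "of_nat m \<in> (*) x ` I"
      using m(2)[OF I] by blast
    have "OK_module ((*) x ` I)"
      unfolding OK_module_def
    proof (intro conjI ballI)
      fix y z assume "y \<in> (*) x ` I" "z \<in> (*) x ` I"
      then obtain a b where "a \<in> I" "b \<in> I" "y = x * a" "z = x * b" by blast
      then show "y + z \<in> (*) x ` I" using I
        by (intro image_eqI[of _ _ "a + b"]) (auto simp: fractional_ideal_def distrib_left)
    next
      fix c y assume "c \<in> OK" "y \<in> (*) x ` I"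
      then obtain a where "a \<in> I" "y = x * a" by blast
      then show "c * y \<in> (*) x ` I" using I \<open>c \<in> OK\<close>
        by (intro image_eqI[of _ _ "c * a"]) (auto simp: fractional_ideal_def)
    qed
    then show ?thesis using x by blast
  qed
  then show ?thesis using finite_modules_containing[OF m(1)] by blast
qed

end

lemma finite_ideal_classes:
  assumes "number_field K"
  obtains \<J> where "finite \<J>"
    "\<And>I. fractional_ideal K I \<Longrightarrow> \<exists>x\<in>K. x \<noteq> 0 \<and> (*) x ` I \<in> \<J>"
proof -
  obtain n e cf where "integral_rat_basis K n e cf" using integral_rat_basis_exists[OF assms] .
  then interpret integral_rat_basis K n e cf .
  show ?thesis using finite_ideal_classes_aux that by blast
qed

section \<open>The class group\<close>

lemma ideal_mult_zero: "0 \<in> ideal_mult I J"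
  unfolding ideal_mult_def by (rule CollectI) (rule exI[of _ "0::nat"], simp)

lemma ideal_mult_cons:
  assumes "a \<in> I" "b \<in> J" "y \<in> ideal_mult I J"
  shows "a * b + y \<in> ideal_mult I J"
proof -
  obtain n :: nat and f g where y: "y = (\<Sum>i<n. f i * g i)" "\<forall>i<n. f i \<in> I \<and> g i \<in> J"
    using assms(3) unfolding ideal_mult_def by auto
  let ?f = "f(n := a)" and ?g = "g(n := b)"
  have "a * b + y = (\<Sum>i<Suc n. ?f i * ?g i)" by (simp add: y(1))
  moreover have "\<forall>i<Suc n. ?f i \<in> I \<and> ?g i \<in> J" using y(2) assms by (auto simp: less_Suc_eq)
  ultimately show ?thesis unfolding ideal_mult_def by blast
qed

lemma ideal_mult_prod: "a \<in> I \<Longrightarrow> b \<in> J \<Longrightarrow> a * b \<in> ideal_mult I J"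
  using ideal_mult_cons[OF _ _ ideal_mult_zero, of a I b J] by simp

text \<open>Sums of products are treated like lists, one term at a time, which spares the later
  proofs any concatenation of indexed families.\<close>

lemma ideal_mult_induct [consumes 1, case_names zero cons]:
  assumes "x \<in> ideal_mult I J" "P 0"
    and step: "\<And>a b y. a \<in> I \<Longrightarrow> b \<in> J \<Longrightarrow> y \<in> ideal_mult I J \<Longrightarrow> P y \<Longrightarrow> P (a * b + y)"
  shows "P x"
proof -
  have "(\<forall>i<n. f i \<in> I \<and> g i \<in> J) \<Longrightarrow> (\<Sum>i<n. f i * g i) \<in> ideal_mult I J \<and> P (\<Sum>i<n. f i * g i)"
    for n :: nat and f g
  proof (induction n)
    case (Suc n)
    then show ?case
      using step[of "f n" "g n" "\<Sum>i<n. f i * g i"]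
        ideal_mult_cons[of "f n" I "g n" J "\<Sum>i<n. f i * g i"]
      by (simp add: add.commute)
  qed (use assms(2) ideal_mult_zero in auto)
  then show ?thesis using assms(1) unfolding ideal_mult_def by blast
qed

lemma ideal_mult_add:
  assumes "x \<in> ideal_mult I J" "y \<in> ideal_mult I J"
  shows "x + y \<in> ideal_mult I J"
  using assms(1) by (induction rule: ideal_mult_induct) (simp_all add: assms(2) ideal_mult_cons add.assoc)

lemma ideal_mult_commute: "ideal_mult I J = ideal_mult J I"
proof -
  have "x \<in> ideal_mult J I" if "x \<in> ideal_mult I J" for x I J
    using that
  proof (induction rule: ideal_mult_induct)
    case (cons a b y)
    then show ?case using ideal_mult_cons[of b J a I y] by (simp add: mult.commute)
  qed (rule ideal_mult_zero)
  then show ?thesis by blast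
qed

lemma ideal_mult_assoc: "ideal_mult (ideal_mult I J) L = ideal_mult I (ideal_mult J L)"
proof -
  have sub: "ideal_mult (ideal_mult I J) L \<subseteq> ideal_mult I (ideal_mult J L)" for I J L
  proof
    fix x assume "x \<in> ideal_mult (ideal_mult I J) L"
    then show "x \<in> ideal_mult I (ideal_mult J L)"
    proof (induction rule: ideal_mult_induct)
      case (cons u c y)
      have c: "c \<in> L" by (rule cons(2))
      from cons(1) have "u * c \<in> ideal_mult I (ideal_mult J L)"
      proof (induction rule: ideal_mult_induct)
        case (cons a b z)
        have "a * (b * c) + z * c \<in> ideal_mult I (ideal_mult J L)"
          by (rule ideal_mult_cons[OF cons(1) ideal_mult_prod[OF cons(2) c] cons(4)])
        then show ?case by (simp add: distrib_right mult.assoc)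
      qed (simp add: ideal_mult_zero)
      then show ?case using cons ideal_mult_add by blast
    qed (rule ideal_mult_zero)
  qed
  \<comment> \<open>The reverse inclusion is the proved one for the factors in the opposite order,
    by commutativity.\<close>
  have "ideal_mult I (ideal_mult J L) = ideal_mult (ideal_mult L J) I"
    by (simp only: ideal_mult_commute[of I] ideal_mult_commute[of J L])
  also have "\<dots> \<subseteq> ideal_mult L (ideal_mult J I)" by (rule sub)
  also have "\<dots> = ideal_mult (ideal_mult I J) L"
    by (simp only: ideal_mult_commute[of L] ideal_mult_commute[of J I])
  finally show ?thesis by (rule subset_antisym[OF sub])
qed

lemma fractional_ideal_mult:
  assumes K: "number_field K" and I: "fractional_ideal K I" and J: "fractional_ideal K J"
  shows "fractional_ideal K (ideal_mult I J)"
proof -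
  obtain a where a: "a \<in> I" "a \<noteq> 0" using I by (auto simp: fractional_ideal_def)
  obtain b where b: "b \<in> J" "b \<noteq> 0" using J by (auto simp: fractional_ideal_def)
  obtain d where d: "d \<in> ring_of_integers K" "d \<noteq> 0" "\<forall>x\<in>I. d * x \<in> ring_of_integers K"
    using I by (auto simp: fractional_ideal_def)
  obtain d' where d': "d' \<in> ring_of_integers K" "d' \<noteq> 0" "\<forall>x\<in>J. d' * x \<in> ring_of_integers K"
    using J by (auto simp: fractional_ideal_def)
  note R = ring_of_integers_closed[OF K]
  show ?thesis unfolding fractional_ideal_def
  proof (intro conjI ballI)
    show "ideal_mult I J \<subseteq> K"
    proof
      fix x assume "x \<in> ideal_mult I J"
      then show "x \<in> K"
        using I J by (induction rule: ideal_mult_induct)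
          (auto simp: fractional_ideal_def intro!: number_field_closed[OF K])
    qed
    show "0 \<in> ideal_mult I J" by (rule ideal_mult_zero)
    have "a * b \<in> ideal_mult I J" "a * b \<noteq> 0" using a b ideal_mult_prod by auto
    then show "ideal_mult I J \<noteq> {0}" by blast
    show "x + y \<in> ideal_mult I J" if "x \<in> ideal_mult I J" "y \<in> ideal_mult I J" for x y
      using that by (rule ideal_mult_add)
    show "c * x \<in> ideal_mult I J" if c: "c \<in> ring_of_integers K" and "x \<in> ideal_mult I J" for c x
      using that(2)
    proof (induction rule: ideal_mult_induct)
      case (cons a b y)
      have "c * a \<in> I" using I c cons(1) by (auto simp: fractional_ideal_def)
      then have "(c * a) * b + c * y \<in> ideal_mult I J" using cons by (intro ideal_mult_cons)
      then show ?case by (simp add: distrib_left mult.assoc)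
    qed (simp add: ideal_mult_zero)
    show "\<exists>d\<in>ring_of_integers K. d \<noteq> 0 \<and> (\<forall>x\<in>ideal_mult I J. d * x \<in> ring_of_integers K)"
    proof (intro bexI[of _ "d * d'"] conjI ballI)
      fix x assume "x \<in> ideal_mult I J"
      then show "d * d' * x \<in> ring_of_integers K"
      proof (induction rule: ideal_mult_induct)
        case (cons a b y)
        have "d * a \<in> ring_of_integers K" "d' * b \<in> ring_of_integers K"
          using cons d(3) d'(3) by auto
        from R(3)[OF R(5)[OF this] cons(4)]
        have "(d * a) * (d' * b) + d * d' * y \<in> ring_of_integers K" .
        then show ?case by (simp add: algebra_simps)
      qed (simp add: R)
    qed (use d d' R in auto)
  qed
qed

lemma ideal_mult_one:
  assumes K: "number_field K" and I: "fractional_ideal K I"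
  shows "ideal_mult (ring_of_integers K) I = I"
proof
  show "ideal_mult (ring_of_integers K) I \<subseteq> I"
  proof
    fix x assume "x \<in> ideal_mult (ring_of_integers K) I"
    then show "x \<in> I"
      using I by (induction rule: ideal_mult_induct) (auto simp: fractional_ideal_def)
  qed
  show "I \<subseteq> ideal_mult (ring_of_integers K) I"
    using ideal_mult_prod[OF ring_of_integers_closed(2)[OF K]] by (metis mult_1 subsetI)
qed

lemma fractional_ideal_principal:
  assumes K: "number_field K" and x: "x \<in> K" "x \<noteq> 0"
  shows "fractional_ideal K ((*) x ` ring_of_integers K)"
proof -
  note R = ring_of_integers_closed[OF K]
  obtain d :: int where d: "d > 0" "of_int d * x \<in> ring_of_integers K"
    using number_field_integral_multiple[OF K x(1)] .
  show ?thesis unfolding fractional_ideal_def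
  proof (intro conjI ballI)
    show "(*) x ` ring_of_integers K \<subseteq> K"
      using x(1) by (auto simp: ring_of_integers_def intro: number_field_mult[OF K])
    show "0 \<in> (*) x ` ring_of_integers K" using R(1) by (intro image_eqI[of _ _ 0]) auto
    have "x \<in> (*) x ` ring_of_integers K" using R(2) by (intro image_eqI[of _ _ 1]) auto
    then show "(*) x ` ring_of_integers K \<noteq> {0}" using x(2) by blast
    show "y + z \<in> (*) x ` ring_of_integers K"
      if "y \<in> (*) x ` ring_of_integers K" "z \<in> (*) x ` ring_of_integers K" for y z
      using that R(3) by (auto simp flip: distrib_left)
    show "c * y \<in> (*) x ` ring_of_integers K"
      if "c \<in> ring_of_integers K" "y \<in> (*) x ` ring_of_integers K" for c y
      using that R(5) by (auto simp: mult.left_commute)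
    show "\<exists>d\<in>ring_of_integers K. d \<noteq> 0 \<and> (\<forall>y\<in>(*) x ` ring_of_integers K. d * y \<in> ring_of_integers K)"
    proof (intro bexI[of _ "of_int d"] conjI ballI)
      show "of_int d * y \<in> ring_of_integers K" if "y \<in> (*) x ` ring_of_integers K" for y
        using that R(5)[OF d(2)] by (auto simp: mult.assoc)
    qed (use d R(6) in auto)
  qed
qed

text \<open>Links ideal classes to the scaled ideals of \<open>finite_ideal_classes\<close>: scaling
  an ideal does not change its class.\<close>

lemma ideal_mult_principal:
  assumes K: "number_field K" and I: "fractional_ideal K I"
  shows "ideal_mult ((*) x ` ring_of_integers K) I = (*) x ` I"
proof
  show "ideal_mult ((*) x ` ring_of_integers K) I \<subseteq> (*) x ` I"
  proof
    fix y assume "y \<in> ideal_mult ((*) x ` ring_of_integers K) I"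
    then show "y \<in> (*) x ` I"
    proof (induction rule: ideal_mult_induct)
      case zero
      then show ?case using I by (intro image_eqI[of _ _ 0]) (auto simp: fractional_ideal_def)
    next
      case (cons a b z)
      then obtain c w where "c \<in> ring_of_integers K" "a = x * c" "w \<in> I" "z = x * w" by blast
      then show ?case using I cons(2)
        by (intro image_eqI[of _ _ "c * b + w"]) (auto simp: fractional_ideal_def algebra_simps)
    qed
  qed
  show "(*) x ` I \<subseteq> ideal_mult ((*) x ` ring_of_integers K) I"
  proof
    fix y assume "y \<in> (*) x ` I"
    then obtain a where "a \<in> I" "y = (x * 1) * a" by auto
    then show "y \<in> ideal_mult ((*) x ` ring_of_integers K) I"
      using ideal_mult_prod[of "x * 1" "(*) x ` ring_of_integers K" a I] ring_of_integers_closed(2)[OF K] by blast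
  qed
qed

section \<open>The ideal group and its quotient by the principal ideals\<close>

lemma comm_monoid_fractional_ideals:
  assumes K: "number_field K"
  shows "comm_monoid (fractional_ideals K)"
proof (rule comm_monoidI)
  have "fractional_ideal K ((*) 1 ` ring_of_integers K)"
    using fractional_ideal_principal[OF K number_field_1[OF K]] by simp
  then show "\<one>\<^bsub>fractional_ideals K\<^esub> \<in> carrier (fractional_ideals K)"
    by (simp add: fractional_ideals_def)
  show "I \<otimes>\<^bsub>fractional_ideals K\<^esub> J = J \<otimes>\<^bsub>fractional_ideals K\<^esub> I" for I J
    by (simp add: fractional_ideals_def ideal_mult_commute)
qed (auto simp: fractional_ideals_def fractional_ideal_mult[OF K] ideal_mult_assoc ideal_mult_one[OF K])

lemma comm_group_ideal_group:
  assumes K: "number_field K"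
  shows "comm_group (ideal_group K)"
proof -
  interpret comm_monoid "fractional_ideals K" by (rule comm_monoid_fractional_ideals[OF K])
  show ?thesis unfolding ideal_group_def by (rule units_comm_group)
qed

lemma principal_ideal_unit:
  assumes K: "number_field K" and x: "x \<in> K" "x \<noteq> 0"
  shows "(*) x ` ring_of_integers K \<in> carrier (ideal_group K)"
    and "inv\<^bsub>ideal_group K\<^esub> ((*) x ` ring_of_integers K) = (*) (inverse x) ` ring_of_integers K"
proof -
  interpret M: comm_monoid "fractional_ideals K" by (rule comm_monoid_fractional_ideals[OF K])
  interpret G: comm_group "ideal_group K" by (rule comm_group_ideal_group[OF K])
  let ?P = "\<lambda>x. (*) x ` ring_of_integers K"
  have fi: "fractional_ideal K (?P x)" "fractional_ideal K (?P (inverse x))"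
    using x number_field_inverse[OF K] by (auto intro!: fractional_ideal_principal[OF K])
  have m: "ideal_mult (?P y) (?P z) = ?P (y * z)" if "fractional_ideal K (?P z)" for y z
    using ideal_mult_principal[OF K that, of y] by (simp add: image_image mult.assoc)
  have eq: "ideal_mult (?P x) (?P (inverse x)) = ring_of_integers K" "ideal_mult (?P (inverse x)) (?P x) = ring_of_integers K"
    using m fi x by simp_all
  have U: "?P x \<in> Units (fractional_ideals K)" "?P (inverse x) \<in> Units (fractional_ideals K)"
    unfolding Units_def using fi eq by (auto simp: fractional_ideals_def)
  then show c: "?P x \<in> carrier (ideal_group K)"
    by (simp add: ideal_group_def units_of_carrier)
  show "inv\<^bsub>ideal_group K\<^esub> ?P x = ?P (inverse x)"
  proof (rule G.inv_equality)
    show "?P (inverse x) \<otimes>\<^bsub>ideal_group K\<^esub> ?P x = \<one>\<^bsub>ideal_group K\<^esub>"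
      using eq by (simp add: ideal_group_def units_of_mult units_of_one fractional_ideals_def)
  qed (use U in \<open>auto simp: ideal_group_def units_of_carrier\<close>)
qed

lemma principal_ideals_subgroup:
  assumes K: "number_field K"
  shows "subgroup (principal_ideals K) (ideal_group K)"
proof -
  interpret G: comm_group "ideal_group K" by (rule comm_group_ideal_group[OF K])
  have PI: "I \<in> principal_ideals K \<longleftrightarrow> (\<exists>x. x \<in> K \<and> x \<noteq> 0 \<and> I = (*) x ` ring_of_integers K)" for I
    by (auto simp: principal_ideals_def)
  show ?thesis
  proof (rule G.subgroupI)
    show "principal_ideals K \<subseteq> carrier (ideal_group K)"
      using principal_ideal_unit(1)[OF K] by (auto simp: PI)
    show "principal_ideals K \<noteq> {}" using number_field_1[OF K] PI[of "(*) 1 ` ring_of_integers K"] by force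
    show "inv\<^bsub>ideal_group K\<^esub> I \<in> principal_ideals K" if "I \<in> principal_ideals K" for I
    proof -
      from that obtain x where x: "x \<in> K" "x \<noteq> 0" "I = (*) x ` ring_of_integers K" using PI[of I] by blast
      then show ?thesis
        using principal_ideal_unit(2)[OF K x(1,2)] number_field_inverse[OF K x(1)] unfolding PI by auto
    qed
    show "I \<otimes>\<^bsub>ideal_group K\<^esub> J \<in> principal_ideals K" if IJ: "I \<in> principal_ideals K" "J \<in> principal_ideals K" for I J
    proof -
      obtain x where x: "x \<in> K" "x \<noteq> 0" "I = (*) x ` ring_of_integers K" using PI[of I] IJ(1) by blast
      obtain y where y: "y \<in> K" "y \<noteq> 0" "J = (*) y ` ring_of_integers K" using PI[of J] IJ(2) by blast
      have "I \<otimes>\<^bsub>ideal_group K\<^esub> J = (*) (x * y) ` ring_of_integers K"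
        using ideal_mult_principal[OF K fractional_ideal_principal[OF K y(1,2)], of x] x y
        by (simp add: ideal_group_def units_of_mult fractional_ideals_def image_image mult.assoc)
      then show ?thesis using x y number_field_mult[OF K] unfolding PI by (auto intro!: exI[of _ "x * y"])
    qed
  qed
qed

lemma comm_group_FactGroup:
  assumes "comm_group G" "subgroup H G"
  shows "comm_group (G Mod H)"
proof -
  interpret G: comm_group G by fact
  interpret N: normal H G by (rule G.subgroup_imp_normal[OF assms(2)])
  show ?thesis
  proof (rule group.group_comm_groupI[OF N.factorgroup_is_group])
    fix x y assume "x \<in> carrier (G Mod H)" "y \<in> carrier (G Mod H)"
    then show "x \<otimes>\<^bsub>G Mod H\<^esub> y = y \<otimes>\<^bsub>G Mod H\<^esub> x"
      by (auto simp: FactGroup_def RCOSETS_def N.rcos_sum G.m_comm)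
  qed
qed

lemma comm_group_class_group:
  assumes K: "number_field K"
  shows "comm_group (class_group K)"
  unfolding class_group_def
  by (rule comm_group_FactGroup[OF comm_group_ideal_group[OF K] principal_ideals_subgroup[OF K]])

text \<open>Every ideal can be scaled into a fixed finite family without changing its coset, so the
  cosets of the members of that family include all classes.\<close>

theorem finite_class_group:
  assumes K: "number_field K"
  shows "finite (carrier (class_group K))"
proof -
  interpret G: comm_group "ideal_group K" by (rule comm_group_ideal_group[OF K])
  interpret S: subgroup "principal_ideals K" "ideal_group K" by (rule principal_ideals_subgroup[OF K])
  obtain \<J> where \<J>: "finite \<J>" "\<And>I. fractional_ideal K I \<Longrightarrow> \<exists>x\<in>K. x \<noteq> 0 \<and> (*) x ` I \<in> \<J>"
    by (rule finite_ideal_classes[OF K]) (rule that)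
  have "carrier (class_group K) \<subseteq> (\<lambda>J. principal_ideals K #>\<^bsub>ideal_group K\<^esub> J) ` \<J>"
  proof
    fix c assume "c \<in> carrier (class_group K)"
    then obtain I where I: "I \<in> carrier (ideal_group K)" "c = principal_ideals K #>\<^bsub>ideal_group K\<^esub> I"
      by (auto simp: class_group_def FactGroup_def RCOSETS_def)
    have fI: "fractional_ideal K I"
      using I(1) by (auto simp: ideal_group_def units_of_carrier Units_def fractional_ideals_def)
    obtain x where x: "x \<in> K" "x \<noteq> 0" "(*) x ` I \<in> \<J>" using \<J>(2)[OF fI] by blast
    let ?P = "(*) x ` ring_of_integers K"
    have PP: "?P \<in> principal_ideals K" using x by (auto simp: principal_ideals_def)
    have "?P \<otimes>\<^bsub>ideal_group K\<^esub> I = (*) x ` I"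
      using ideal_mult_principal[OF K fI] by (simp add: ideal_group_def units_of_mult fractional_ideals_def)
    then have "principal_ideals K #>\<^bsub>ideal_group K\<^esub> ((*) x ` I)
        = (principal_ideals K #>\<^bsub>ideal_group K\<^esub> ?P) #>\<^bsub>ideal_group K\<^esub> I"
      using G.coset_mult_assoc[OF S.subset S.mem_carrier[OF PP] I(1)] by simp
    also have "principal_ideals K #>\<^bsub>ideal_group K\<^esub> ?P = principal_ideals K"
      by (rule G.coset_join2[OF S.mem_carrier[OF PP] principal_ideals_subgroup[OF K] PP])
    finally show "c \<in> (\<lambda>J. principal_ideals K #>\<^bsub>ideal_group K\<^esub> J) ` \<J>" using I(2) x(3) by blast
  qed
  then show ?thesis using \<J>(1) finite_subset by blast
qed

section \<open>Torsion and ranks of finite abelian groups\<close>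

text \<open>Exponent \<open>p\<close> makes integer powers depend only on the exponent modulo
  \<open>p\<close>; with this the module axioms over the residue ring become laws of powers.\<close>

lemma vectorspace_module_of_group:
  assumes p: "prime p" and Q: "comm_group Q" and ex: "\<And>x. x \<in> carrier Q \<Longrightarrow> x [^]\<^bsub>Q\<^esub> p = \<one>\<^bsub>Q\<^esub>"
  shows "vectorspace (residue_ring (int p)) (module_of_group Q)"
proof -
  interpret Q: comm_group Q by fact
  interpret residues_prime p "residue_ring (int p)" by unfold_locales (simp_all add: p)
  let ?R = "residue_ring (int p)" and ?M = "module_of_group Q"
  have pw: "x [^]\<^bsub>Q\<^esub> (a mod int p) = x [^]\<^bsub>Q\<^esub> a" if x: "x \<in> carrier Q" for x a
  proof -
    have "x [^]\<^bsub>Q\<^esub> a = x [^]\<^bsub>Q\<^esub> (int p * (a div int p) + a mod int p)" by simp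
    also have "\<dots> = (x [^]\<^bsub>Q\<^esub> int p) [^]\<^bsub>Q\<^esub> (a div int p) \<otimes>\<^bsub>Q\<^esub> x [^]\<^bsub>Q\<^esub> (a mod int p)"
      using x by (simp only: Q.int_pow_mult Q.int_pow_pow)
    also have "\<dots> = x [^]\<^bsub>Q\<^esub> (a mod int p)" using x ex by (simp add: int_pow_int)
    finally show ?thesis by simp
  qed
  have ab: "abelian_group ?M"
  proof (rule abelian_groupI)
    fix x assume "x \<in> carrier ?M"
    then show "\<exists>y\<in>carrier ?M. y \<oplus>\<^bsub>?M\<^esub> x = \<zero>\<^bsub>?M\<^esub>"
      by (intro bexI[of _ "inv\<^bsub>Q\<^esub> x"]) (simp_all add: module_of_group_def)
  qed (simp_all add: module_of_group_def Q.m_ac)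
  have "Module.module ?R ?M"
  proof (rule Module.moduleI[OF cring ab])
    fix a x assume "a \<in> carrier ?R" "x \<in> carrier ?M"
    then show "a \<odot>\<^bsub>?M\<^esub> x \<in> carrier ?M" by (simp add: module_of_group_def)
  next
    fix a b x assume "x \<in> carrier ?M"
    then have x: "x \<in> carrier Q" by (simp add: module_of_group_def)
    show "(a \<oplus>\<^bsub>?R\<^esub> b) \<odot>\<^bsub>?M\<^esub> x = a \<odot>\<^bsub>?M\<^esub> x \<oplus>\<^bsub>?M\<^esub> b \<odot>\<^bsub>?M\<^esub> x"
      using x by (simp add: module_of_group_def residue_ring_def pw Q.int_pow_mult)
    show "(a \<otimes>\<^bsub>?R\<^esub> b) \<odot>\<^bsub>?M\<^esub> x = a \<odot>\<^bsub>?M\<^esub> (b \<odot>\<^bsub>?M\<^esub> x)"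
      using x by (simp add: module_of_group_def residue_ring_def pw Q.int_pow_pow mult.commute)
    show "\<one>\<^bsub>?R\<^esub> \<odot>\<^bsub>?M\<^esub> x = x"
      using x by (simp add: module_of_group_def residue_ring_def)
  next
    fix a x y assume "x \<in> carrier ?M" "y \<in> carrier ?M"
    then show "a \<odot>\<^bsub>?M\<^esub> (x \<oplus>\<^bsub>?M\<^esub> y) = a \<odot>\<^bsub>?M\<^esub> x \<oplus>\<^bsub>?M\<^esub> a \<odot>\<^bsub>?M\<^esub> y"
      by (simp add: module_of_group_def Q.int_pow_distrib)
  qed
  then show ?thesis using is_field unfolding vectorspace_def by blast
qed

lemma (in vectorspace) card_carrier_eq_power_dim:
  assumes "finite (carrier V)"
  shows "card (carrier V) = card (carrier K) ^ dim"
proof -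
  have "fin_dim" unfolding fin_dim_def
    using assms by (intro exI[of _ "carrier V"]) (use in_own_span[of "carrier V"] span_is_subset2[of "carrier V"] in auto)
  then obtain B where B: "finite B" "basis B" using finite_basis_exists by blast
  then have BV: "B \<subseteq> carrier V" by (simp add: basis_def)
  note crit = basis_criterion[OF B(1) BV, THEN iffD1, OF B(2), rule_format]
  have "bij_betw (\<lambda>a. lincomb a B) (B \<rightarrow>\<^sub>E carrier K) (carrier V)"
  proof (rule bij_betw_imageI)
    show "inj_on (\<lambda>a. lincomb a B) (B \<rightarrow>\<^sub>E carrier K)"
    proof (rule inj_onI)
      fix a b assume ab: "a \<in> B \<rightarrow>\<^sub>E carrier K" "b \<in> B \<rightarrow>\<^sub>E carrier K" "lincomb a B = lincomb b B"
      have "lincomb a B \<in> carrier V" using ab(1) BV B(1) by (intro lincomb_closed) auto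
      from crit[OF this] show "a = b" using ab by metis
    qed
    show "(\<lambda>a. lincomb a B) ` (B \<rightarrow>\<^sub>E carrier K) = carrier V"
    proof
      show "(\<lambda>a. lincomb a B) ` (B \<rightarrow>\<^sub>E carrier K) \<subseteq> carrier V"
        using BV B(1) by (intro image_subsetI lincomb_closed) auto
      show "carrier V \<subseteq> (\<lambda>a. lincomb a B) ` (B \<rightarrow>\<^sub>E carrier K)"
        using crit by blast
    qed
  qed
  then have "card (carrier V) = card (B \<rightarrow>\<^sub>E carrier K)" by (rule bij_betw_same_card[symmetric])
  then show ?thesis using dim_basis[OF B] B(1) by (simp add: card_PiE)
qed

lemma card_eq_power_dim:
  assumes p: "prime p" and Q: "comm_group Q" and ex: "\<And>x. x \<in> carrier Q \<Longrightarrow> x [^]\<^bsub>Q\<^esub> p = \<one>\<^bsub>Q\<^esub>"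
    and "finite (carrier Q)"
  shows "card (carrier Q) = p ^ vectorspace.dim (residue_ring (int p)) (module_of_group Q)"
proof -
  interpret vectorspace "residue_ring (int p)" "module_of_group Q"
    using vectorspace_module_of_group[OF p Q ex] .
  have "carrier (module_of_group Q) = carrier Q" by (simp add: module_of_group_def)
  moreover have "card (carrier (residue_ring (int p))) = p" by (simp add: residue_ring_def)
  ultimately show ?thesis using card_carrier_eq_power_dim assms(4) by (simp only:)
qed

context comm_group
begin

lemma subgroup_comm_group:
  assumes "subgroup H G"
  shows "comm_group (G\<lparr>carrier := H\<rparr>)"
proof (rule group.group_comm_groupI[OF subgroup.subgroup_is_group[OF assms is_group]])
  fix x y assume "x \<in> carrier (G\<lparr>carrier := H\<rparr>)" "y \<in> carrier (G\<lparr>carrier := H\<rparr>)"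
  then show "x \<otimes>\<^bsub>G\<lparr>carrier := H\<rparr>\<^esub> y = y \<otimes>\<^bsub>G\<lparr>carrier := H\<rparr>\<^esub> x"
    using subgroup.mem_carrier[OF assms] by (simp add: m_comm)
qed

lemma nat_pow_hom: "group_hom G G (\<lambda>x. x [^] (n::nat))"
  by unfold_locales (auto simp: hom_def nat_pow_distrib)

lemma multiples_subgroup: "subgroup (multiples G n) G"
  unfolding multiples_def using group_hom.img_is_subgroup[OF nat_pow_hom] .

text \<open>Each nonempty fibre of the \<open>n\<close>-th power map is a translate of its kernel,
  so all fibres are equally large.\<close>

lemma card_torsion_times_multiples:
  assumes "finite (carrier G)"
  shows "card (torsion G n) * card (multiples G n) = Coset.order G"
proof -
  have fib: "card {x \<in> carrier G. x [^] n = y} = card (torsion G n)" if y: "y \<in> multiples G n" for y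
  proof -
    obtain a where a: "a \<in> carrier G" "y = a [^] n" using y by (auto simp: multiples_def)
    have inv: "inv a \<otimes> (a \<otimes> x) = x" "a \<otimes> (inv a \<otimes> x) = x" if "x \<in> carrier G" for x
      using a that m_assoc[of "inv a" a x] m_assoc[of a "inv a" x] by simp_all
    have "bij_betw (\<lambda>x. a \<otimes> x) (torsion G n) {x \<in> carrier G. x [^] n = y}"
    proof (rule bij_betw_byWitness[where f' = "\<lambda>x. inv a \<otimes> x"])
      show "\<forall>x\<in>torsion G n. inv a \<otimes> (a \<otimes> x) = x"
        using inv by (simp add: torsion_def)
      show "\<forall>x\<in>{x \<in> carrier G. x [^] n = y}. a \<otimes> (inv a \<otimes> x) = x"
        using inv by simp
      show "(\<otimes>) a ` torsion G n \<subseteq> {x \<in> carrier G. x [^] n = y}"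
        using a by (auto simp: torsion_def nat_pow_distrib)
      show "(\<otimes>) (inv a) ` {x \<in> carrier G. x [^] n = y} \<subseteq> torsion G n"
        using a by (auto simp: torsion_def nat_pow_distrib nat_pow_inv)
    qed
    then show ?thesis by (simp add: bij_betw_same_card)
  qed
  have "Coset.order G = card (\<Union>y\<in>multiples G n. {x \<in> carrier G. x [^] n = y})"
    unfolding Coset.order_def by (rule arg_cong[of _ _ card]) (auto simp: multiples_def)
  also have "\<dots> = (\<Sum>y\<in>multiples G n. card {x \<in> carrier G. x [^] n = y})"
    using assms by (intro card_UN_disjoint) (auto simp: multiples_def)
  also have "\<dots> = card (torsion G n) * card (multiples G n)" by (simp add: fib)
  finally show ?thesis by simp
qed

lemma multiples_mult:
  "multiples (G\<lparr>carrier := multiples G m\<rparr>) n = multiples G (m * n)"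
  by (auto simp: multiples_def nat_pow_consistent[symmetric] nat_pow_pow image_image)

text \<open>Lagrange's theorem for the quotient of \<open>p^(j-1) G\<close> by \<open>p^j G\<close>:
  it has exponent \<open>p\<close>, so it is a vector space whose order is \<open>p\<close> to its
  dimension.\<close>

lemma card_multiples_step:
  assumes fin: "finite (carrier G)" and p: "prime p" and j: "j \<ge> 1"
  shows "card (multiples G (p ^ (j - 1))) = p ^ rk p j G * card (multiples G (p ^ j))"
proof -
  let ?H = "G\<lparr>carrier := multiples G (p ^ (j - 1))\<rparr>" and ?N = "multiples G (p ^ j)"
  interpret S: subgroup "multiples G (p ^ (j - 1))" G by (rule multiples_subgroup)
  interpret H: comm_group ?H by (rule subgroup_comm_group[OF multiples_subgroup])
  have pj: "p ^ (j - 1) * p = p ^ j" using j by (cases j) auto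
  then have N: "?N = multiples ?H p" by (simp add: multiples_mult)
  then have sub: "subgroup ?N ?H" using H.multiples_subgroup by simp
  have finH: "finite (carrier ?H)" using fin S.subset finite_subset by simp
  interpret N: normal ?N ?H by (rule H.subgroup_imp_normal[OF sub])
  have Q: "comm_group (?H Mod ?N)" by (rule comm_group_FactGroup[OF H.comm_group_axioms sub])
  have powQ: "(?N #>\<^bsub>?H\<^esub> x) [^]\<^bsub>?H Mod ?N\<^esub> (k::nat) = ?N #>\<^bsub>?H\<^esub> (x [^]\<^bsub>?H\<^esub> k)" if x: "x \<in> carrier ?H" for x k
  proof (induction k)
    case 0
    then show ?case using H.coset_mult_one[OF N.subset] by (simp add: FactGroup_def)
  next
    case (Suc k)
    have "(?N #>\<^bsub>?H\<^esub> x) [^]\<^bsub>?H Mod ?N\<^esub> Suc k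
        = (?N #>\<^bsub>?H\<^esub> (x [^]\<^bsub>?H\<^esub> k)) <#>\<^bsub>?H\<^esub> (?N #>\<^bsub>?H\<^esub> x)"
      using Suc by (simp add: FactGroup_def)
    also have "\<dots> = ?N #>\<^bsub>?H\<^esub> (x [^]\<^bsub>?H\<^esub> k \<otimes>\<^bsub>?H\<^esub> x)"
      by (rule N.rcos_sum[OF H.nat_pow_closed[OF x] x])
    finally show ?case by simp
  qed
  have ex: "c [^]\<^bsub>?H Mod ?N\<^esub> p = \<one>\<^bsub>?H Mod ?N\<^esub>" if c: "c \<in> carrier (?H Mod ?N)" for c
  proof -
    obtain x where x: "x \<in> carrier ?H" "c = ?N #>\<^bsub>?H\<^esub> x"
      using c by (auto simp: FactGroup_def RCOSETS_def)
    have "x [^]\<^bsub>?H\<^esub> p \<in> multiples ?H p" using x(1) unfolding multiples_def by (rule imageI)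
    then have "x [^]\<^bsub>?H\<^esub> p \<in> ?N" by (simp only: N)
    then have "?N #>\<^bsub>?H\<^esub> (x [^]\<^bsub>?H\<^esub> p) = ?N"
      using H.coset_join2[OF H.nat_pow_closed[OF x(1)] sub] by blast
    then show ?thesis using powQ[OF x(1)] x(2) by (simp add: FactGroup_def)
  qed
  have cQ: "carrier (?H Mod ?N) = rcosets\<^bsub>?H\<^esub> ?N" by (simp add: FactGroup_def)
  have finQ: "finite (carrier (?H Mod ?N))"
    unfolding cQ RCOSETS_def using finH by simp
  have "card (rcosets\<^bsub>?H\<^esub> ?N) * card ?N = Coset.order ?H" by (rule H.lagrange[OF sub])
  moreover have "card (rcosets\<^bsub>?H\<^esub> ?N) = p ^ rk p j G"
    using card_eq_power_dim[OF p Q ex finQ] unfolding cQ rk_def by simp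
  ultimately show ?thesis by (simp add: Coset.order_def)
qed

lemma card_multiples_chain:
  assumes fin: "finite (carrier G)" and p: "prime p"
  shows "Coset.order G = p ^ (\<Sum>i = 1..j. rk p i G) * card (multiples G (p ^ j))"
proof (induction j)
  case 0
  have "multiples G (p ^ 0) = carrier G" by (auto simp: multiples_def image_iff)
  then show ?case by (simp add: Coset.order_def)
next
  case (Suc j)
  then show ?case using card_multiples_step[OF fin p, of "Suc j"] by (simp add: power_add)
qed

lemma card_multiples_pos:
  assumes "finite (carrier G)"
  shows "card (multiples G n) > 0"
  using assms by (auto simp: multiples_def card_gt_0_iff)

lemma card_torsion_prime_power:
  assumes fin: "finite (carrier G)" and p: "prime p"
  shows "card (torsion G (p ^ j)) = p ^ (\<Sum>i = 1..j. rk p i G)"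
  using card_torsion_times_multiples[OF fin, of "p ^ j"] card_multiples_chain[OF fin p, of j]
    card_multiples_pos[OF fin, of "p ^ j"] by simp

text \<open>On the finite group \<open>p^(i-1) G\<close>, kernel and cokernel of multiplication by
  \<open>p\<close> have the same order. The kernel is the \<open>p\<close>-torsion of
  \<open>G\<close> inside that subgroup, and these intersections shrink as \<open>i\<close>
  grows.\<close>

lemma rk_antimono:
  assumes fin: "finite (carrier G)" and p: "prime p" and j: "j \<ge> 1"
  shows "rk p (j + 1) G \<le> rk p j G"
proof -
  have *: "p ^ rk p i G = card (torsion G p \<inter> multiples G (p ^ (i - 1)))" if i: "i \<ge> 1" for i
  proof -
    let ?H = "G\<lparr>carrier := multiples G (p ^ (i - 1))\<rparr>"
    interpret S: subgroup "multiples G (p ^ (i - 1))" G by (rule multiples_subgroup)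
    interpret H: comm_group ?H by (rule subgroup_comm_group[OF multiples_subgroup])
    have "p ^ (i - 1) * p = p ^ i" using i by (cases i) auto
    then have N: "multiples ?H p = multiples G (p ^ i)" by (simp add: multiples_mult)
    have finH: "finite (carrier ?H)" using fin S.subset finite_subset by simp
    have "torsion ?H p = torsion G p \<inter> multiples G (p ^ (i - 1))"
      using S.subset by (auto simp: torsion_def nat_pow_consistent[symmetric])
    then have "card (torsion G p \<inter> multiples G (p ^ (i - 1))) * card (multiples G (p ^ i))
        = card (multiples G (p ^ (i - 1)))"
      using H.card_torsion_times_multiples[OF finH, of p] N by (simp add: Coset.order_def)
    then show ?thesis using card_multiples_step[OF fin p i] card_multiples_pos[OF fin, of "p ^ i"] by simp
  qed
  have "multiples G (p ^ (j + 1 - 1)) \<subseteq> multiples G (p ^ (j - 1))"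
  proof -
    have "p ^ (j - 1) * p = p ^ j" using j by (cases j) auto
    moreover have "multiples (G\<lparr>carrier := multiples G (p ^ (j - 1))\<rparr>) p \<subseteq> multiples G (p ^ (j - 1))"
      using comm_group.multiples_subgroup[OF subgroup_comm_group[OF multiples_subgroup]]
      subgroup.subset by fastforce
    ultimately show ?thesis by (simp add: multiples_mult)
  qed
  then have "p ^ rk p (j + 1) G \<le> p ^ rk p j G"
    using *[OF j] *[of "j + 1"] fin by (auto simp: torsion_def intro!: card_mono)
  then show ?thesis using prime_gt_1_nat[OF p] by simp
qed

end

section \<open>The Markov chain of ranks and its moments\<close>

lemma qpoch_0 [simp]: "qpoch a q 0 = 1" by (simp add: qpoch_def)

lemma qpoch_Suc: "qpoch a q (Suc k) = qpoch a q k * (1 - a * q ^ k)" by (simp add: qpoch_def)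

lemma qpoch_add: "qpoch a q (i + j) = qpoch a q i * qpoch (a * q ^ i) q j"
  by (induction j) (simp_all add: qpoch_Suc power_add mult_ac)

lemma qpoch_Suc_left: "qpoch a q (Suc k) = (1 - a) * qpoch (a * q) q k"
  using qpoch_add[of a q 1 k] by (simp add: qpoch_Suc)

lemma qpoch_pos:
  assumes "0 \<le> a" "a < 1" "0 \<le> q" "q \<le> 1"
  shows "qpoch a q k > 0"
proof (induction k)
  case (Suc k)
  have "a * q ^ k \<le> a" using assms by (simp add: mult_left_le power_le_one)
  then show ?case using Suc assms by (simp add: qpoch_Suc)
qed simp

lemma qpoch_le_1:
  assumes "0 \<le> a" "a < 1" "0 \<le> q" "q \<le> 1"
  shows "qpoch a q k \<le> 1"
proof (induction k)
  case (Suc k)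
  have "qpoch a q k * (1 - a * q ^ k) \<le> qpoch a q k * 1"
    using qpoch_pos[OF assms, of k] assms by (intro mult_left_mono) auto
  then show ?case using Suc by (simp add: qpoch_Suc)
qed simp

lemma qpoch_tendsto:
  assumes "0 \<le> a" "a < 1" "0 \<le> q" "q \<le> 1"
  shows "qpoch a q \<longlonglongrightarrow> qpoch_inf a q"
proof -
  have "decseq (qpoch a q)"
  proof (rule decseq_SucI)
    fix k
    have "qpoch a q k * (1 - a * q ^ k) \<le> qpoch a q k * 1"
      using qpoch_pos[OF assms, of k] assms by (intro mult_left_mono) auto
    then show "qpoch a q (Suc k) \<le> qpoch a q k" by (simp add: qpoch_Suc)
  qed
  then have "convergent (qpoch a q)"
    using qpoch_pos[OF assms] by (metis decseq_convergent less_imp_le convergentI)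
  then show ?thesis by (simp add: qpoch_inf_def convergent_LIMSEQ_iff)
qed

lemma qpoch_neq_0:
  fixes P :: real
  assumes "P > 1"
  shows "qpoch P P k \<noteq> 0"
proof (induction k)
  case (Suc k)
  have "P * P ^ k > 1" using assms by (metis one_less_power power_Suc zero_less_Suc)
  then show ?case using Suc by (simp add: qpoch_Suc)
qed simp

lemma qbinom_0 [simp]: "(P::real) > 1 \<Longrightarrow> qbinom P n 0 = 1"
  by (simp add: qbinom_def qpoch_neq_0)

lemma qbinom_self [simp]: "(P::real) > 1 \<Longrightarrow> qbinom P n n = 1"
  by (simp add: qbinom_def qpoch_neq_0)

text \<open>The rational identity shared by the two Pascal rules, for base \<open>P\<close> and for
  base \<open>q\<close>; \<open>x\<close> and \<open>z\<close> are the last factors of the two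
  Pochhammer products in the denominator.\<close>

lemma pascal_division:
  fixes F a b x y z :: real
  assumes "a \<noteq> 0" "b \<noteq> 0" "x \<noteq> 0" "z \<noteq> 0"
  shows "F * (x + y * z) / (b * a * z * x) = F / (b * a * z) + y * (F / (b * a * x))"
  using assms by (simp add: field_simps)

lemma qbinom_pascal:
  fixes P :: real
  assumes P: "P > 1" and i: "1 \<le> i" "i \<le> N"
  shows "qbinom P (Suc N) (Suc N - i) = qbinom P N (Suc N - i) + P ^ i * qbinom P N (N - i)"
proof -
  obtain a where a: "i = Suc a" using i by (cases i) auto
  obtain b where N: "N = Suc a + b" using i a le_Suc_ex by blast
  let ?f = "qpoch P P"
  have s: "?f (Suc k) = ?f k * (1 - P ^ Suc k)" for k by (simp add: qpoch_Suc)
  have n0: "?f k \<noteq> 0" "1 - P ^ Suc k \<noteq> 0" for k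
    using qpoch_neq_0[OF P, of k] qpoch_neq_0[OF P, of "Suc k"] by (auto simp: s)
  have e: "qbinom P (Suc N) (Suc N - i) = ?f (Suc (Suc (a + b))) / (?f (Suc b) * ?f (Suc a))"
    "qbinom P N (Suc N - i) = ?f (Suc (a + b)) / (?f (Suc b) * ?f a)"
    "qbinom P N (N - i) = ?f (Suc (a + b)) / (?f b * ?f (Suc a))"
    by (simp_all add: qbinom_def N a Suc_diff_le)
  have "?f (Suc (Suc (a + b))) / (?f (Suc b) * ?f (Suc a)) =
      ?f (Suc (a + b)) * (1 - P ^ Suc (Suc (a + b))) / (?f b * ?f a * (1 - P ^ Suc b) * (1 - P ^ Suc a))"
    by (simp only: s[of "Suc (a + b)"] s[of a] s[of b] mult_ac)
  also have "1 - P ^ Suc (Suc (a + b)) = (1 - P ^ Suc a) + P ^ Suc a * (1 - P ^ Suc b)"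
    by (simp add: power_add algebra_simps)
  also have "?f (Suc (a + b)) * \<dots> / (?f b * ?f a * (1 - P ^ Suc b) * (1 - P ^ Suc a)) =
      ?f (Suc (a + b)) / (?f b * ?f a * (1 - P ^ Suc b)) + P ^ Suc a * (?f (Suc (a + b)) / (?f b * ?f a * (1 - P ^ Suc a)))"
    by (rule pascal_division) (use n0 in auto)
  finally show ?thesis unfolding e by (simp only: s[of a] s[of b] a mult_ac)
qed

text \<open>For a prime \<open>P\<close> this is the number of surjections from \<open>\<bbbF>\<^sub>P\<^sup>r\<close> onto \<open>\<bbbF>\<^sub>P\<^sup>k\<close>.\<close>

definition surj_count :: "real \<Rightarrow> nat \<Rightarrow> nat \<Rightarrow> real" where
  "surj_count P k r = (\<Prod>i<k. P ^ r - P ^ i)"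

lemma surj_count_0 [simp]: "surj_count P 0 r = 1" by (simp add: surj_count_def)

lemma surj_count_Suc: "surj_count P (Suc k) r = surj_count P k r * (P ^ r - P ^ k)"
  by (simp add: surj_count_def)

lemma surj_count_eq_0: "r < k \<Longrightarrow> surj_count P k r = 0"
  by (auto simp: surj_count_def)

text \<open>For prime \<open>P\<close> both sides count the linear maps from dimension
  \<open>r\<close> to dimension \<open>k + N\<close> whose projection to the first \<open>k\<close>
  coordinates is onto. The right side sorts them by the dimension \<open>k + i\<close> of the image:
  \<open>P ^ (k * (N - i)) * qbinom P N (N - i)\<close> subspaces of that dimension project onto
  these coordinates. For real \<open>P\<close> the induction multiplies by \<open>P ^ r\<close> and
  matches coefficients through Pascal's rule.\<close>

lemma power_times_surj_count_aux:
  fixes P :: real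
  assumes P: "P > 1"
  shows "P ^ (N * r) * surj_count P k r =
    (\<Sum>i\<le>N. P ^ (k * (N - i)) * qbinom P N (N - i) * surj_count P (k + i) r)"
proof (induction N)
  case 0
  then show ?case using P by simp
next
  case (Suc N)
  let ?a = "\<lambda>N i. P ^ (k * (N - i)) * qbinom P N (N - i)" and ?S = "\<lambda>i. surj_count P (k + i) r"
  have rec: "P ^ r * ?S i = ?S (Suc i) + P ^ (k + i) * ?S i" for i
    by (simp add: surj_count_Suc algebra_simps)
  have mid: "?a (Suc N) (Suc i) = ?a N i + P ^ (k + Suc i) * ?a N (Suc i)" if "i < N" for i
  proof -
    have e: "N - i = Suc (N - Suc i)" using that by simp
    have "?a (Suc N) (Suc i) = P ^ (k * (N - i)) * (qbinom P N (N - i) + P ^ Suc i * qbinom P N (N - Suc i))"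
      using qbinom_pascal[OF P, of "Suc i" N] that by simp
    also have "\<dots> = ?a N i + P ^ Suc i * P ^ (k * (N - i)) * qbinom P N (N - Suc i)"
      by (simp add: algebra_simps)
    also have "P ^ Suc i * P ^ (k * (N - i)) = P ^ (k + Suc i) * P ^ (k * (N - Suc i))"
      unfolding e by (simp add: power_add)
    finally show ?thesis by (simp only: mult.assoc)
  qed
  have "P ^ (Suc N * r) * surj_count P k r = P ^ r * (P ^ (N * r) * surj_count P k r)"
    by (simp add: power_add mult_ac)
  also have "\<dots> = (\<Sum>i\<le>N. ?a N i * (P ^ r * ?S i))"
    unfolding Suc by (simp add: sum_distrib_left mult_ac)
  also have "\<dots> = (\<Sum>i\<le>N. ?a N i * ?S (Suc i)) + (\<Sum>i\<le>N. ?a N i * P ^ (k + i) * ?S i)"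
    unfolding rec by (simp add: distrib_left sum.distrib mult.assoc)
  also have "(\<Sum>i\<le>N. ?a N i * ?S (Suc i)) = (\<Sum>i<N. ?a N i * ?S (Suc i)) + ?S (Suc N)"
    using P by (simp add: lessThan_Suc_atMost[symmetric])
  also have "(\<Sum>i\<le>N. ?a N i * P ^ (k + i) * ?S i) = P ^ (k * Suc N) * ?S 0 + (\<Sum>i<N. ?a N (Suc i) * P ^ (k + Suc i) * ?S (Suc i))"
    using P by (simp add: lessThan_Suc_atMost[symmetric] sum.lessThan_Suc_shift power_add mult_ac del: sum.lessThan_Suc)
  also have "(\<Sum>i<N. ?a N i * ?S (Suc i)) + ?S (Suc N) +
      (P ^ (k * Suc N) * ?S 0 + (\<Sum>i<N. ?a N (Suc i) * P ^ (k + Suc i) * ?S (Suc i))) =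
      P ^ (k * Suc N) * ?S 0 + (\<Sum>i<N. (?a N i + P ^ (k + Suc i) * ?a N (Suc i)) * ?S (Suc i)) + ?S (Suc N)"
    by (simp add: sum.distrib algebra_simps)
  also have "(\<Sum>i<N. (?a N i + P ^ (k + Suc i) * ?a N (Suc i)) * ?S (Suc i)) = (\<Sum>i<N. ?a (Suc N) (Suc i) * ?S (Suc i))"
    using mid by (intro sum.cong) auto
  also have "P ^ (k * Suc N) * ?S 0 + \<dots> + ?S (Suc N) = (\<Sum>i\<le>Suc N. ?a (Suc N) i * ?S i)"
  proof -
    have "(\<Sum>i\<le>Suc N. ?a (Suc N) i * ?S i) = ?a (Suc N) 0 * ?S 0 + (\<Sum>i<Suc N. ?a (Suc N) (Suc i) * ?S (Suc i))"
      unfolding lessThan_Suc_atMost[symmetric] by (rule sum.lessThan_Suc_shift)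
    also have "(\<Sum>i<Suc N. ?a (Suc N) (Suc i) * ?S (Suc i)) = (\<Sum>i<N. ?a (Suc N) (Suc i) * ?S (Suc i)) + ?S (Suc N)"
      using P by simp
    also have "?a (Suc N) 0 = P ^ (k * Suc N)" using P by simp
    finally show ?thesis by simp
  qed
  finally show ?case .
qed

lemma power_times_surj_count:
  fixes P :: real
  assumes P: "P > 1" and "k \<le> n"
  shows "P ^ ((n - k) * r) * surj_count P k r =
    (\<Sum>m=k..n. P ^ (k * (n - m)) * qbinom P (n - k) (n - m) * surj_count P m r)"
proof -
  have "(\<Sum>m=k..n. P ^ (k * (n - m)) * qbinom P (n - k) (n - m) * surj_count P m r) =
    (\<Sum>i\<le>n - k. P ^ (k * (n - k - i)) * qbinom P (n - k) (n - k - i) * surj_count P (k + i) r)"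
    by (rule sum.reindex_bij_witness[of _ "\<lambda>i. k + i" "\<lambda>m. m - k"]) (use assms in auto)
  then show ?thesis using power_times_surj_count_aux[OF P] by simp
qed

section \<open>Transition probabilities, their total mass and their moments\<close>

locale cohen_lenstra_chain =
  fixes P :: real
  assumes P: "P > 1"
begin

definition q :: real where "q = 1 / P"

lemma q: "q > 0" "q < 1" using P by (auto simp: q_def)

abbreviation qf :: "nat \<Rightarrow> real" where "qf k \<equiv> qpoch q q k"

lemma q_pow_less_1: "q ^ (k + 1) < 1" using q power_Suc_less_one[of q k] by simp

lemma qf_pos: "qf k > 0" using qpoch_pos[of q q] q by simp

lemma qf_Suc: "qf (Suc k) = qf k * (1 - q ^ Suc k)" by (simp add: qpoch_Suc)

text \<open>
  The probability that the rank after \<open>R\<close> is \<open>r\<close>. The law of the theorem is the limit for \<open>R \<longrightarrow> \<infinity>\<close> of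
  the chain started at \<open>R\<close>; working with finite \<open>R\<close> avoids infinite sums over the first rank.
\<close>

definition trans_prob :: "nat \<Rightarrow> nat \<Rightarrow> nat \<Rightarrow> real" where
  "trans_prob u R r = qf R / (qf r * qf (R - r)) * q ^ (r * r + u * r) * qpoch (q ^ (u + r + 1)) q (R - r)"

lemma trans_nonneg: "trans_prob u R r \<ge> 0"
proof -
  have "qpoch (q ^ (u + r + 1)) q (R - r) > 0" using q q_pow_less_1 by (intro qpoch_pos) auto
  then show ?thesis using qf_pos q by (auto simp: trans_prob_def intro!: mult_nonneg_nonneg divide_nonneg_nonneg less_imp_le)
qed

text \<open>The Gaussian binomial to base \<open>q\<close>, set to 0 for \<open>k > n\<close> so
  that Pascal's rule holds without side conditions. With the truncated subtraction in
  \<open>qbinom\<close> it would not vanish there.\<close>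

definition qb :: "nat \<Rightarrow> nat \<Rightarrow> real" where
  "qb n k = (if k \<le> n then qf n / (qf k * qf (n - k)) else 0)"

lemma qb_Suc_Suc: "qb (Suc n) (Suc k) = q ^ Suc k * qb n (Suc k) + qb n k"
proof -
  consider "k = n" | "k < n" | "n < k" by linarith
  then show ?thesis
  proof cases
    case 2
    then obtain d where n: "n = Suc (k + d)" using less_iff_Suc_add by auto
    have f0: "qf i \<noteq> 0" "1 - q ^ Suc i \<noteq> 0" for i
      using qf_pos[of i] qf_pos[of "Suc i"] by (auto simp: qf_Suc)
    have "qb (Suc n) (Suc k) = qf (Suc (k + d)) * (1 - q ^ Suc (Suc (k + d))) / (qf k * (1 - q ^ Suc k) * (qf d * (1 - q ^ Suc d)))"
      by (simp add: qb_def n Suc_diff_le qf_Suc del: power_Suc)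
    also have "1 - q ^ Suc (Suc (k + d)) = (1 - q ^ Suc k) + q ^ Suc k * (1 - q ^ Suc d)"
      by (simp add: power_add algebra_simps)
    also have "qf k * (1 - q ^ Suc k) * (qf d * (1 - q ^ Suc d)) = qf d * qf k * (1 - q ^ Suc d) * (1 - q ^ Suc k)"
      by (simp only: mult_ac)
    also have "qf (Suc (k + d)) * ((1 - q ^ Suc k) + q ^ Suc k * (1 - q ^ Suc d)) / (qf d * qf k * (1 - q ^ Suc d) * (1 - q ^ Suc k))
        = qf (Suc (k + d)) / (qf d * qf k * (1 - q ^ Suc d)) + q ^ Suc k * (qf (Suc (k + d)) / (qf d * qf k * (1 - q ^ Suc k)))"
      by (rule pascal_division) (use f0 in auto)
    also have "\<dots> = q ^ Suc k * qb n (Suc k) + qb n k"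
      by (simp add: qb_def n Suc_diff_le qf_Suc mult_ac del: power_Suc)
    finally show ?thesis .
  qed (use qf_pos in \<open>auto simp: qb_def less_imp_neq[THEN not_sym]\<close>)
qed

lemma qb_0 [simp]: "qb n 0 = 1" using qf_pos[of n] by (simp add: qb_def)

text \<open>Induction on \<open>R\<close> for all \<open>u\<close> together. Pascal's rule splits
  each term in two; once the second part is shifted by one, the two carry the weights
  \<open>1 - q ^ (u + r + 1)\<close> and \<open>q ^ (u + r + 1)\<close> and add up to
  \<open>trans_prob (Suc u) R r\<close>.\<close>

lemma sum_trans: "(\<Sum>r\<le>R. trans_prob u R r) = 1"
proof (induction R arbitrary: u)
  case 0
  then show ?case by (simp add: trans_prob_def)
next
  case (Suc R)
  have tr: "trans_prob u n r = qb n r * q ^ (r * r + u * r) * qpoch (q ^ (u + r + 1)) q (n - r)" if "r \<le> n" for u n r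
    using that by (simp add: trans_prob_def qb_def)
  let ?g = "\<lambda>r. q ^ (r * r + Suc u * r) * qpoch (q ^ (Suc u + r + 1)) q (R - r)"
  have split: "trans_prob u (Suc R) r = qb R r * (1 - q ^ (u + r + 1)) * ?g r
      + (if r = 0 then 0 else qb R (r - 1) * q ^ (u + r) * ?g (r - 1))" if r: "r \<le> Suc R" for r
  proof -
    have A: "q ^ r * qb R r * q ^ (r * r + u * r) * qpoch (q ^ (u + r + 1)) q (Suc R - r)
        = qb R r * (1 - q ^ (u + r + 1)) * ?g r"
    proof (cases "r \<le> R")
      case True
      then show ?thesis
        by (simp add: Suc_diff_le qpoch_Suc_left power_add mult_ac)
    qed (simp add: qb_def)
    show ?thesis
    proof (cases r)
      case 0
      then show ?thesis using tr[OF r, of u] A by simp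
    next
      case (Suc s)
      have B: "qb R s * q ^ (r * r + u * r) * qpoch (q ^ (u + r + 1)) q (Suc R - r) = qb R s * q ^ (u + r) * ?g s"
        unfolding Suc by (simp add: power_add mult_ac)
      have "trans_prob u (Suc R) r = qb (Suc R) r * q ^ (r * r + u * r) * qpoch (q ^ (u + r + 1)) q (Suc R - r)"
        by (rule tr[OF r])
      also have "qb (Suc R) r = q ^ r * qb R r + qb R s" using qb_Suc_Suc[of R s] Suc by simp
      finally show ?thesis unfolding distrib_right A B using Suc by simp
    qed
  qed
  have "(\<Sum>r\<le>Suc R. trans_prob u (Suc R) r) = (\<Sum>r\<le>Suc R. qb R r * (1 - q ^ (u + r + 1)) * ?g r)
      + (\<Sum>r\<le>Suc R. if r = 0 then 0 else qb R (r - 1) * q ^ (u + r) * ?g (r - 1))"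
    unfolding sum.distrib[symmetric] by (intro sum.cong refl split) simp
  also have "(\<Sum>r\<le>Suc R. qb R r * (1 - q ^ (u + r + 1)) * ?g r) = (\<Sum>r\<le>R. qb R r * (1 - q ^ (u + r + 1)) * ?g r)"
    by (simp add: qb_def)
  also have "(\<Sum>r\<le>Suc R. if r = 0 then 0 else qb R (r - 1) * q ^ (u + r) * ?g (r - 1)) = (\<Sum>r\<le>R. qb R r * q ^ (u + r + 1) * ?g r)"
    unfolding sum.atMost_Suc_shift by simp
  also have "(\<Sum>r\<le>R. qb R r * (1 - q ^ (u + r + 1)) * ?g r) + \<dots> = (\<Sum>r\<le>R. trans_prob (Suc u) R r)"
    unfolding sum.distrib[symmetric] by (intro sum.cong) (auto simp: tr algebra_simps)
  also have "\<dots> = 1" by (rule Suc)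
  finally show ?case .
qed

lemma surj_count_qf:
  assumes "k \<le> R"
  shows "surj_count P k R = P ^ (k * R) * (qf R / qf (R - k))"
  using assms
proof (induction k)
  case 0
  then show ?case using qf_pos[of R] by simp
next
  case (Suc k)
  then obtain d where R: "R = Suc (k + d)" using less_iff_Suc_add[of k R] by auto
  define x where "x = 1 - q ^ Suc d"
  have e1: "P ^ R - P ^ k = P ^ R * x"
    unfolding x_def using P by (simp add: q_def R power_divide field_simps power_add)
  have e2: "qf (R - k) = qf (R - Suc k) * x" by (simp add: x_def R qf_Suc Suc_diff_le)
  have "x \<noteq> 0" using qf_pos[of "Suc d"] by (auto simp: x_def qf_Suc)
  have "surj_count P (Suc k) R = P ^ (k * R) * (qf R / (qf (R - Suc k) * x)) * (P ^ R * x)"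
    using Suc.IH Suc.prems by (simp only: surj_count_Suc e1 e2 Suc_leD)
  then show ?case using \<open>x \<noteq> 0\<close> by (simp add: power_add)
qed

text \<open>Only \<open>r = k + s\<close> contributes, and there the surjection count cancels
  against the transition probability. What remains is a constant times
  \<open>trans_prob (u + k) (R - k) s\<close>, whose sum over \<open>s\<close> is 1.\<close>

lemma sum_trans_surj_count:
  "(\<Sum>r\<le>R. trans_prob u R r * surj_count P k r) = q ^ (u * k) * (q ^ (k * R) * surj_count P k R)"
proof (cases "k \<le> R")
  case False
  then show ?thesis by (simp add: surj_count_eq_0)
next
  case True
  have qP: "q ^ n * P ^ n = 1" for n using P by (simp add: q_def power_divide)
  have "(\<Sum>r\<le>R. trans_prob u R r * surj_count P k r) = (\<Sum>r=k..R. trans_prob u R r * surj_count P k r)"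
    by (rule sum.mono_neutral_right) (auto simp: surj_count_eq_0)
  also have "\<dots> = (\<Sum>s\<le>R - k. trans_prob u R (k + s) * surj_count P k (k + s))"
    by (rule sum.reindex_bij_witness[of _ "\<lambda>s. k + s" "\<lambda>r. r - k"]) (use True in auto)
  also have "\<dots> = (\<Sum>s\<le>R - k. q ^ (u * k) * (qf R / qf (R - k)) * trans_prob (u + k) (R - k) s)"
  proof (rule sum.cong[OF refl])
    fix s assume s: "s \<in> {..R - k}"
    have "q ^ ((k + s) * (k + s) + u * (k + s)) * P ^ (k * (k + s)) = q ^ (u * k) * q ^ (s * s + (u + k) * s)"
    proof -
      have "q ^ ((k + s) * (k + s) + u * (k + s)) = q ^ (u * k) * q ^ (s * s + (u + k) * s) * q ^ (k * (k + s))"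
        by (simp add: power_add[symmetric] algebra_simps)
      then show ?thesis using qP[of "k * (k + s)"] by (simp add: mult.assoc)
    qed
    moreover have "trans_prob u R (k + s) * surj_count P k (k + s) =
       (q ^ ((k + s) * (k + s) + u * (k + s)) * P ^ (k * (k + s))) * 
       (qf R / (qf s * qf (R - k - s)) * qpoch (q ^ (u + k + s + 1)) q (R - k - s))"
      using surj_count_qf[of k "k + s"] qf_pos[of "k + s"] by (simp add: trans_prob_def add.assoc mult_ac)
    ultimately show "trans_prob u R (k + s) * surj_count P k (k + s)
        = q ^ (u * k) * (qf R / qf (R - k)) * trans_prob (u + k) (R - k) s"
      using qf_pos[of "R - k"] by (simp add: trans_prob_def)
  qed
  also have "\<dots> = q ^ (u * k) * (qf R / qf (R - k))"
    by (simp only: sum_distrib_left[symmetric] sum_trans mult_1_right)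
  also have "qf R / qf (R - k) = q ^ (k * R) * surj_count P k R"
    using surj_count_qf[OF True] qP[of "k * R"] by simp
  finally show ?thesis .
qed

fun chain_exp :: "nat \<Rightarrow> nat \<Rightarrow> nat \<Rightarrow> (nat list \<Rightarrow> real) \<Rightarrow> real" where
  "chain_exp u 0 R f = f []"
| "chain_exp u (Suc l) R f = (\<Sum>r\<le>R. trans_prob u R r * chain_exp u l r (\<lambda>rs. f (r # rs)))"

text \<open>The default value 1 lets \<open>moment_add\<close> and \<open>moment_replicate_0\<close>
  hold for \<open>rs\<close> of any length.\<close>

fun moment :: "nat list \<Rightarrow> nat list \<Rightarrow> real" where
  "moment (n # ns) (r # rs) = P ^ (n * r) * moment ns rs"
| "moment _ _ = 1"

text \<open>
  The coefficients of a moment, as a function of the starting point \<open>R\<close>, in the functions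
  \<open>q\<^bsup>kR\<^esup> surj_count P k R\<close>, all of which tend to 1.
\<close>

fun mcoeff :: "nat \<Rightarrow> nat list \<Rightarrow> nat \<Rightarrow> real" where
  "mcoeff u [] k = (if k = 0 then 1 else 0)"
| "mcoeff u (n # ns) m = (if m \<le> n then q ^ (u * m) *
     (\<Sum>k\<le>m. P ^ (k * (n - m)) * qbinom P (n - k) (n - m) * mcoeff u ns k) else 0)"

lemma chain_exp_cmult: "chain_exp u l R (\<lambda>rs. c * f rs) = c * chain_exp u l R f"
  by (induction l arbitrary: R f) (simp_all add: sum_distrib_left mult_ac)

text \<open>Given the first rank \<open>r\<close>, the later ranks contribute terms
  \<open>q ^ (k * r) * surj_count P k r\<close> by induction. Since the exponents decrease,
  \<open>k \<le> n\<close>, so \<open>P ^ (n * r) * q ^ (k * r)\<close> is the nonnegative power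
  \<open>P ^ ((n - k) * r)\<close>. It is expanded in surjection counts, and those are summed
  against the transition probabilities.\<close>

lemma chain_exp_moment:
  assumes "sorted_wrt (\<ge>) ns" "\<forall>x\<in>set ns. x \<le> B"
  shows "chain_exp u (length ns) R (moment ns) = (\<Sum>k\<le>B. mcoeff u ns k * (q ^ (k * R) * surj_count P k R))"
  using assms
proof (induction ns arbitrary: R B)
  case Nil
  have "(\<Sum>k\<le>B. mcoeff u [] k * (q ^ (k * R) * surj_count P k R)) = (\<Sum>k\<le>B. if k = 0 then 1 else 0)"
    by (intro sum.cong) auto
  then show ?case by simp
next
  case (Cons n ns)
  let ?c = "\<lambda>k m. P ^ (k * (n - m)) * qbinom P (n - k) (n - m)"
  have IH: "chain_exp u (length ns) r (moment ns) = (\<Sum>k\<le>n. mcoeff u ns k * (q ^ (k * r) * surj_count P k r))" for r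
    using Cons by auto
  have step: "P ^ (n * r) * (q ^ (k * r) * surj_count P k r) = (\<Sum>m=k..n. ?c k m * surj_count P m r)" if "k \<le> n" for k r
  proof -
    have "n * r = (n - k) * r + k * r" using that by (simp flip: add_mult_distrib)
    then have "P ^ (n * r) = P ^ ((n - k) * r) * P ^ (k * r)" by (simp flip: power_add)
    moreover have "P ^ (k * r) * q ^ (k * r) = 1" using P by (simp add: q_def power_divide)
    ultimately have "P ^ (n * r) * (q ^ (k * r) * surj_count P k r) = P ^ ((n - k) * r) * surj_count P k r"
      by (simp add: mult.assoc[symmetric])
    then show ?thesis using power_times_surj_count[OF P that] by simp
  qed
  have "chain_exp u (length (n # ns)) R (moment (n # ns)) =
      (\<Sum>r\<le>R. trans_prob u R r * (P ^ (n * r) * (\<Sum>k\<le>n. mcoeff u ns k * (q ^ (k * r) * surj_count P k r))))"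
    by (simp add: chain_exp_cmult IH)
  also have "\<dots> = (\<Sum>r\<le>R. \<Sum>k\<le>n. \<Sum>m=k..n. mcoeff u ns k * ?c k m * (trans_prob u R r * surj_count P m r))"
  proof (rule sum.cong[OF refl])
    fix r
    have "P ^ (n * r) * (\<Sum>k\<le>n. mcoeff u ns k * (q ^ (k * r) * surj_count P k r)) =
      (\<Sum>k\<le>n. mcoeff u ns k * (P ^ (n * r) * (q ^ (k * r) * surj_count P k r)))"
      by (simp add: sum_distrib_left mult_ac)
    also have "\<dots> = (\<Sum>k\<le>n. mcoeff u ns k * (\<Sum>m=k..n. ?c k m * surj_count P m r))"
      using step by (intro sum.cong) auto
    finally show "trans_prob u R r * (P ^ (n * r) * (\<Sum>k\<le>n. mcoeff u ns k * (q ^ (k * r) * surj_count P k r))) =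
      (\<Sum>k\<le>n. \<Sum>m=k..n. mcoeff u ns k * ?c k m * (trans_prob u R r * surj_count P m r))"
      by (simp add: sum_distrib_left mult_ac)
  qed
  also have "\<dots> = (\<Sum>k\<le>n. \<Sum>r\<le>R. \<Sum>m=k..n. mcoeff u ns k * ?c k m * (trans_prob u R r * surj_count P m r))"
    by (rule sum.swap)
  also have "\<dots> = (\<Sum>k\<le>n. \<Sum>m=k..n. \<Sum>r\<le>R. mcoeff u ns k * ?c k m * (trans_prob u R r * surj_count P m r))"
    by (intro sum.cong[OF refl] sum.swap)
  also have "\<dots> = (\<Sum>k\<le>n. \<Sum>m=k..n. mcoeff u ns k * ?c k m * (q ^ (u * m) * (q ^ (m * R) * surj_count P m R)))"
    by (simp only: sum_distrib_left[symmetric] sum_trans_surj_count)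
  also have "\<dots> = (\<Sum>m\<le>n. \<Sum>k\<le>m. mcoeff u ns k * ?c k m * (q ^ (u * m) * (q ^ (m * R) * surj_count P m R)))"
    unfolding sum.Sigma[OF finite_atMost ballI[OF finite_atLeastAtMost]] sum.Sigma[OF finite_atMost ballI[OF finite_atMost]]
    by (rule sum.reindex_bij_witness[of _ "\<lambda>(m, k). (k, m)" "\<lambda>(k, m). (m, k)"]) auto
  also have "\<dots> = (\<Sum>m\<le>n. mcoeff u (n # ns) m * (q ^ (m * R) * surj_count P m R))"
    by (intro sum.cong[OF refl]) (simp add: sum_distrib_left sum_distrib_right mult_ac)
  also have "\<dots> = (\<Sum>m\<le>B. mcoeff u (n # ns) m * (q ^ (m * R) * surj_count P m R))"
    using Cons.prems(2) by (intro sum.mono_neutral_left) auto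
  finally show ?case .
qed

lemma normalized_surj_count_tendsto: "(\<lambda>R. q ^ (k * R) * surj_count P k R) \<longlonglongrightarrow> 1"
proof -
  have "q ^ (k * R) * surj_count P k R = (\<Prod>i<k. 1 - P ^ i * q ^ R)" for R
  proof -
    have "q ^ R * P ^ R = 1" using P by (simp add: q_def power_divide)
    then have "q ^ R * (P ^ R - P ^ i) = 1 - P ^ i * q ^ R" for i by (simp add: algebra_simps)
    then have "(\<Prod>i<k. q ^ R * (P ^ R - P ^ i)) = (\<Prod>i<k. 1 - P ^ i * q ^ R)" by simp
    then show ?thesis by (simp add: prod.distrib surj_count_def power_mult mult.commute[of k])
  qed
  moreover have "(\<lambda>R. \<Prod>i<k. 1 - P ^ i * q ^ R) \<longlonglongrightarrow> (\<Prod>i<k. 1 - P ^ i * 0)"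
    using q by (intro tendsto_prod tendsto_diff tendsto_mult tendsto_const LIMSEQ_power_zero) auto
  ultimately show ?thesis by simp
qed

lemma chain_exp_moment_tendsto:
  assumes "sorted_wrt (\<ge>) ns" "\<forall>x\<in>set ns. x \<le> B"
  shows "(\<lambda>R. chain_exp u (length ns) R (moment ns)) \<longlonglongrightarrow> (\<Sum>k\<le>B. mcoeff u ns k)"
proof -
  have "(\<lambda>R. \<Sum>k\<le>B. mcoeff u ns k * (q ^ (k * R) * surj_count P k R)) \<longlonglongrightarrow> (\<Sum>k\<le>B. mcoeff u ns k * 1)"
    by (intro tendsto_sum tendsto_mult tendsto_const normalized_surj_count_tendsto)
  then show ?thesis using chain_exp_moment[OF assms] by simp
qed

section \<open>Point probabilities of the chain and their limit\<close>

fun chain_prob :: "nat \<Rightarrow> nat \<Rightarrow> nat list \<Rightarrow> real" where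
  "chain_prob u R [] = 1"
| "chain_prob u R (m # ms) = (if m \<le> R then trans_prob u R m * chain_prob u m ms else 0)"

lemma chain_exp_0 [simp]: "chain_exp u l R (\<lambda>rs. 0) = 0"
  by (induction l arbitrary: R) simp_all

lemma chain_exp_indicator:
  "chain_exp u (length ms) R (\<lambda>rs. of_bool (rs = ms)) = chain_prob u R ms"
proof (induction ms arbitrary: R)
  case (Cons m ms)
  have "chain_exp u (length ms) r (\<lambda>rs. of_bool (r # rs = m # ms)) = (if r = m then chain_prob u m ms else 0)" for r
    using Cons by (cases "r = m") simp_all
  then show ?case by (simp add: if_distrib[of "\<lambda>x. trans_prob _ _ _ * x"] cong: if_cong)
qed simp

text \<open>What is left of the transition probabilities in \<open>chain_prob\<close> after the
  telescoping of \<open>chain_prob_eq\<close>.\<close>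

fun chain_weight :: "nat \<Rightarrow> nat \<Rightarrow> nat list \<Rightarrow> real" where
  "chain_weight u R [] = 1"
| "chain_weight u R (m # ms) = q ^ (m * m + u * m) / qf (R - m) * chain_weight u m ms"

text \<open>In a product of consecutive transitions the numerator \<open>qf m\<close> of one cancels
  against the denominator of the preceding one, and the Pochhammer products over adjacent ranges
  join into one, ending at the last rank.\<close>

lemma chain_prob_eq:
  assumes "sorted_wrt (\<ge>) (R # ms)" "ms \<noteq> []"
  shows "chain_prob u R ms = qf R * qpoch (q ^ (u + last ms + 1)) q (R - last ms) / qf (last ms) * chain_weight u R ms"
  using assms
proof (induction ms arbitrary: R)
  case (Cons m ms)
  show ?case
  proof (cases "ms = []")
    case True
    then show ?thesis using Cons.prems by (simp add: trans_prob_def)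
  next
    case False
    let ?t = "last ms"
    have lm: "?t \<le> m" "m \<le> R" using Cons.prems False by auto
    have IH: "chain_prob u m ms = qf m * qpoch (q ^ (u + ?t + 1)) q (m - ?t) / qf ?t * chain_weight u m ms"
      using Cons False by simp
    have "qpoch (q ^ (u + ?t + 1)) q (R - ?t) = qpoch (q ^ (u + ?t + 1)) q (m - ?t) * qpoch (q ^ (u + m + 1)) q (R - m)"
    proof -
      have "q ^ (u + ?t + 1) * q ^ (m - ?t) = q ^ (u + m + 1)" using lm by (simp flip: power_add power_Suc)
      moreover have "R - ?t = (m - ?t) + (R - m)" using lm by simp
      ultimately show ?thesis by (simp only: qpoch_add)
    qed
    then show ?thesis using IH lm False qf_pos[of m] by (simp add: trans_prob_def field_simps)
  qed
qed simp

lemma chain_prob_tendsto: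
  assumes "sorted_wrt (\<ge>) ms" "ms \<noteq> []"
  shows "(\<lambda>R. chain_prob u R ms) \<longlonglongrightarrow>
     qpoch_inf (q ^ (u + last ms + 1)) q / qf (last ms) * (q ^ (hd ms * hd ms + u * hd ms) * chain_weight u (hd ms) (tl ms))"
proof -
  obtain m ms' where ms: "ms = m # ms'" using assms(2) by (cases ms) auto
  let ?t = "last ms" and ?C = "q ^ (m * m + u * m) * chain_weight u m ms'"
  have "qpoch (q ^ (u + ?t + 1)) q \<longlonglongrightarrow> qpoch_inf (q ^ (u + ?t + 1)) q"
    using q q_pow_less_1 by (intro qpoch_tendsto) auto
  then have 1: "(\<lambda>R. qpoch (q ^ (u + ?t + 1)) q (R - ?t)) \<longlonglongrightarrow> qpoch_inf (q ^ (u + ?t + 1)) q"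
    by (rule filterlim_compose) (rule filterlim_minus_const_nat_at_top)
  \<comment> \<open>By \<open>surj_count_qf\<close> this is \<open>qf R / qf (R - m)\<close>, the
    other factor of \<open>chain_prob\<close> that depends on \<open>R\<close>.\<close>
  have 2: "(\<lambda>R. q ^ (m * R) * surj_count P m R) \<longlonglongrightarrow> 1"
    by (rule normalized_surj_count_tendsto)
  have "(\<lambda>R. (q ^ (m * R) * surj_count P m R) * qpoch (q ^ (u + ?t + 1)) q (R - ?t) / qf ?t * ?C)
      \<longlonglongrightarrow> 1 * qpoch_inf (q ^ (u + ?t + 1)) q / qf ?t * ?C"
    using qf_pos[of ?t] by (intro tendsto_mult tendsto_divide tendsto_const 1 2) auto
  moreover have "\<forall>\<^sub>F R in sequentially. (q ^ (m * R) * surj_count P m R) * qpoch (q ^ (u + ?t + 1)) q (R - ?t) / qf ?t * ?C = chain_prob u R ms"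
    using eventually_ge_at_top[of m]
  proof eventually_elim
    case (elim R)
    have "q ^ (m * R) * surj_count P m R = qf R / qf (R - m)"
      using surj_count_qf[OF elim] P by (simp add: q_def power_divide)
    moreover have "sorted_wrt (\<ge>) (R # ms)" using assms(1) elim unfolding ms by auto
    ultimately show ?case using chain_prob_eq[OF _ assms(2), of R u] by (simp add: ms)
  qed
  ultimately show ?thesis by (simp add: ms filterlim_cong)
qed

end

section \<open>Partitions\<close>

lemma conj_part_size: "conj_part lam k = size {#j \<in># lam. k \<le> j#}"
  unfolding conj_part_def size_multiset_overloaded_eq by (intro sum.cong) auto

lemma conj_part_empty [simp]: "conj_part {#} k = 0"
  by (simp add: conj_part_size)

lemma conj_part_add_mset [simp]: "conj_part (add_mset x lam) k = conj_part lam k + of_bool (k \<le> x)"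
  by (simp add: conj_part_size)

lemma conj_part_Suc: "conj_part lam k = count lam k + conj_part lam (Suc k)"
  by (induction lam) auto

lemma conj_part_antimono: "i \<le> j \<Longrightarrow> conj_part lam j \<le> conj_part lam i"
  by (induction lam) (auto intro: add_mono)

lemma conj_part_eq_0: "\<forall>i\<in>#lam. i \<le> l \<Longrightarrow> l < k \<Longrightarrow> conj_part lam k = 0"
  by (induction lam) auto

lemma conj_part_eq_sum:
  assumes "\<forall>i\<in>#lam. i \<le> l" "k \<le> Suc l"
  shows "conj_part lam k = (\<Sum>i=k..l. count lam i)"
  using assms(2)
proof (induction "Suc l - k" arbitrary: k)
  case 0
  then show ?case using conj_part_eq_0[OF assms(1), of k] by simp
next
  case (Suc d)
  then have "k \<le> l" "conj_part lam (Suc k) = (\<Sum>i=Suc k..l. count lam i)" by auto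
  then show ?case using conj_part_Suc[of lam k] by (simp add: sum.atLeast_Suc_atMost)
qed

lemma sum_mset_eq_sum_conj_part:
  assumes "\<forall>i\<in>#lam. i \<le> l"
  shows "\<Sum>\<^sub># lam = (\<Sum>k=1..l. conj_part lam k)"
  using assms
proof (induction lam)
  case (add x lam)
  have "(\<Sum>k=1..l. of_bool (k \<le> x)) = card {k \<in> {1..l}. k \<le> x}"
    by (simp add: sum_of_bool_eq Int_def)
  also have "{k \<in> {1..l}. k \<le> x} = {1..x}" using add.prems by auto
  finally show ?case using add by (simp add: sum.distrib)
qed simp

lemma nth_ge_iff_length_filter:
  fixes ps :: "nat list"
  assumes "sorted_wrt (\<ge>) ps"
  shows "i < length ps \<and> k \<le> ps ! i \<longleftrightarrow> i < length (filter (\<lambda>j. k \<le> j) ps)"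
  using assms
proof (induction ps arbitrary: i)
  case (Cons x ps)
  show ?case
  proof (cases "k \<le> x")
    case True
    then show ?thesis using Cons by (cases i) auto
  next
    case False
    then have e: "filter (\<lambda>j. k \<le> j) (x # ps) = []" using Cons.prems by (auto simp: filter_empty_conv)
    have "\<not> k \<le> (x # ps) ! i" if "i < length (x # ps)"
      using e that by (metis filter_empty_conv nth_mem)
    then show ?thesis using e by simp
  qed
qed simp

text \<open>Both sides say that the cell in row \<open>i\<close> and column \<open>k\<close> lies in
  the Young diagram of \<open>lam\<close>.\<close>

lemma part_ge_iff:
  assumes "i \<ge> 1" "k \<ge> 1"
  shows "k \<le> part lam i \<longleftrightarrow> i \<le> conj_part lam k"
proof -
  let ?ps = "rev (sorted_list_of_multiset lam)"
  have "sorted_wrt (\<ge>) ?ps" by (simp add: sorted_wrt_rev)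
  moreover have "length (filter (\<lambda>j. k \<le> j) ?ps) = conj_part lam k"
    unfolding conj_part_size by (metis mset_filter mset_rev mset_sorted_list_of_multiset size_mset)
  ultimately have "i - 1 < length ?ps \<and> k \<le> ?ps ! (i - 1) \<longleftrightarrow> i - 1 < conj_part lam k"
    using nth_ge_iff_length_filter by metis
  then show ?thesis using assms by (auto simp: part_def Let_def)
qed

text \<open>Moments and \<open>C_coeff\<close> see only column lengths, so containment, which is
  defined by rows, is moved to columns.\<close>

lemma partition_le_iff: "partition_le mu lam \<longleftrightarrow> (\<forall>k\<ge>1. conj_part mu k \<le> conj_part lam k)"
proof
  assume le: "partition_le mu lam"
  show "\<forall>k\<ge>1. conj_part mu k \<le> conj_part lam k"
  proof (intro allI impI)
    fix k :: nat assume k: "k \<ge> 1"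
    show "conj_part mu k \<le> conj_part lam k"
    proof (cases "conj_part mu k = 0")
      case False
      then have "k \<le> part mu (conj_part mu k)" using part_ge_iff[of "conj_part mu k" k mu] k by simp
      also have "\<dots> \<le> part lam (conj_part mu k)" using le False by (simp add: partition_le_def)
      finally show ?thesis using part_ge_iff[of "conj_part mu k" k lam] k False by simp
    qed simp
  qed
next
  assume le: "\<forall>k\<ge>1. conj_part mu k \<le> conj_part lam k"
  show "partition_le mu lam" unfolding partition_le_def
  proof (intro allI impI)
    fix i :: nat assume i: "i \<ge> 1"
    show "part mu i \<le> part lam i"
    proof (cases "part mu i = 0")
      case False
      then have "i \<le> conj_part mu (part mu i)" using part_ge_iff[of i "part mu i" mu] i by simp
      also have "\<dots> \<le> conj_part lam (part mu i)" using le False by simp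
      finally show ?thesis using part_ge_iff[of i "part mu i" lam] i False by simp
    qed simp
  qed
qed

text \<open>The column lengths are the exponents \<open>ns\<close> of the moment belonging to
  \<open>lam\<close>; see \<open>prod_power_count\<close>.\<close>

definition conj_list :: "nat \<Rightarrow> nat multiset \<Rightarrow> nat list" where
  "conj_list l lam = map (conj_part lam) [1..<Suc l]"

lemma length_conj_list [simp]: "length (conj_list l lam) = l"
  by (simp add: conj_list_def)

lemma nth_conj_list: "i < l \<Longrightarrow> conj_list l lam ! i = conj_part lam (Suc i)"
  by (simp add: conj_list_def del: upt_Suc)

lemma sorted_conj_list: "sorted_wrt (\<ge>) (conj_list l lam)"
  unfolding conj_list_def sorted_wrt_map
  by (rule sorted_wrt_mono_rel[of _ "(<)"]) (auto intro: conj_part_antimono simp del: upt_Suc)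

definition sub_lists :: "nat list \<Rightarrow> nat list set" where
  "sub_lists ns = {ms. sorted_wrt (\<ge>) ms \<and> list_all2 (\<le>) ms ns}"

lemma mset_eq_of_conj_part:
  assumes "is_partition mu" "is_partition nu" "\<And>k. k \<ge> 1 \<Longrightarrow> conj_part mu k = conj_part nu k"
  shows "mu = nu"
proof (rule multiset_eqI)
  fix k
  show "count mu k = count nu k"
  proof (cases "k = 0")
    case True
    then show ?thesis using assms(1,2) by (simp add: is_partition_def not_in_iff)
  next
    case False
    then show ?thesis using assms(3)[of k] assms(3)[of "Suc k"] conj_part_Suc[of mu k] conj_part_Suc[of nu k]
      by simp
  qed
qed

lemma exists_mset_conj_part:
  fixes m :: "nat \<Rightarrow> nat"
  assumes dec: "\<And>k. 1 \<le> k \<Longrightarrow> k \<le> l \<Longrightarrow> m (Suc k) \<le> m k" and "m (Suc l) = 0"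
  obtains mu where "is_partition mu" "\<forall>i\<in>#mu. i \<le> l" "\<And>k. 1 \<le> k \<Longrightarrow> k \<le> Suc l \<Longrightarrow> conj_part mu k = m k"
proof -
  define mu where "mu = (\<Sum>i\<in>{1..l}. replicate_mset (m i - m (Suc i)) i)"
  have cnt: "count mu j = (if 1 \<le> j \<and> j \<le> l then m j - m (Suc j) else 0)" for j
  proof -
    have "count mu j = (\<Sum>i\<in>{1..l}. if i = j then m i - m (Suc i) else 0)"
      unfolding mu_def count_sum by (intro sum.cong) auto
    then show ?thesis by simp
  qed
  have "is_partition mu" using cnt[of 0] by (simp add: is_partition_def not_in_iff)
  moreover have le: "\<forall>i\<in>#mu. i \<le> l"
  proof
    fix i assume "i \<in># mu"
    then have "count mu i \<noteq> 0" by simp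
    then show "i \<le> l" using cnt[of i] by (auto split: if_splits)
  qed
  moreover have "conj_part mu k = m k" if "1 \<le> k" "k \<le> Suc l" for k
    using that
  proof (induction "Suc l - k" arbitrary: k)
    case 0
    then show ?case using conj_part_eq_0[OF le, of k] assms(2) by (simp add: le_antisym)
  next
    case (Suc d)
    then have "k \<le> l" by arith
    with Suc have "conj_part mu (Suc k) = m (Suc k)" by simp
    then show ?case using conj_part_Suc[of mu k] cnt[of k] dec[of k] Suc.prems \<open>k \<le> l\<close> by simp
  qed
  ultimately show ?thesis using that by blast
qed

text \<open>A partition contained in \<open>lam\<close> has all its parts at most \<open>l\<close>
  too, so its first \<open>l\<close> column lengths determine it.\<close>

lemma bij_betw_conj_list:
  assumes "\<forall>i\<in>#lam. i \<le> l"
  shows "bij_betw (conj_list l) {mu. is_partition mu \<and> partition_le mu lam} (sub_lists (conj_list l lam))"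
proof (rule bij_betw_imageI)
  have 0: "conj_part mu k = 0" if "partition_le mu lam" "k > l" for mu k
  proof -
    have "conj_part mu k \<le> conj_part lam k" using that by (auto simp: partition_le_iff)
    then show ?thesis using conj_part_eq_0[OF assms that(2)] by simp
  qed
  show "inj_on (conj_list l) {mu. is_partition mu \<and> partition_le mu lam}"
  proof (rule inj_onI)
    fix mu nu assume a: "mu \<in> {mu. is_partition mu \<and> partition_le mu lam}"
      "nu \<in> {mu. is_partition mu \<and> partition_le mu lam}" "conj_list l mu = conj_list l nu"
    show "mu = nu"
    proof (rule mset_eq_of_conj_part)
      fix k :: nat assume "k \<ge> 1"
      then show "conj_part mu k = conj_part nu k"
        using a 0[of mu k] 0[of nu k] by (cases "k \<le> l") (auto simp: conj_list_def simp del: upt_Suc)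
    qed (use a in auto)
  qed
  show "conj_list l ` {mu. is_partition mu \<and> partition_le mu lam} = sub_lists (conj_list l lam)"
  proof
    show "conj_list l ` {mu. is_partition mu \<and> partition_le mu lam} \<subseteq> sub_lists (conj_list l lam)"
      using sorted_conj_list
      by (auto simp: sub_lists_def list_all2_conv_all_nth partition_le_iff nth_conj_list)
    show "sub_lists (conj_list l lam) \<subseteq> conj_list l ` {mu. is_partition mu \<and> partition_le mu lam}"
    proof
      fix ms assume ms: "ms \<in> sub_lists (conj_list l lam)"
      then have len: "length ms = l" by (auto simp: sub_lists_def dest: list_all2_lengthD)
      define m where "m = (\<lambda>k. if k \<le> l then ms ! (k - 1) else 0)"
      have dec: "m (Suc k) \<le> m k" if "1 \<le> k" "k \<le> l" for k
      proof (cases "k = l")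
        case False
        then have "ms ! (k - 1) \<ge> ms ! k"
          using ms that len sorted_wrt_nth_less[of "(\<ge>)" ms "k - 1" k] by (auto simp: sub_lists_def)
        then show ?thesis using that by (simp add: m_def)
      qed (simp add: m_def)
      obtain mu where mu: "is_partition mu" "\<forall>i\<in>#mu. i \<le> l" "\<And>k. 1 \<le> k \<Longrightarrow> k \<le> Suc l \<Longrightarrow> conj_part mu k = m k"
        using exists_mset_conj_part[of l m] dec by (auto simp: m_def)
      have "conj_list l mu = ms"
        by (rule nth_equalityI) (auto simp: nth_conj_list len mu(3) m_def)
      moreover have "partition_le mu lam"
        unfolding partition_le_iff
      proof (intro allI impI)
        fix k :: nat assume k: "k \<ge> 1"
        show "conj_part mu k \<le> conj_part lam k"
        proof (cases "k \<le> l")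
          case True
          then have "ms ! (k - 1) \<le> conj_list l lam ! (k - 1)"
            using ms k len by (auto simp: sub_lists_def list_all2_conv_all_nth)
          then show ?thesis using mu(3)[of k] k True by (simp add: m_def nth_conj_list)
        qed (simp add: conj_part_eq_0[OF mu(2)])
      qed
      ultimately show "ms \<in> conj_list l ` {mu. is_partition mu \<and> partition_le mu lam}"
        using mu(1) by blast
    qed
  qed
qed

text \<open>The value 0 on the empty list plays the part of the vanishing column after the last
  one.\<close>

definition hd0 :: "nat list \<Rightarrow> nat" where "hd0 ms = (case ms of [] \<Rightarrow> 0 | m # _ \<Rightarrow> m)"

lemma hd0_simps [simp]: "hd0 [] = 0" "hd0 (m # ms) = m" by (simp_all add: hd0_def)

lemma sub_lists_Nil: "sub_lists [] = {[]}" by (auto simp: sub_lists_def)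

lemma sub_lists_Cons: "sub_lists (n # ns) = (\<Union>m\<le>n. (#) m ` {ms \<in> sub_lists ns. hd0 ms \<le> m})"
proof (rule Set.set_eqI)
  fix xs
  show "xs \<in> sub_lists (n # ns) \<longleftrightarrow> xs \<in> (\<Union>m\<le>n. (#) m ` {ms \<in> sub_lists ns. hd0 ms \<le> m})"
  proof (cases xs)
    case (Cons m ms)
    have "sorted_wrt (\<ge>) (m # ms) \<longleftrightarrow> sorted_wrt (\<ge>) ms \<and> hd0 ms \<le> m"
      by (cases ms) auto
    then show ?thesis using Cons by (auto simp: sub_lists_def)
  qed (auto simp: sub_lists_def)
qed

lemma finite_sub_lists: "finite (sub_lists ns)"
  by (induction ns) (auto simp: sub_lists_Nil sub_lists_Cons)

section \<open>The sum over contained partitions as a sum of chain coefficients\<close>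

context cohen_lenstra_chain
begin

text \<open>One factor of \<open>C_coeff\<close> and the matching power of \<open>q ^ u\<close> per
  step: \<open>n\<close>, \<open>m\<close> and \<open>hd0 ms\<close> stand for \<lambda>'_i,
  \<mu>'_i and \<mu>'_(i+1).\<close>

fun sub_weight :: "nat \<Rightarrow> nat list \<Rightarrow> nat list \<Rightarrow> real" where
  "sub_weight u (n # ns) (m # ms) = q ^ (u * m) * (P ^ (hd0 ms * (n - m)) * qbinom P (n - hd0 ms) (n - m)) * sub_weight u ns ms"
| "sub_weight u _ _ = 1"

text \<open>The recursion of \<open>mcoeff\<close> sums over the next column length, which is
  \<open>hd0\<close> of the tail. Grouping the lists by this value unrolls it.\<close>

lemma mcoeff_eq_sum: "mcoeff u ns k = (\<Sum>ms | ms \<in> sub_lists ns \<and> hd0 ms = k. sub_weight u ns ms)"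
proof (induction ns arbitrary: k)
  case Nil
  have "{ms. ms \<in> sub_lists [] \<and> hd0 ms = k} = (if k = 0 then {[]} else {})"
    by (auto simp: sub_lists_Nil)
  then show ?case by simp
next
  case (Cons n ns)
  show ?case
  proof (cases "k \<le> n")
    case True
    let ?c = "\<lambda>j. P ^ (j * (n - k)) * qbinom P (n - j) (n - k)"
    have "{ms. ms \<in> sub_lists (n # ns) \<and> hd0 ms = k} = (#) k ` {ms \<in> sub_lists ns. hd0 ms \<le> k}"
      using True by (auto simp: sub_lists_Cons)
    then have "(\<Sum>ms | ms \<in> sub_lists (n # ns) \<and> hd0 ms = k. sub_weight u (n # ns) ms)
        = (\<Sum>ms | ms \<in> sub_lists ns \<and> hd0 ms \<le> k. q ^ (u * k) * (?c (hd0 ms) * sub_weight u ns ms))"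
      by (simp add: sum.reindex mult.assoc)
    also have "\<dots> = q ^ (u * k) * (\<Sum>ms | ms \<in> sub_lists ns \<and> hd0 ms \<le> k. ?c (hd0 ms) * sub_weight u ns ms)"
      by (simp add: sum_distrib_left)
    also have "(\<Sum>ms | ms \<in> sub_lists ns \<and> hd0 ms \<le> k. ?c (hd0 ms) * sub_weight u ns ms)
        = (\<Sum>j\<le>k. \<Sum>ms | ms \<in> {ms. ms \<in> sub_lists ns \<and> hd0 ms \<le> k} \<and> hd0 ms = j. ?c (hd0 ms) * sub_weight u ns ms)"
      by (rule sum.group[symmetric]) (use finite_sub_lists in auto)
    also have "\<dots> = (\<Sum>j\<le>k. ?c j * mcoeff u ns j)"
    proof (rule sum.cong[OF refl])
      fix j assume "j \<in> {..k}"
      then have "{ms. ms \<in> {ms. ms \<in> sub_lists ns \<and> hd0 ms \<le> k} \<and> hd0 ms = j} = {ms. ms \<in> sub_lists ns \<and> hd0 ms = j}"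
        by auto
      then show "(\<Sum>ms | ms \<in> {ms. ms \<in> sub_lists ns \<and> hd0 ms \<le> k} \<and> hd0 ms = j. ?c (hd0 ms) * sub_weight u ns ms) = ?c j * mcoeff u ns j"
        unfolding Cons.IH sum_distrib_left by (intro sum.cong) auto
    qed
    finally show ?thesis using True by simp
  next
    case False
    then have e: "{ms. ms \<in> sub_lists (n # ns) \<and> hd0 ms = k} = {}"
      by (auto simp: sub_lists_Cons)
    show ?thesis unfolding e using False by simp
  qed
qed

lemma sum_mcoeff:
  assumes "\<forall>x\<in>set ns. x \<le> B"
  shows "(\<Sum>k\<le>B. mcoeff u ns k) = (\<Sum>ms\<in>sub_lists ns. sub_weight u ns ms)"
proof -
  have "hd0 ms \<le> B" if "ms \<in> sub_lists ns" for ms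
    using that assms by (cases ns; cases ms) (auto simp: sub_lists_def)
  then have "(\<Sum>k\<le>B. \<Sum>ms | ms \<in> sub_lists ns \<and> hd0 ms = k. sub_weight u ns ms) = (\<Sum>ms\<in>sub_lists ns. sub_weight u ns ms)"
    by (intro sum.group) (auto simp: finite_sub_lists)
  then show ?thesis by (simp only: mcoeff_eq_sum)
qed

lemma sub_weight_map:
  assumes "m (Suc l) = 0" "a \<le> Suc l"
  shows "sub_weight u (map n [a..<Suc l]) (map m [a..<Suc l]) =
    (\<Prod>i=a..l. q ^ (u * m i) * (P ^ (m (i + 1) * (n i - m i)) * qbinom P (n i - m (i + 1)) (n i - m i)))"
  using assms(2)
proof (induction "Suc l - a" arbitrary: a)
  case (Suc d)
  then have al: "a \<le> l" by simp
  have "hd0 (map m [Suc a..<Suc l]) = m (Suc a)"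
    using al assms(1) by (cases "a = l") (auto simp: upt_conv_Cons simp del: upt_Suc)
  moreover have "[a..<Suc l] = a # [Suc a..<Suc l]" using al by (simp add: upt_conv_Cons del: upt_Suc)
  ultimately show ?case using Suc.hyps(1)[of "Suc a"] Suc.hyps(2) al
    by (simp add: prod.atLeast_Suc_atMost del: upt_Suc)
qed simp

lemma C_coeff_eq_sub_weight:
  assumes Pp: "P = real p" and lam: "is_partition lam" "\<forall>i\<in>#lam. i \<le> l"
    and mu: "partition_le mu lam" "\<forall>i\<in>#mu. i \<le> l"
  shows "C_coeff p lam mu / real p ^ (u * \<Sum>\<^sub># mu) = sub_weight u (conj_list l lam) (conj_list l mu)"
proof -
  let ?n = "conj_part lam" and ?m = "conj_part mu" and ?s = "\<Sum>\<^sub># lam"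
  \<comment> \<open>\<open>C_coeff\<close> runs up to the size of \<open>lam\<close>, the lists up
    to \<open>l\<close>, and either bound may be the larger. Beyond either of them both column
    lengths vanish, so the ranges can be exchanged.\<close>
  have z: "?n i = 0 \<and> ?m i = 0" if "1 \<le> i" "\<not> i \<le> ?s \<or> \<not> i \<le> l" for i
  proof -
    have "?n i = 0"
    proof (cases "i \<le> l")
      case False
      then show ?thesis using conj_part_eq_0[OF lam(2)] by simp
    next
      case True
      then have "i > ?s" using that by simp
      moreover have "\<forall>i\<in>#lam. i \<le> ?s" by (metis sum_mset.remove le_add1)
      ultimately show ?thesis using conj_part_eq_0 by blast
    qed
    moreover have "?m i \<le> ?n i" using mu(1) that by (simp add: partition_le_iff)
    ultimately show ?thesis by simp
  qed
  have ext_sum: "(\<Sum>i=1..?s. f i) = (\<Sum>i=1..l. f i)" if "\<And>i. ?n i = 0 \<and> ?m i = 0 \<Longrightarrow> f i = 0" for f :: "nat \<Rightarrow> nat"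
    using that z by (intro sum.mono_neutral_cong) auto
  have ext_prod: "(\<Prod>i=1..?s. f i) = (\<Prod>i=1..l. f i)" if "\<And>i. ?n i = 0 \<and> ?m i = 0 \<Longrightarrow> f i = 1" for f :: "nat \<Rightarrow> real"
    using that z by (intro prod.mono_neutral_cong) auto
  have "C_coeff p lam mu = P ^ (\<Sum>i = 1..l. ?m (i + 1) * (?n i - ?m i)) *
     (\<Prod>i = 1..l. qbinom P (?n i - ?m (i + 1)) (?n i - ?m i))"
    unfolding C_coeff_def Pp[symmetric] using P by (subst ext_sum, simp, subst ext_prod) simp_all
  also have "\<dots> = (\<Prod>i=1..l. P ^ (?m (i + 1) * (?n i - ?m i)) * qbinom P (?n i - ?m (i + 1)) (?n i - ?m i))"
    by (simp add: power_sum prod.distrib)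
  finally have C: "C_coeff p lam mu = \<dots>" .
  have "1 / real p ^ (u * \<Sum>\<^sub># mu) = q ^ (u * \<Sum>\<^sub># mu)" unfolding Pp[symmetric] by (simp only: q_def power_one_over)
  also have "\<dots> = (\<Prod>i=1..l. q ^ (u * ?m i))"
    by (simp add: sum_mset_eq_sum_conj_part[OF mu(2)] sum_distrib_left power_sum)
  finally have U: "1 / real p ^ (u * \<Sum>\<^sub># mu) = (\<Prod>i=1..l. q ^ (u * ?m i))" .
  have "C_coeff p lam mu / real p ^ (u * \<Sum>\<^sub># mu) = (1 / real p ^ (u * \<Sum>\<^sub># mu)) * C_coeff p lam mu" by simp
  also have "\<dots> = sub_weight u (conj_list l lam) (conj_list l mu)"
    unfolding C U conj_list_def using conj_part_eq_0[OF mu(2), of "Suc l"]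
    by (subst sub_weight_map) (simp_all add: prod.distrib)
  finally show ?thesis .
qed

text \<open>Identifies the average in the hypothesis of the theorem with the limit in
  \<open>chain_exp_moment_tendsto\<close>.\<close>

lemma sum_C_coeff:
  assumes "P = real p" and lam: "is_partition lam" "\<forall>i\<in>#lam. i \<le> l"
    and B: "\<forall>x\<in>set (conj_list l lam). x \<le> B"
  shows "(\<Sum>mu | is_partition mu \<and> partition_le mu lam. C_coeff p lam mu / real p ^ (u * \<Sum>\<^sub># mu))
     = (\<Sum>k\<le>B. mcoeff u (conj_list l lam) k)"
proof -
  have parts: "\<forall>i\<in>#mu. i \<le> l" if "partition_le mu lam" for mu
  proof (rule ccontr)
    assume "\<not> ?thesis"
    then obtain i where i: "i \<in># mu" "i > l" by auto
    then have "i \<ge> 1" by simp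
    then have "conj_part mu i \<le> 0"
      using that conj_part_eq_0[OF lam(2) i(2)] partition_le_iff[of mu lam] by fastforce
    moreover have "count mu i > 0" using i(1) by simp
    ultimately show False using conj_part_Suc[of mu i] by simp
  qed
  have "(\<Sum>mu | is_partition mu \<and> partition_le mu lam. C_coeff p lam mu / real p ^ (u * \<Sum>\<^sub># mu))
     = (\<Sum>mu | is_partition mu \<and> partition_le mu lam. sub_weight u (conj_list l lam) (conj_list l mu))"
    using C_coeff_eq_sub_weight[OF assms(1) lam _ parts] by (intro sum.cong) auto
  also have "\<dots> = (\<Sum>ms\<in>sub_lists (conj_list l lam). sub_weight u (conj_list l lam) ms)"
    by (rule sum.reindex_bij_betw[OF bij_betw_conj_list[OF lam(2)]])
  finally show ?thesis using sum_mcoeff[OF B] by simp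
qed

lemma moment_map:
  "moment (map n [a..<b]) (map r [a..<b]) = (\<Prod>i=a..<b. P ^ (n i * r i))"
proof (induction "b - a" arbitrary: a)
  case (Suc d)
  then have "[a..<b] = a # [Suc a..<b]" by (simp add: upt_conv_Cons)
  then show ?case using Suc by (simp add: prod.atLeast_Suc_lessThan)
qed simp

text \<open>The rank \<open>r j\<close> enters every torsion order with \<open>i \<ge> j\<close>, so
  after exchanging the sums its exponent is the number of parts that are at least
  \<open>j\<close>.\<close>

lemma prod_power_count:
  assumes "\<forall>i\<in>#lam. i \<le> l"
  shows "(\<Prod>i=1..l. (P ^ (\<Sum>j=1..i. r j)) ^ count lam i) = moment (conj_list l lam) (map r [1..<Suc l])"
proof -
  have "(\<Sum>i=1..l. (\<Sum>j=1..i. r j) * count lam i) = (\<Sum>i=1..l. \<Sum>j=1..i. r j * count lam i)"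
    by (simp add: sum_distrib_right)
  also have "\<dots> = (\<Sum>j=1..l. \<Sum>i=j..l. r j * count lam i)"
    unfolding sum.Sigma[OF finite_atLeastAtMost ballI[OF finite_atLeastAtMost]]
    by (rule sum.reindex_bij_witness[of _ "\<lambda>(m, k). (k, m)" "\<lambda>(k, m). (m, k)"]) auto
  also have "\<dots> = (\<Sum>j=1..l. conj_part lam j * r j)"
    by (intro sum.cong[OF refl]) (simp add: conj_part_eq_sum[OF assms] sum_distrib_left mult.commute)
  finally have e: "(\<Sum>i=1..l. (\<Sum>j=1..i. r j) * count lam i) = \<dots>" .
  have "(\<Prod>i=1..l. (P ^ (\<Sum>j=1..i. r j)) ^ count lam i) = P ^ (\<Sum>i=1..l. (\<Sum>j=1..i. r j) * count lam i)"
    by (simp add: power_sum power_mult)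
  also have "\<dots> = (\<Prod>j=1..l. P ^ (conj_part lam j * r j))" unfolding e by (simp add: power_sum)
  also have "\<dots> = moment (conj_list l lam) (map r [1..<Suc l])"
    unfolding conj_list_def moment_map by (simp add: atLeastLessThanSuc_atLeastAtMost)
  finally show ?thesis .
qed

end

section \<open>Moments determine the law of the ranks\<close>

text \<open>Serves both for rank vectors and for exponent vectors of moments.\<close>

definition rank_lists :: "nat \<Rightarrow> nat list set" where
  "rank_lists l = {rs. length rs = l \<and> sorted_wrt (\<ge>) rs}"

context cohen_lenstra_chain
begin

text \<open>The functions whose averages the hypothesis prescribes. The inductive form allows limits
  and bounds to be proved by rule induction. The span is closed under products because decreasing
  exponent vectors add up to decreasing ones.\<close>

inductive moment_span :: "nat \<Rightarrow> (nat list \<Rightarrow> real) \<Rightarrow> bool" for l where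
  moment: "ns \<in> rank_lists l \<Longrightarrow> moment_span l (moment ns)"
| add: "moment_span l f \<Longrightarrow> moment_span l g \<Longrightarrow> moment_span l (\<lambda>rs. f rs + g rs)"
| scale: "moment_span l f \<Longrightarrow> moment_span l (\<lambda>rs. c * f rs)"

lemma moment_add:
  "length ns = length ns' \<Longrightarrow> moment (map2 (+) ns ns') rs = moment ns rs * moment ns' rs"
proof (induction ns ns' arbitrary: rs rule: list_induct2)
  case (Cons x xs y ys)
  then show ?case by (cases rs) (simp_all add: power_add distrib_right)
qed simp

lemma moment_replicate_0: "moment (replicate l 0) rs = 1"
  by (induction l arbitrary: rs) (auto, metis list.exhaust moment.simps(1,3) mult_0 mult_1 power_0)

text \<open>The exponents 1, ..., 1, 0, ..., 0 are decreasing, those of a single later rank are not;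
  hence the interpolation in partial sums of ranks.\<close>

lemma moment_partial_sum:
  "moment (replicate i 1 @ replicate d 0) rs = P ^ sum_list (take i rs)"
proof (induction i arbitrary: rs)
  case 0
  then show ?case by (simp add: moment_replicate_0)
next
  case (Suc i)
  then show ?case by (cases rs) (simp_all add: power_add)
qed

lemma sorted_replicate_append: "sorted_wrt (\<ge>) (replicate i (1::nat) @ replicate d 0)"
  by (auto simp: sorted_wrt_iff_nth_less nth_append)

lemma moment_span_partial_sum: "i \<le> l \<Longrightarrow> moment_span l (\<lambda>rs. P ^ sum_list (take i rs))"
  using moment_span.moment[of "replicate i 1 @ replicate (l - i) 0" l] sorted_replicate_append[of i "l - i"]
  by (simp add: moment_partial_sum[abs_def] rank_lists_def flip: One_nat_def)

lemma moment_span_const: "moment_span l (\<lambda>rs. c)"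
  using moment_span.scale[OF moment_span_partial_sum[of 0 l], of c] by simp

lemma sorted_map2_add:
  "sorted_wrt (\<ge>) xs \<Longrightarrow> sorted_wrt (\<ge>) ys \<Longrightarrow> length xs = length ys \<Longrightarrow> sorted_wrt (\<ge>) (map2 (+) xs (ys :: nat list))"
  by (auto simp: sorted_wrt_iff_nth_less intro: add_mono)

lemma moment_span_mult_moment:
  "moment_span l g \<Longrightarrow> ns \<in> rank_lists l \<Longrightarrow> moment_span l (\<lambda>rs. moment ns rs * g rs)"
proof (induction rule: moment_span.induct)
  case (moment ns')
  have "map2 (+) ns ns' \<in> rank_lists l"
    using moment by (auto simp: rank_lists_def intro: sorted_map2_add)
  moreover have "moment (map2 (+) ns ns') = (\<lambda>rs. moment ns rs * moment ns' rs)"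
    by (rule ext, rule moment_add) (use moment in \<open>simp add: rank_lists_def\<close>)
  ultimately show ?case using moment_span.moment by metis
next
  case (add f g)
  then show ?case using moment_span.add by (simp add: distrib_left)
next
  case (scale f c)
  then show ?case using moment_span.scale[of l _ c] by (simp add: mult.left_commute)
qed

lemma moment_span_mult:
  "moment_span l f \<Longrightarrow> moment_span l g \<Longrightarrow> moment_span l (\<lambda>rs. f rs * g rs)"
proof (induction rule: moment_span.induct)
  case (moment ns)
  then show ?case by (intro moment_span_mult_moment)
next
  case (add f g)
  then show ?case using moment_span.add by (simp add: distrib_right)
next
  case (scale f c)
  then show ?case using moment_span.scale[of l _ c] by (simp add: mult.assoc)
qed

lemma moment_span_prod:
  "(\<And>i. i \<in> A \<Longrightarrow> moment_span l (f i)) \<Longrightarrow> moment_span l (\<lambda>rs. \<Prod>i\<in>A. f i rs)"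
proof (induction A rule: infinite_finite_induct)
  case (insert x F)
  then show ?case using moment_span_mult[of l "f x" "\<lambda>rs. \<Prod>i\<in>F. f i rs"] by simp
qed (simp_all add: moment_span_const)

lemma moment_span_factor:
  assumes "i \<le> l"
  shows "moment_span l (\<lambda>rs. (P ^ sum_list (take i rs) - a) / b)"
proof -
  have "moment_span l (\<lambda>rs. (1 / b) * (P ^ sum_list (take i rs) + - a))"
    by (intro moment_span.scale moment_span.add moment_span_partial_sum moment_span_const assms)
  then show ?thesis by simp
qed

lemma moment_span_bound:
  assumes "moment_span l f"
  obtains C D where "C \<ge> 0" "\<And>rs. rs \<in> rank_lists l \<Longrightarrow> \<bar>f rs\<bar> \<le> C * P ^ (D * hd0 rs)"
proof -
  have "\<exists>C D. C \<ge> 0 \<and> (\<forall>rs\<in>rank_lists l. \<bar>f rs\<bar> \<le> C * P ^ (D * hd0 rs))"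
    using assms
  proof induction
    case (moment ns)
    have "\<bar>moment ns rs\<bar> \<le> P ^ (sum_list ns * hd0 rs)" if "\<forall>r\<in>set rs. r \<le> hd0 rs" for rs
    proof -
      have "1 \<le> moment ns rs \<and> moment ns rs \<le> P ^ (sum_list ns * B)" if "\<forall>r\<in>set rs. r \<le> B" for B
        using that
      proof (induction ns rs rule: moment.induct)
        case (1 n ns r rs)
        have "1 * 1 \<le> P ^ (n * r) * moment ns rs"
          using 1 P by (intro mult_mono) auto
        moreover have "P ^ (n * r) * moment ns rs \<le> P ^ (n * B) * P ^ (sum_list ns * B)"
          using 1 P by (intro mult_mono power_increasing) auto
        ultimately show ?case by (simp add: power_add distrib_right)
      qed (use P in auto)
      from this[of "hd0 rs"] that show ?thesis by simp
    qed
    moreover have "\<forall>r\<in>set rs. r \<le> hd0 rs" if "rs \<in> rank_lists l" for rs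
      using that by (cases rs) (auto simp: rank_lists_def)
    ultimately show ?case by (intro exI[of _ 1] exI[of _ "sum_list ns"]) auto
  next
    case (add f g)
    then obtain C D C' D' where fg: "C \<ge> 0" "\<forall>rs\<in>rank_lists l. \<bar>f rs\<bar> \<le> C * P ^ (D * hd0 rs)"
      "C' \<ge> 0" "\<forall>rs\<in>rank_lists l. \<bar>g rs\<bar> \<le> C' * P ^ (D' * hd0 rs)" by blast
    have "\<bar>f rs + g rs\<bar> \<le> (C + C') * P ^ ((D + D') * hd0 rs)" if "rs \<in> rank_lists l" for rs
    proof -
      have "\<bar>f rs + g rs\<bar> \<le> C * P ^ (D * hd0 rs) + C' * P ^ (D' * hd0 rs)"
        using fg that abs_triangle_ineq[of "f rs" "g rs"] by force
      also have "\<dots> \<le> C * P ^ ((D + D') * hd0 rs) + C' * P ^ ((D + D') * hd0 rs)"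
        using P fg by (intro add_mono mult_left_mono power_increasing) auto
      finally show ?thesis by (simp add: distrib_right)
    qed
    then show ?case using fg(1,3) by (intro exI[of _ "C + C'"] exI[of _ "D + D'"]) auto
  next
    case (scale f c)
    then obtain C D where f: "C \<ge> 0" "\<forall>rs\<in>rank_lists l. \<bar>f rs\<bar> \<le> C * P ^ (D * hd0 rs)" by blast
    have "\<bar>c * f rs\<bar> \<le> (\<bar>c\<bar> * C) * P ^ (D * hd0 rs)" if "rs \<in> rank_lists l" for rs
      using mult_left_mono[OF f(2)[rule_format, OF that], of "\<bar>c\<bar>"] by (simp add: abs_mult mult.assoc)
    then show ?case using f(1) by (intro exI[of _ "\<bar>c\<bar> * C"] exI[of _ D]) auto
  qed
  then show ?thesis using that by blast
qed

section \<open>Lagrange interpolation on powers of \<open>P\<close>\<close>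

definition lagrange_factor :: "nat set \<Rightarrow> nat \<Rightarrow> nat \<Rightarrow> real" where
  "lagrange_factor J k r = (\<Prod>j\<in>J - {k}. (P ^ r - P ^ j) / (P ^ k - P ^ j))"

lemma power_inj: "P ^ a = P ^ b \<longleftrightarrow> a = b"
  using P by (simp add: power_inject_exp)

lemma lagrange_factor_eq:
  assumes "finite J" "r \<in> J"
  shows "lagrange_factor J k r = of_bool (r = k)"
proof (cases "r = k")
  case True
  then show ?thesis by (auto simp: lagrange_factor_def power_inj intro!: prod.neutral)
next
  case False
  then show ?thesis using assms by (auto simp: lagrange_factor_def)
qed

lemma moment_span_lagrange_factor:
  assumes "i \<le> l"
  shows "moment_span l (\<lambda>rs. lagrange_factor J k (sum_list (take i rs)))"
  unfolding lagrange_factor_def by (intro moment_span_prod moment_span_factor assms)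

lemma eq_of_partial_sums_eq:
  fixes rs ms :: "nat list"
  shows "length rs = length ms \<Longrightarrow> (\<And>i. i \<le> length ms \<Longrightarrow> sum_list (take i rs) = sum_list (take i ms)) \<Longrightarrow> rs = ms"
proof (induction rs ms rule: list_induct2)
  case (Cons x xs y ys)
  have xy: "x = y" using Cons.prems[of 1] by simp
  have "sum_list (take i xs) = sum_list (take i ys)" if "i \<le> length ys" for i
    using Cons.prems[of "Suc i"] that xy by simp
  then show ?case using Cons.IH xy by blast
qed simp

text \<open>With the head fixed, all partial sums lie in a finite set depending only on
  \<open>ms\<close>, where interpolation is exact. So the growth of \<open>f\<close> is independent
  of the number of nodes used later for the first rank.\<close>

lemma exists_indicator_given_hd:
  assumes "ms \<in> rank_lists l"
  obtains f where "moment_span l f"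
    "\<And>rs. rs \<in> rank_lists l \<Longrightarrow> hd0 rs = hd0 ms \<Longrightarrow> f rs = of_bool (rs = ms)"
proof -
  define f where "f = (\<lambda>rs. \<Prod>i\<le>l. lagrange_factor {..l * hd0 ms} (sum_list (take i ms)) (sum_list (take i rs)))"
  have "moment_span l f"
    unfolding f_def by (intro moment_span_prod moment_span_lagrange_factor) auto
  moreover have "f rs = of_bool (rs = ms)" if rs: "rs \<in> rank_lists l" "hd0 rs = hd0 ms" for rs
  proof -
    have le: "\<forall>r\<in>set rs. r \<le> hd0 ms"
      unfolding rs(2)[symmetric] using rs(1) by (cases rs) (auto simp: rank_lists_def)
    have "sum_list (take i rs) \<in> {..l * hd0 ms}" for i
    proof -
      have "sum_list (take i rs) \<le> length (take i rs) * hd0 ms"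
        using le sum_list_mono[of "take i rs" "\<lambda>r. r" "\<lambda>_. hd0 ms"]
        by (force simp: sum_list_triv dest: in_set_takeD)
      also have "\<dots> \<le> l * hd0 ms" using rs(1) by (intro mult_right_mono) (auto simp: rank_lists_def)
      finally show ?thesis by simp
    qed
    then have e: "f rs = (\<Prod>i\<le>l. of_bool (sum_list (take i rs) = sum_list (take i ms)))"
      unfolding f_def by (simp add: lagrange_factor_eq)
    show ?thesis
    proof (cases "rs = ms")
      case True
      then show ?thesis unfolding e by simp
    next
      case False
      then obtain i where "i \<le> l" "sum_list (take i rs) \<noteq> sum_list (take i ms)"
        using eq_of_partial_sums_eq[of rs ms] rs(1) assms by (auto simp: rank_lists_def)
      then show ?thesis unfolding e using False by auto
    qed
  qed
  ultimately show ?thesis using that by blast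
qed

section \<open>Size estimates for the interpolation error\<close>

lemma chain_exp_add: "chain_exp u l R (\<lambda>rs. f rs + g rs) = chain_exp u l R f + chain_exp u l R g"
  by (induction l arbitrary: R f g) (simp_all add: distrib_left sum.distrib)

lemma chain_exp_mono:
  assumes "\<And>rs. length rs = l \<Longrightarrow> sorted_wrt (\<ge>) (R # rs) \<Longrightarrow> f rs \<le> g rs"
  shows "chain_exp u l R f \<le> chain_exp u l R g"
  using assms
proof (induction l arbitrary: R f g)
  case (Suc l)
  show ?case unfolding chain_exp.simps
  proof (intro sum_mono mult_left_mono trans_nonneg Suc.IH)
    fix r rs assume "r \<in> {..R}" "length rs = l" "sorted_wrt (\<ge>) (r # rs)"
    then show "f (r # rs) \<le> g (r # rs)" by (intro Suc.prems) auto
  qed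
qed simp

lemma chain_exp_1: "chain_exp u l R (\<lambda>rs. 1) = 1"
  by (induction l arbitrary: R) (simp_all add: sum_trans)

text \<open>Each factor \<open>1 / (1 - q ^ i)\<close> is at most 2, hence at most \<open>P\<close>.
  The bound is crude but costs only a linear exponent, against the quadratic decay in
  \<open>trans_le\<close>.\<close>

lemma qf_inverse_le:
  assumes P2: "P \<ge> 2"
  shows "1 / qf r \<le> P ^ r"
proof (induction r)
  case (Suc r)
  have "q ^ Suc r \<le> q" using q by (simp add: mult_left_le power_le_one)
  moreover have "q \<le> 1 / 2" using P2 by (simp add: q_def field_simps)
  ultimately have "1 - q ^ Suc r \<ge> 1 / 2" by linarith
  then have "1 / (1 - q ^ Suc r) \<le> 1 / (1 / 2)" by (intro divide_left_mono) auto
  then have "1 / (1 - q ^ Suc r) \<le> P" using P2 by simp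
  then have "1 / qf r * (1 / (1 - q ^ Suc r)) \<le> P ^ r * P"
    using Suc P \<open>1 - q ^ Suc r \<ge> 1 / 2\<close> by (intro mult_mono) auto
  then show ?case by (simp add: qf_Suc mult.commute)
qed simp

lemma qf_antimono: "i \<le> j \<Longrightarrow> qf j \<le> qf i"
proof (induction rule: dec_induct)
  case (step n)
  have "qf n * (1 - q ^ Suc n) \<le> qf n * 1"
    using qf_pos[of n] q by (intro mult_left_mono) auto
  then show ?case using step by (simp add: qf_Suc)
qed simp

lemma trans_le:
  assumes P2: "P \<ge> 2" and r: "r \<le> R"
  shows "trans_prob u R r \<le> P ^ r * q ^ (r * r)"
proof -
  have "qpoch (q ^ (u + r + 1)) q (R - r) \<le> 1"
    using q q_pow_less_1[of "u + r"] by (intro qpoch_le_1) auto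
  moreover have "qf R / (qf r * qf (R - r)) \<le> P ^ r"
  proof -
    have "qf R / qf (R - r) \<le> 1" using qf_antimono[of "R - r" R] qf_pos[of "R - r"] by simp
    then have "qf R / qf (R - r) * (1 / qf r) \<le> 1 * P ^ r"
      using qf_inverse_le[OF P2, of r] qf_pos[of r] qf_pos[of R] qf_pos[of "R - r"] by (intro mult_mono) auto
    then show ?thesis by (simp add: mult.commute)
  qed
  moreover have "q ^ (r * r + u * r) \<le> q ^ (r * r)" using q by (intro power_decreasing) auto
  moreover have "0 \<le> qf R / (qf r * qf (R - r))" using qf_pos[of r] qf_pos[of R] qf_pos[of "R - r"] by simp
  moreover have "0 \<le> qpoch (q ^ (u + r + 1)) q (R - r)"
    using q q_pow_less_1[of "u + r"] by (intro less_imp_le qpoch_pos) auto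
  ultimately have "qf R / (qf r * qf (R - r)) * q ^ (r * r + u * r) * qpoch (q ^ (u + r + 1)) q (R - r)
      \<le> P ^ r * q ^ (r * r) * 1"
    using q P by (intro mult_mono mult_nonneg_nonneg) auto
  then show ?thesis by (simp add: trans_prob_def)
qed

text \<open>Completing the square: \<open>(2a + 1) r - r\<^sup>2 \<le> (a + 1)\<^sup>2 - r\<close>.\<close>

lemma chain_exp_hd_power_le:
  assumes P2: "P \<ge> 2"
  shows "chain_exp u (Suc l) R (\<lambda>rs. P ^ (2 * a * hd0 rs)) \<le> 2 * P ^ ((a + 1) * (a + 1))"
proof -
  have "chain_exp u (Suc l) R (\<lambda>rs. P ^ (2 * a * hd0 rs)) = (\<Sum>r\<le>R. trans_prob u R r * P ^ (2 * a * r))"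
    using chain_exp_cmult[of u l _ _ "\<lambda>_. 1"] by (simp add: chain_exp_1)
  also have "\<dots> \<le> (\<Sum>r\<le>R. P ^ ((a + 1) * (a + 1)) * q ^ r)"
  proof (rule sum_mono)
    fix r assume "r \<in> {..R}"
    then have "trans_prob u R r * P ^ (2 * a * r) \<le> P ^ r * q ^ (r * r) * P ^ (2 * a * r)"
      using P by (intro mult_right_mono trans_le P2) auto
    also have "\<dots> \<le> P ^ ((a + 1) * (a + 1)) * q ^ r"
    proof -
      have "2 * (a + 1) * r \<le> (a + 1) * (a + 1) + r * r"
      \<comment> \<open>The inequality is \<open>(a + 1 - r)^2 \<ge> 0\<close>; the cases keep the
        difference a natural number.\<close>
      proof (cases "r \<le> a + 1")
        case True
        then obtain d where "a + 1 = r + d" using le_Suc_ex by blast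
        then show ?thesis by (simp add: algebra_simps del: add_Suc_right)
      next
        case False
        then obtain d where "r = a + 1 + d" using le_Suc_ex[of "a + 1" r] by auto
        then show ?thesis by (simp add: algebra_simps)
      qed
      then have "P ^ (2 * (a + 1) * r) \<le> P ^ ((a + 1) * (a + 1) + r * r)"
        using P by (intro power_increasing) auto
      then have "P ^ (2 * (a + 1) * r) / (P ^ (r * r) * P ^ r) \<le> P ^ ((a + 1) * (a + 1) + r * r) / (P ^ (r * r) * P ^ r)"
        using P by (intro divide_right_mono) auto
      moreover have "P ^ (2 * (a + 1) * r) = P ^ r * P ^ (2 * a * r) * P ^ r"
        by (simp add: algebra_simps flip: power_add)
      moreover have "P ^ ((a + 1) * (a + 1) + r * r) = P ^ ((a + 1) * (a + 1)) * P ^ (r * r)"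
        by (rule power_add)
      ultimately show ?thesis using P by (simp add: q_def power_one_over field_simps)
    qed
    finally show "trans_prob u R r * P ^ (2 * a * r) \<le> P ^ ((a + 1) * (a + 1)) * q ^ r" .
  qed
  also have "\<dots> = P ^ ((a + 1) * (a + 1)) * (\<Sum>r\<le>R. q ^ r)" by (simp add: sum_distrib_left)
  also have "(\<Sum>r\<le>R. q ^ r) \<le> 2"
  proof -
    have "(\<Sum>r\<le>R. q ^ r) \<le> (\<Sum>r. q ^ r)"
      using q by (intro sum_le_suminf summable_geometric) auto
    also have "\<dots> = 1 / (1 - q)" using q by (intro suminf_geometric) auto
    also have "\<dots> \<le> 1 / (1 / 2)" using P2 by (intro divide_left_mono) (auto simp: q_def field_simps)
    finally show ?thesis by simp
  qed
  finally show ?thesis using P by (simp add: mult.commute)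
qed

text \<open>Nodes above \<open>k\<close> supply the quadratic exponent of the Lagrange denominator.
  The nodes below \<open>k\<close> are fixed in number, so for them the bound 1 is enough.\<close>

lemma abs_power_diff_ge:
  assumes P2: "P \<ge> 2" and jk: "j \<noteq> k"
  shows "\<bar>P ^ k - P ^ j\<bar> \<ge> P ^ (if k < j then j - 1 else 0)"
proof -
  have *: "P ^ b - P ^ a \<ge> P ^ (b - 1)" if "a < b" for a b
  proof -
    have "P ^ a \<le> P ^ (b - 1)" using P that by (intro power_increasing) auto
    moreover have "P ^ b = P * P ^ (b - 1)" using that by (cases b) auto
    moreover have "P * P ^ (b - 1) \<ge> 2 * P ^ (b - 1)" using P P2 by (intro mult_right_mono) auto
    ultimately show ?thesis by linarith
  qed
  show ?thesis
  proof (cases "k < j")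
    case True
    then show ?thesis using *[of k j] by simp
  next
    case False
    then have "P ^ k - P ^ j \<ge> P ^ (k - 1)" using *[of j k] jk by simp
    moreover have "P ^ (k - 1) \<ge> 1" using P by simp
    ultimately show ?thesis using False by simp
  qed
qed

lemma lagrange_factor_le:
  assumes P2: "P \<ge> 2" and r: "r \<ge> J"
  shows "\<bar>lagrange_factor {..<J} k r\<bar> \<le> P ^ (J * r) / P ^ (\<Sum>j\<in>{Suc k..<J}. j - 1)"
proof -
  have "\<bar>lagrange_factor {..<J} k r\<bar> = (\<Prod>j\<in>{..<J} - {k}. \<bar>P ^ r - P ^ j\<bar> / \<bar>P ^ k - P ^ j\<bar>)"
    by (simp add: lagrange_factor_def abs_prod)
  also have "\<dots> \<le> (\<Prod>j\<in>{..<J} - {k}. P ^ r / P ^ (if k < j then j - 1 else 0))"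
  proof (intro prod_mono conjI frac_le)
    fix j assume j: "j \<in> {..<J} - {k}"
    then have "P ^ j \<le> P ^ r" "P ^ j > 0" using P r by (auto intro: power_increasing)
    then show "\<bar>P ^ r - P ^ j\<bar> \<le> P ^ r" by simp
    show "P ^ (if k < j then j - 1 else 0) \<le> \<bar>P ^ k - P ^ j\<bar>"
      using abs_power_diff_ge[OF P2] j by blast
  qed (use P in auto)
  also have "\<dots> = P ^ (r * card ({..<J} - {k})) / P ^ (\<Sum>j\<in>{..<J} - {k}. if k < j then j - 1 else 0)"
    by (simp add: prod_dividef power_sum power_mult)
  also have "(\<Sum>j\<in>{..<J} - {k}. if k < j then j - 1 else 0) = (\<Sum>j\<in>{Suc k..<J}. j - 1)"
    by (intro sum.mono_neutral_cong_right) auto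
  also have "P ^ (r * card ({..<J} - {k})) / P ^ (\<Sum>j\<in>{Suc k..<J}. j - 1) \<le> P ^ (J * r) / P ^ (\<Sum>j\<in>{Suc k..<J}. j - 1)"
  proof (intro divide_right_mono power_increasing)
    have "card ({..<J} - {k}) \<le> card {..<J}" by (intro card_mono) auto
    then show "r * card ({..<J} - {k}) \<le> J * r" by (simp add: mult.commute)
  qed (use P in auto)
  finally show ?thesis .
qed

text \<open>With \<open>J = 2 * b\<close> nodes the Lagrange denominator has exponent about
  \<open>2 * b^2\<close>, while the moment of the error has exponent about \<open>b^2\<close>. For
  large \<open>b\<close> the difference still covers the extra \<open>b\<close>, which makes the
  error tend to 0.\<close>

lemma exponent_gap:
  fixes b d k :: nat
  assumes b: "b \<ge> 8 + 4 * (d + 1) + k"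
  shows "(b + d + 1) * (b + d + 1) + b \<le> (\<Sum>j\<in>{Suc k..<2 * b}. j - 1)"
proof -
  \<comment> \<open>The closed form is doubled and taken over the integers, to avoid both division
    and truncated subtraction.\<close>
  have s: "(\<Sum>j\<in>{Suc k..<n}. int (j - 1)) * 2 = int n * int n - 3 * int n + 2 - int k * int k + int k" if "n \<ge> Suc k" for n
    using that
  proof (induction rule: dec_induct)
    case (step n)
    have "int (n - 1) = int n - 1" using step by simp
    then show ?case using step by (simp add: algebra_simps)
  qed (simp add: algebra_simps)
  define B D k' where "B = int b" and "D = int d + 1" and "k' = int k"
  have "2 * ((b + d + 1) * (b + d + 1) + b) \<le> 2 * (\<Sum>j\<in>{Suc k..<2 * b}. j - 1)"
  proof -
    have b': "B \<ge> 8 + 4 * D + k'" and nn: "B \<ge> 0" "D \<ge> 0" "k' \<ge> 0"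
      using b by (simp_all add: B_def D_def k'_def)
    have "B * B \<ge> B * (8 + 4 * D + k')" using b' nn by (intro mult_left_mono) auto
    then have "8 * B + 4 * (B * D) + B * k' \<le> B * B" by (simp add: algebra_simps)
    moreover have "B * D \<ge> D * D" "B * k' \<ge> k' * k'" using b' nn by (intro mult_right_mono; simp)+
    moreover have "B * k' \<ge> 0" "B * D \<ge> 0" using nn by simp_all
    ultimately have "2 * (B * B) + 4 * (B * D) + 2 * (D * D) + 2 * B \<le> 4 * (B * B) - 6 * B + 2 - k' * k' + k'"
      using nn by linarith
    then have "2 * ((B + D) * (B + D) + B) \<le> 2 * B * (2 * B) - 3 * (2 * B) + 2 - k' * k' + k'"
      by (simp add: algebra_simps)
    also have "\<dots> = (\<Sum>j\<in>{Suc k..<2 * b}. int (j - 1)) * 2" using s[of "2 * b"] b by (simp add: B_def k'_def)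
    finally have "int (2 * ((b + d + 1) * (b + d + 1) + b)) \<le> int (2 * (\<Sum>j\<in>{Suc k..<2 * b}. j - 1))"
      by (simp add: B_def D_def algebra_simps)
    then show ?thesis by (simp only: of_nat_le_iff)
  qed
  then show ?thesis by simp
qed

text \<open>The majorant \<open>h\<close> of the error is a multiple of a single moment in the first
  rank. Its average over fields is thus known in the limit, and its chain expectation is small
  uniformly in \<open>R\<close>.\<close>

lemma indicator_approximation:
  assumes P2: "P \<ge> 2" and ms: "ms \<in> rank_lists (Suc l)" and e: "e > 0"
  obtains g h where "moment_span (Suc l) g" "moment_span (Suc l) h"
    "\<And>rs. rs \<in> rank_lists (Suc l) \<Longrightarrow> \<bar>of_bool (rs = ms) - g rs\<bar> \<le> h rs"
    "\<And>R. chain_exp u (Suc l) R h \<le> e"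
proof -
  obtain f where f: "moment_span (Suc l) f"
    "\<And>rs. rs \<in> rank_lists (Suc l) \<Longrightarrow> hd0 rs = hd0 ms \<Longrightarrow> f rs = of_bool (rs = ms)"
    using exists_indicator_given_hd[OF ms] by blast
  obtain C D where CD: "C \<ge> 0" "\<And>rs. rs \<in> rank_lists (Suc l) \<Longrightarrow> \<bar>f rs\<bar> \<le> C * P ^ (D * hd0 rs)"
    using moment_span_bound[OF f(1)] by blast
  let ?k = "hd0 ms"
  obtain b0 where b0: "2 * C / e < P ^ b0" using real_arch_pow[OF P] by blast
  \<comment> \<open>The bracket is what \<open>exponent_gap\<close> requires, and it puts
    \<open>?k\<close> below \<open>2 * b\<close>, among the nodes; \<open>b0\<close> makes the final
    bound \<open>2 * C / P ^ b\<close> at most \<open>e\<close>.\<close>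
  define b where "b = b0 + (8 + 4 * (D + 1) + ?k)"
  let ?J = "2 * b" and ?den = "\<Sum>j\<in>{Suc ?k..<2 * b}. j - 1"
  define g where "g = (\<lambda>rs. lagrange_factor {..<?J} ?k (sum_list (take 1 rs)) * f rs)"
  \<comment> \<open>The error has exponent \<open>(2 * b + D) * hd0 rs\<close>. It is raised to
    \<open>2 * (b + D) * hd0 rs\<close>, the even form treated by
    \<open>chain_exp_hd_power_le\<close>.\<close>
  define h where "h = (\<lambda>rs. C / P ^ ?den * P ^ (2 * (b + D) * hd0 rs))"
  have hd_sum: "sum_list (take 1 rs) = hd0 rs" for rs by (cases rs) auto
  have g: "moment_span (Suc l) g"
    unfolding g_def by (intro moment_span_mult moment_span_lagrange_factor f(1)) auto
  have h: "moment_span (Suc l) h"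
  proof -
    have "(\<lambda>rs. C / P ^ ?den * (\<Prod>i<2 * (b + D). P ^ sum_list (take 1 rs))) = h"
      unfolding h_def hd_sum by (simp add: power_mult[symmetric] mult.commute)
    moreover have "moment_span (Suc l) (\<lambda>rs. C / P ^ ?den * (\<Prod>i<2 * (b + D). P ^ sum_list (take 1 rs)))"
      by (intro moment_span.scale moment_span_prod moment_span_partial_sum) auto
    ultimately show ?thesis by simp
  qed
  have h_nonneg: "h rs \<ge> 0" for rs using CD(1) P by (simp add: h_def)
  have approx: "\<bar>of_bool (rs = ms) - g rs\<bar> \<le> h rs" if rs: "rs \<in> rank_lists (Suc l)" for rs
  proof (cases "hd0 rs < ?J")
    case True
    then have "lagrange_factor {..<?J} ?k (hd0 rs) = of_bool (hd0 rs = ?k)"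
      by (intro lagrange_factor_eq) auto
    then have "g rs = of_bool (hd0 rs = ?k) * f rs" by (simp only: g_def hd_sum)
    also have "\<dots> = of_bool (rs = ms)" using f(2)[OF rs] by (cases "hd0 rs = ?k") auto
    finally show ?thesis using h_nonneg by simp
  next
    case False
    then have ne: "rs \<noteq> ms" using b_def by auto
    have "\<bar>g rs\<bar> = \<bar>lagrange_factor {..<?J} ?k (hd0 rs)\<bar> * \<bar>f rs\<bar>"
      by (simp add: g_def hd_sum abs_mult del: One_nat_def)
    also have "\<dots> \<le> (P ^ (?J * hd0 rs) / P ^ ?den) * (C * P ^ (D * hd0 rs))"
      using False P by (intro mult_mono lagrange_factor_le[OF P2] CD(2) rs) auto
    also have "\<dots> = C / P ^ ?den * P ^ ((2 * b + D) * hd0 rs)" by (simp add: power_add distrib_right)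
    also have "\<dots> \<le> h rs"
      unfolding h_def using CD(1) P by (intro mult_left_mono power_increasing mult_right_mono) auto
    finally show ?thesis using ne by simp
  qed
  have "chain_exp u (Suc l) R h \<le> e" for R
  proof -
    have "chain_exp u (Suc l) R h = C / P ^ ?den * chain_exp u (Suc l) R (\<lambda>rs. P ^ (2 * (b + D) * hd0 rs))"
      unfolding h_def by (rule chain_exp_cmult)
    also have "\<dots> \<le> C / P ^ ?den * (2 * P ^ ((b + D + 1) * (b + D + 1)))"
      using CD(1) P by (intro mult_left_mono chain_exp_hd_power_le[OF P2]) auto
    also have "\<dots> \<le> C / P ^ ((b + D + 1) * (b + D + 1) + b) * (2 * P ^ ((b + D + 1) * (b + D + 1)))"
      using CD(1) P exponent_gap[of D ?k b]
      by (intro mult_right_mono divide_left_mono power_increasing) (auto simp: b_def)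
    also have "\<dots> = 2 * C / P ^ b" using P by (simp add: power_add)
    also have "\<dots> \<le> 2 * C / P ^ b0"
      using CD(1) P by (intro divide_left_mono power_increasing) (auto simp: b_def)
    also have "\<dots> \<le> e" using b0 e P by (simp add: field_simps)
    finally show ?thesis .
  qed
  then show ?thesis using that g h approx by blast
qed

text \<open>The limits of \<open>E\<close> and of the chain are built in parallel, so their equality
  has to be checked on single moments only.\<close>

lemma moment_span_common_limit:
  fixes E :: "'x \<Rightarrow> (nat list \<Rightarrow> real) \<Rightarrow> real"
  assumes add: "\<And>x f g. E x (\<lambda>rs. f rs + g rs) = E x f + E x g"
    and scale: "\<And>x c f. E x (\<lambda>rs. c * f rs) = c * E x f"
    and mom: "\<And>ns. ns \<in> rank_lists l \<Longrightarrow> ((\<lambda>x. E x (moment ns)) \<longlongrightarrow> (\<Sum>k\<le>hd0 ns. mcoeff u ns k)) F"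
    and f: "moment_span l f"
  shows "\<exists>L. ((\<lambda>x. E x f) \<longlongrightarrow> L) F \<and> (\<lambda>R. chain_exp u l R f) \<longlonglongrightarrow> L"
  using f
proof induction
  case (moment ns)
  then have "\<forall>x\<in>set ns. x \<le> hd0 ns" by (cases ns) (auto simp: rank_lists_def)
  then have "(\<lambda>R. chain_exp u l R (moment ns)) \<longlonglongrightarrow> (\<Sum>k\<le>hd0 ns. mcoeff u ns k)"
    using chain_exp_moment_tendsto[of ns "hd0 ns" u] moment by (auto simp: rank_lists_def)
  then show ?case using mom[OF moment] by blast
next
  case (add f g)
  then obtain L L' where "((\<lambda>x. E x f) \<longlongrightarrow> L) F" "(\<lambda>R. chain_exp u l R f) \<longlonglongrightarrow> L"
    "((\<lambda>x. E x g) \<longlongrightarrow> L') F" "(\<lambda>R. chain_exp u l R g) \<longlonglongrightarrow> L'" by blast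
  then show ?case unfolding assms(1) chain_exp_add
    by (intro exI[of _ "L + L'"] conjI tendsto_add)
next
  case (scale f c)
  then obtain L where "((\<lambda>x. E x f) \<longlongrightarrow> L) F" "(\<lambda>R. chain_exp u l R f) \<longlonglongrightarrow> L" by blast
  then show ?case unfolding assms(2) chain_exp_cmult
    by (intro exI[of _ "c * L"] conjI tendsto_mult_left)
qed

text \<open>The indicator lies between \<open>g - h\<close> and \<open>g + h\<close>. Linearity and
  monotonicity carry this over to \<open>E\<close> and to the chain, where \<open>g\<close> and
  \<open>h\<close> have the same limits.\<close>

theorem moment_determinacy:
  fixes E :: "'x \<Rightarrow> (nat list \<Rightarrow> real) \<Rightarrow> real"
  assumes P2: "P \<ge> 2"
    and add: "\<And>x f g. E x (\<lambda>rs. f rs + g rs) = E x f + E x g"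
    and scale: "\<And>x c f. E x (\<lambda>rs. c * f rs) = c * E x f"
    and mono: "\<And>x f g. (\<And>rs. rs \<in> rank_lists (Suc l) \<Longrightarrow> f rs \<le> g rs) \<Longrightarrow> E x f \<le> E x g"
    and mom: "\<And>ns. ns \<in> rank_lists (Suc l) \<Longrightarrow>
       ((\<lambda>x. E x (moment ns)) \<longlongrightarrow> (\<Sum>k\<le>hd0 ns. mcoeff u ns k)) F"
    and ms: "ms \<in> rank_lists (Suc l)" and c: "(\<lambda>R. chain_prob u R ms) \<longlonglongrightarrow> c"
  shows "((\<lambda>x. E x (\<lambda>rs. of_bool (rs = ms))) \<longlongrightarrow> c) F"
proof (rule tendstoI)
  fix e :: real assume "e > 0"
  let ?I = "\<lambda>rs. of_bool (rs = ms) :: real"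
  \<comment> \<open>Four contributions of at most \<open>e / 4\<close>: the limit \<open>Lh\<close>,
    once for \<open>E\<close> and once for the chain, and the distances of \<open>E x g\<close> and
    \<open>E x h\<close> from their limits.\<close>
  have "e / 4 > 0" using \<open>e > 0\<close> by simp
  then obtain g h where gh: "moment_span (Suc l) g" "moment_span (Suc l) h"
    "\<And>rs. rs \<in> rank_lists (Suc l) \<Longrightarrow> \<bar>?I rs - g rs\<bar> \<le> h rs"
    "\<And>R. chain_exp u (Suc l) R h \<le> e / 4"
    using indicator_approximation[OF P2 ms] by blast
  obtain Lg where Lg: "((\<lambda>x. E x g) \<longlongrightarrow> Lg) F" "(\<lambda>R. chain_exp u (Suc l) R g) \<longlonglongrightarrow> Lg"
    using moment_span_common_limit[OF add scale mom gh(1)] by blast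
  obtain Lh where Lh: "((\<lambda>x. E x h) \<longlongrightarrow> Lh) F" "(\<lambda>R. chain_exp u (Suc l) R h) \<longlonglongrightarrow> Lh"
    using moment_span_common_limit[OF add scale mom gh(2)] by blast
  have Lh_le: "Lh \<le> e / 4" using Lh(2) gh(4) by (intro LIMSEQ_le_const2) auto
  have sandwich: "?I rs \<le> g rs + h rs" "g rs \<le> ?I rs + h rs" if "rs \<in> rank_lists (Suc l)" for rs
    using gh(3)[OF that] by linarith+
  have cI: "chain_exp u (Suc l) R ?I = chain_prob u R ms" for R
    using chain_exp_indicator[of u ms R] ms by (simp add: rank_lists_def)
  have "chain_prob u R ms \<le> chain_exp u (Suc l) R g + chain_exp u (Suc l) R h" for R
    unfolding cI[symmetric] chain_exp_add[symmetric]
    by (rule chain_exp_mono, rule sandwich) (simp add: rank_lists_def)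
  then have up: "c \<le> Lg + Lh" by (intro LIMSEQ_le[OF c tendsto_add[OF Lg(2) Lh(2)]]) auto
  have "chain_exp u (Suc l) R g \<le> chain_prob u R ms + chain_exp u (Suc l) R h" for R
    unfolding cI[symmetric] chain_exp_add[symmetric]
    by (rule chain_exp_mono, rule sandwich) (simp add: rank_lists_def)
  then have lo: "Lg \<le> c + Lh" by (intro LIMSEQ_le[OF Lg(2) tendsto_add[OF c Lh(2)]]) auto
  have "\<forall>\<^sub>F x in F. dist (E x g) Lg < e / 4" "\<forall>\<^sub>F x in F. dist (E x h) Lh < e / 4"
    using tendstoD[OF Lg(1)] tendstoD[OF Lh(1)] \<open>e / 4 > 0\<close> by blast+
  then show "\<forall>\<^sub>F x in F. dist (E x ?I) c < e"
  proof eventually_elim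
    case (elim x)
    have "E x ?I \<le> E x g + E x h" "E x g \<le> E x ?I + E x h"
      unfolding add[symmetric] by (rule mono, rule sandwich, assumption)+
    then show ?case using elim up lo Lh_le unfolding dist_real_def by linarith
  qed
qed

end

section \<open>Averages over number fields\<close>

definition fields_below :: "complex set set \<Rightarrow> real \<Rightarrow> complex set set" where
  "fields_below \<K> X = {K \<in> \<K>. real_of_int \<bar>disc K\<bar> < X}"

definition avg_below :: "complex set set \<Rightarrow> real \<Rightarrow> (complex set \<Rightarrow> real) \<Rightarrow> real" where
  "avg_below \<K> X f = (\<Sum>K\<in>fields_below \<K> X. f K) / card (fields_below \<K> X)"

text \<open>
  Sums over infinite sets are 0, so in \<open>has_average\<close> only those \<open>X\<close> matter for which the set
  of fields is finite and nonempty.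
\<close>

definition counting_filter :: "complex set set \<Rightarrow> real filter" where
  "counting_filter \<K> = inf at_top (principal {X. finite (fields_below \<K> X) \<and> fields_below \<K> X \<noteq> {}})"

lemma has_average_iff:
  "has_average \<K> f c \<longleftrightarrow> ((\<lambda>X. avg_below \<K> X (\<lambda>K. f (class_group K))) \<longlongrightarrow> c) (counting_filter \<K>)"
proof -
  let ?S = "fields_below \<K>" and ?A = "\<lambda>X. avg_below \<K> X (\<lambda>K. f (class_group K))"
  let ?G = "{X. finite (?S X) \<and> ?S X \<noteq> {}}"
  have ha: "has_average \<K> f c \<longleftrightarrow> (\<exists>\<epsilon> :: real \<Rightarrow> real. (\<epsilon> \<longlongrightarrow> 0) at_top \<and>
        (\<forall>X. (\<Sum>K\<in>?S X. f (class_group K)) = (c + \<epsilon> X) * real (card (?S X))))"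
    by (simp add: has_average_def fields_below_def)
  show ?thesis
  proof
    assume "has_average \<K> f c"
    then obtain \<epsilon> :: "real \<Rightarrow> real" where e: "(\<epsilon> \<longlongrightarrow> 0) at_top"
      "\<And>X. (\<Sum>K\<in>?S X. f (class_group K)) = (c + \<epsilon> X) * real (card (?S X))"
      unfolding ha by blast
    have "((\<lambda>X. c + \<epsilon> X) \<longlongrightarrow> c + 0) at_top" by (intro tendsto_add tendsto_const e(1))
    then have "((\<lambda>X. c + \<epsilon> X) \<longlongrightarrow> c) (counting_filter \<K>)"
      unfolding counting_filter_def by (simp add: tendsto_mono[OF inf_le1])
    moreover have "\<forall>\<^sub>F X in counting_filter \<K>. c + \<epsilon> X = ?A X"
      unfolding counting_filter_def eventually_inf_principal
      by (intro always_eventually) (auto simp: avg_below_def e(2))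
    ultimately show "(?A \<longlongrightarrow> c) (counting_filter \<K>)" by (rule Lim_transform_eventually)
  next
    assume lim: "(?A \<longlongrightarrow> c) (counting_filter \<K>)"
    \<comment> \<open>Outside \<open>?G\<close> both sides of the defining equation are 0, as sums
      over and cardinalities of infinite or empty sets. The value 0 there keeps the limit.\<close>
    define \<epsilon> where "\<epsilon> = (\<lambda>X. if X \<in> ?G then ?A X - c else 0)"
    have "(\<epsilon> \<longlongrightarrow> 0) at_top"
    proof (rule tendstoI)
      fix r :: real assume "r > 0"
      then have "\<forall>\<^sub>F X in counting_filter \<K>. dist (?A X) c < r" using tendstoD[OF lim] by blast
      then have "\<forall>\<^sub>F X in at_top. X \<in> ?G \<longrightarrow> dist (?A X) c < r"
        unfolding counting_filter_def eventually_inf_principal by simp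
      then show "\<forall>\<^sub>F X in at_top. dist (\<epsilon> X) 0 < r"
        by eventually_elim (use \<open>r > 0\<close> in \<open>auto simp: \<epsilon>_def dist_real_def\<close>)
    qed
    moreover have "(\<Sum>K\<in>?S X. f (class_group K)) = (c + \<epsilon> X) * real (card (?S X))" for X
      by (cases "X \<in> ?G") (auto simp: \<epsilon>_def avg_below_def)
    ultimately show "has_average \<K> f c" unfolding ha by blast
  qed
qed

lemma avg_below_cong:
  "(\<And>K. K \<in> \<K> \<Longrightarrow> f K = g K) \<Longrightarrow> avg_below \<K> X f = avg_below \<K> X g"
  unfolding avg_below_def by (intro arg_cong2[of _ _ _ _ "(/)"] sum.cong) (auto simp: fields_below_def)

definition rk_list :: "nat \<Rightarrow> nat \<Rightarrow> complex set \<Rightarrow> nat list" where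
  "rk_list p l K = map (\<lambda>j. rk p j (class_group K)) [1..<Suc l]"

lemma rk_list_rank_lists:
  assumes K: "number_field K" and p: "prime p"
  shows "rk_list p l K \<in> rank_lists l"
proof -
  interpret comm_group "class_group K" by (rule comm_group_class_group[OF K])
  have mono: "rk p j (class_group K) \<le> rk p i (class_group K)" if "1 \<le> i" "i \<le> j" for i j
    using that(2,1)
  proof (induction rule: dec_induct)
    case (step n)
    then show ?case using rk_antimono[OF finite_class_group[OF K] p, of n] by simp
  qed simp
  have "sorted_wrt (\<ge>) (rk_list p l K)"
    unfolding rk_list_def sorted_wrt_map
    by (rule sorted_wrt_mono_rel[of _ "(<)"]) (auto intro: mono simp del: upt_Suc)
  then show ?thesis by (simp add: rank_lists_def rk_list_def)
qed

context cohen_lenstra_chain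
begin

section \<open>The closed form of the limiting probability\<close>

lemma chain_weight_map:
  assumes "a \<le> l"
  shows "chain_weight u (mu a) (map mu [Suc a..<Suc l]) =
    (\<Prod>j=Suc a..l. q ^ (mu j * mu j + u * mu j)) / (\<Prod>j=a..<l. qf (mu j - mu (j + 1)))"
  using assms
proof (induction "l - a" arbitrary: a)
  case (Suc d)
  then have "[Suc a..<Suc l] = Suc a # [Suc (Suc a)..<Suc l]" by (simp add: upt_conv_Cons del: upt_Suc)
  moreover have "(\<Prod>j=Suc a..l. q ^ (mu j * mu j + u * mu j)) =
      q ^ (mu (Suc a) * mu (Suc a) + u * mu (Suc a)) * (\<Prod>j=Suc (Suc a)..l. q ^ (mu j * mu j + u * mu j))"
    using Suc by (intro prod.atLeast_Suc_atMost) simp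
  moreover have "(\<Prod>j=a..<l. qf (mu j - mu (j + 1))) = qf (mu a - mu (Suc a)) * (\<Prod>j=Suc a..<l. qf (mu j - mu (j + 1)))"
    using Suc prod.atLeast_Suc_lessThan[of a l "\<lambda>j. qf (mu j - mu (j + 1))"] by simp
  ultimately show ?case using Suc.hyps(1)[of "Suc a"] Suc.hyps(2) Suc.prems by (simp del: upt_Suc)
qed simp

lemma chain_limit_eq:
  assumes l: "l \<ge> 1" and mu: "mu (l + 1) = 0"
  defines "ms \<equiv> map mu [1..<Suc l]"
  shows "qpoch_inf (q ^ (u + last ms + 1)) q / qf (last ms) * (q ^ (hd ms * hd ms + u * hd ms) * chain_weight u (hd ms) (tl ms))
    = qpoch_inf (1 / P ^ (u + mu l + 1)) (1 / P) /
      (P ^ ((\<Sum>j = 1..l. (mu j)\<^sup>2) + u * (\<Sum>j = 1..l. mu j)) *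
               (\<Prod>j = 1..l. qpoch (1 / P) (1 / P) (mu j - mu (j + 1))))"
proof -
  have u1: "[1..<Suc l] = 1 # [2..<Suc l]" using l by (simp add: upt_conv_Cons numeral_2_eq_2 del: upt_Suc)
  have u2: "[1..<Suc l] = [1..<l] @ [l]" using l by simp
  have ms: "ms = mu 1 # map mu [2..<Suc l]" "last ms = mu l"
    unfolding ms_def by (simp only: u1 list.map, simp only: u2 list.map map_append last_snoc)
  have "q ^ (mu 1 * mu 1 + u * mu 1) * (\<Prod>j=2..l. q ^ (mu j * mu j + u * mu j)) = (\<Prod>j=1..l. q ^ (mu j * mu j + u * mu j))"
    using l prod.atLeast_Suc_atMost[of 1 l "\<lambda>j. q ^ (mu j * mu j + u * mu j)"] by (simp add: numeral_2_eq_2)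
  also have "\<dots> = q ^ ((\<Sum>j = 1..l. (mu j)\<^sup>2) + u * (\<Sum>j = 1..l. mu j))"
    by (simp add: power_sum[symmetric] sum.distrib sum_distrib_left power2_eq_square)
  finally have Q: "q ^ (mu 1 * mu 1 + u * mu 1) * (\<Prod>j=2..l. q ^ (mu j * mu j + u * mu j)) = \<dots>" .
  \<comment> \<open>The factor \<open>j = l\<close> is \<open>qf (mu l)\<close> because
    \<open>mu (l + 1) = 0\<close>; it is the denominator \<open>qf (last ms)\<close> of the
    limit.\<close>
  have "(\<Prod>j=1..l. qf (mu j - mu (j + 1))) = (\<Prod>j=1..<l. qf (mu j - mu (j + 1))) * qf (mu l)"
    using l mu by (cases l) (auto simp: atLeastLessThanSuc_atLeastAtMost[symmetric])
  then have D: "(\<Prod>j=1..<l. qf (mu j - mu (j + 1))) * qf (mu l) = (\<Prod>j=1..l. qf (mu j - mu (j + 1)))" by simp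
  have cw: "chain_weight u (mu 1) (map mu [2..<Suc l]) =
    (\<Prod>j=2..l. q ^ (mu j * mu j + u * mu j)) / (\<Prod>j=1..<l. qf (mu j - mu (j + 1)))"
    using chain_weight_map[OF l, of u mu] by (simp add: numeral_2_eq_2 del: upt_Suc)
  have "qpoch_inf (q ^ (u + last ms + 1)) q / qf (last ms) * (q ^ (hd ms * hd ms + u * hd ms) * chain_weight u (hd ms) (tl ms))
    = qpoch_inf (q ^ (u + mu l + 1)) q * (q ^ (mu 1 * mu 1 + u * mu 1) * (\<Prod>j=2..l. q ^ (mu j * mu j + u * mu j))) /
      ((\<Prod>j=1..<l. qf (mu j - mu (j + 1))) * qf (mu l))"
    unfolding ms(2) by (simp add: ms(1) cw del: upt_Suc One_nat_def)
  also have "\<dots> = qpoch_inf (q ^ (u + mu l + 1)) q * q ^ ((\<Sum>j = 1..l. (mu j)\<^sup>2) + u * (\<Sum>j = 1..l. mu j)) /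
      (\<Prod>j=1..l. qf (mu j - mu (j + 1)))"
    unfolding Q D ..
  finally show ?thesis by (simp add: q_def power_one_over)
qed

end

theorem theorem3:
  fixes p u l :: nat and \<K> :: "complex set set"
  assumes "prime p" and "l \<ge> 1"
    and "\<forall>K\<in>\<K>. number_field K"
    and "\<forall>lam. is_partition lam \<and> (\<forall>i\<in>#lam. i \<le> l) \<longrightarrow>
           has_average \<K>
             (\<lambda>G. \<Prod>i = 1..l. real (card (torsion G (p ^ i))) ^ count lam i)
             (\<Sum>mu | is_partition mu \<and> partition_le mu lam.
                C_coeff p lam mu / real p ^ (u * \<Sum>\<^sub># mu))"
  shows "\<forall>mu :: nat \<Rightarrow> nat.
           (\<forall>j\<in>{1..<l}. mu (j + 1) \<le> mu j) \<and> mu (l + 1) = 0 \<longrightarrow>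
           has_probability \<K>
             (\<lambda>G. \<forall>j\<in>{1..l}. rk p j G = mu j)
             (qpoch_inf (1 / real p ^ (u + mu l + 1)) (1 / real p) /
              (real p ^ ((\<Sum>j = 1..l. (mu j)\<^sup>2) + u * (\<Sum>j = 1..l. mu j)) *
               (\<Prod>j = 1..l. qpoch (1 / real p) (1 / real p) (mu j - mu (j + 1)))))"
proof (intro allI impI)
  fix mu :: "nat \<Rightarrow> nat"
  assume mu: "(\<forall>j\<in>{1..<l}. mu (j + 1) \<le> mu j) \<and> mu (l + 1) = 0"
  have p2: "real p \<ge> 2" using prime_ge_2_nat[OF assms(1)] by simp
  interpret cohen_lenstra_chain "real p" by unfold_locales (use p2 in simp)
  obtain l' where l': "l = Suc l'" using assms(2) by (cases l) auto
  let ?ms = "map mu [1..<Suc l]" and ?F = "counting_filter \<K>"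
  let ?E = "\<lambda>X f. avg_below \<K> X (\<lambda>K. f (rk_list p l K))"
  have anti: "mu j \<le> mu i" if "1 \<le> i" "i \<le> j" "j \<le> l" for i j
    using that(2,1,3)
  proof (induction rule: dec_induct)
    case (step n)
    then show ?case using mu by (metis Suc_eq_plus1 Suc_leD atLeastLessThan_iff le_trans less_eq_Suc_le)
  qed simp
  have "sorted_wrt (\<ge>) ?ms"
    unfolding sorted_wrt_map
    by (rule sorted_wrt_mono_rel[of _ "(<)"]) (auto intro: anti simp del: upt_Suc)
  then have ms: "?ms \<in> rank_lists l" by (simp add: rank_lists_def)
  have mom: "((\<lambda>X. ?E X (moment ns)) \<longlongrightarrow> (\<Sum>k\<le>hd0 ns. mcoeff u ns k)) ?F" if ns: "ns \<in> rank_lists l" for ns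
  proof -
    \<comment> \<open>The list \<open>ns\<close>, continued by 0 at \<open>l + 1\<close>, is the
      sequence of column lengths of a partition \<open>lam\<close> with parts at most
      \<open>l\<close>. So the hypothesis for \<open>lam\<close> is the statement about the moment
      \<open>ns\<close>.\<close>
    define m where "m = (\<lambda>k. if k \<le> l then ns ! (k - 1) else 0)"
    have dec: "m (Suc k) \<le> m k" if "1 \<le> k" "k \<le> l" for k
    proof (cases "k = l")
      case False
      then have "ns ! (k - 1) \<ge> ns ! k"
        using ns that sorted_wrt_nth_less[of "(\<ge>)" ns "k - 1" k] by (auto simp: rank_lists_def)
      then show ?thesis using that by (simp add: m_def)
    qed (simp add: m_def)
    obtain lam where lam: "is_partition lam" "\<forall>i\<in>#lam. i \<le> l"
      "\<And>k. 1 \<le> k \<Longrightarrow> k \<le> Suc l \<Longrightarrow> conj_part lam k = m k"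
      using exists_mset_conj_part[of l m] dec by (auto simp: m_def)
    have cl: "conj_list l lam = ns"
      using ns by (intro nth_equalityI) (auto simp: nth_conj_list rank_lists_def lam(3) m_def)
    have B: "\<forall>x\<in>set (conj_list l lam). x \<le> hd0 ns"
      unfolding cl using ns by (cases ns) (auto simp: rank_lists_def)
    have tors: "(\<Prod>i = 1..l. real (card (torsion (class_group K) (p ^ i))) ^ count lam i) = moment ns (rk_list p l K)"
      if K: "K \<in> \<K>" for K
    proof -
      have nf: "number_field K" using assms(3) K by blast
      interpret comm_group "class_group K" by (rule comm_group_class_group[OF nf])
      have "real (card (torsion (class_group K) (p ^ i))) = real p ^ (\<Sum>j=1..i. rk p j (class_group K))" for i
        using card_torsion_prime_power[OF finite_class_group[OF nf] assms(1), of i] by simp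
      then show ?thesis
        using prod_power_count[OF lam(2), of "\<lambda>j. rk p j (class_group K)"] by (simp only: cl rk_list_def)
    qed
    have "has_average \<K> (\<lambda>G. \<Prod>i = 1..l. real (card (torsion G (p ^ i))) ^ count lam i)
        (\<Sum>mu | is_partition mu \<and> partition_le mu lam. C_coeff p lam mu / real p ^ (u * \<Sum>\<^sub># mu))"
      using assms(4) lam(1,2) by blast
    then show ?thesis
      unfolding has_average_iff sum_C_coeff[OF refl lam(1,2) B] cl
      by (simp only: avg_below_cong[OF tors] cong: avg_below_cong)
  qed
  have lim: "((\<lambda>X. ?E X (\<lambda>rs. of_bool (rs = ?ms))) \<longlongrightarrow>
      qpoch_inf (q ^ (u + last ?ms + 1)) q / qf (last ?ms) * (q ^ (hd ?ms * hd ?ms + u * hd ?ms) * chain_weight u (hd ?ms) (tl ?ms))) ?F"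
  proof (rule moment_determinacy[OF p2, where l = l'])
    show "?E X (\<lambda>rs. f rs + g rs) = ?E X f + ?E X g" for X f g
      by (simp add: avg_below_def sum.distrib add_divide_distrib)
    show "?E X (\<lambda>rs. c * f rs) = c * ?E X f" for X c f
      by (simp add: avg_below_def sum_distrib_left)
    show "?E X f \<le> ?E X g" if "\<And>rs. rs \<in> rank_lists (Suc l') \<Longrightarrow> f rs \<le> g rs" for X f g
      unfolding avg_below_def
      by (intro divide_right_mono sum_mono that)
        (use assms(3) rk_list_rank_lists[OF _ assms(1)] l' in \<open>auto simp: fields_below_def\<close>)
    show "((\<lambda>X. ?E X (moment ns)) \<longlongrightarrow> (\<Sum>k\<le>hd0 ns. mcoeff u ns k)) ?F" if "ns \<in> rank_lists (Suc l')" for ns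
      using mom that l' by simp
    show "?ms \<in> rank_lists (Suc l')" using ms l' by simp
    show "(\<lambda>R. chain_prob u R ?ms) \<longlonglongrightarrow> qpoch_inf (q ^ (u + last ?ms + 1)) q / qf (last ?ms) *
        (q ^ (hd ?ms * hd ?ms + u * hd ?ms) * chain_weight u (hd ?ms) (tl ?ms))"
      by (rule chain_prob_tendsto) (use ms l' in \<open>auto simp: rank_lists_def\<close>)
  qed
  have ind: "(of_bool (\<forall>j\<in>{1..l}. rk p j (class_group K) = mu j) :: real) = of_bool (rk_list p l K = ?ms)" for K
    by (auto simp: rk_list_def simp del: upt_Suc)
  show "has_probability \<K> (\<lambda>G. \<forall>j\<in>{1..l}. rk p j G = mu j)
             (qpoch_inf (1 / real p ^ (u + mu l + 1)) (1 / real p) /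
              (real p ^ ((\<Sum>j = 1..l. (mu j)\<^sup>2) + u * (\<Sum>j = 1..l. mu j)) *
               (\<Prod>j = 1..l. qpoch (1 / real p) (1 / real p) (mu j - mu (j + 1)))))"
    using lim mu unfolding has_probability_def has_average_iff ind
    by (simp only: chain_limit_eq[OF assms(2)])
qed

end
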